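(* Let $E \subset \mathbb{H}$ be a closed $3$-regular set, and assume that $T_{K}$ is bounded on $L^{2}(\mathcal{H}^{3}|_{E})$ for all admissible kernels $K$. Then $E$ satisfies the local symmetry condition: for every $\tau>0$ there is a constant $C_\tau>0$ such that for all $p_0 \in E$ and $R>0$, $$\int_0^R \mathcal{H}^3(\{p \in E\cap B(p_0,R) : E \text{ is not } \tau\text{-symmetric in } B(p,r)\})\,\frac{dr}{r} \leq C_\tau R^3.$$
   Context: The first Heisenberg group is $\mathbb{H} = (\mathbb{R}^{3},\cdot)$ with group law $(x,y,t)\cdot(x',y',t') = (x+x',y+y',t+t'+\tfrac12(xy'-yx'))$. Put $\|(x,y,t)\| = ((x^2+y^2)^2+16t^2)^{1/4}$ and $d(p,q) = \|q^{-1}\cdot p\|$, a metric on $\mathbb{H}$. $B(p,r)$ denotes the open $d$-ball, and Hausdorff measures $\mathcal{H}^s$, diameters and distances are taken with respect to $d$. $\mathcal{H}^{3}|_E$ is the restriction of $\mathcal{H}^3$ to $E$. An $\mathcal{H}^{3}$-measurable set $E \subset \mathbb{H}$ is $3$-regular if there is a constant $A \geq 1$ such that $r^{3}/A \leq \mathcal{H}^{3}(E \cap B(p,r)) \leq A r^{3}$ for all $p \in E$ and $0 < r \leq \operatorname{diam}(E)$. For $p=(x,y,t)$ write $\overline{p} = (-x,-y,t)$. The horizontal gradient is $\nabla_{\mathbb{H}} = (X,Y)$, where $X = \partial_x - \tfrac{y}{2}\partial_t$ and $Y = \partial_y + \tfrac{x}{2}\partial_t$ are the left-invariant horizontal vector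 fields; $\nabla_{\mathbb{H}}^{j}K$ is the collection of all $j$-fold iterated horizontal derivatives of $K$. A smooth function $K \colon \mathbb{H}\setminus\{0\} \to \mathbb{R}$ is an admissible kernel if it is horizontally antisymmetric, that is, $K(\overline{p}) = -K(p)$ for all $p \in \mathbb{H}\setminus\{0\}$, and if for every $j \in \{0,1,2,\ldots\}$ there is a constant $C(j)$ with $|\nabla_{\mathbb{H}}^{j}K(p)| \leq C(j)\|p\|^{-3-j}$ for all $p \in \mathbb{H}\setminus\{0\}$. For an admissible kernel $K$ and $\epsilon>0$ define $T_{K,\epsilon}\nu(p) = \int_{\{\|q^{-1}\cdot p\|>\epsilon\}} K(q^{-1}\cdot p)\,d\nu(q)$ for complex Borel measures $\nu$ of finite total variation. For a positive locally finite Borel measure $\mu$, "$T_K$ is bounded on $L^2(\mu)$" means that there is a constant $C \geq 1$, independent of $\epsilon>0$, such that $\|T_{K,\epsilon}(f\mu)\|_{L^2(\mu)} \leq C\|f\|_{L^2(\mu)}$ for all $f \in L^1(\mu)\cap L^2(\mu)$. Let $\pi(x,y,t) = (x,y)$. For $p,q \in \mathbb{H}$ the symmetric point of $q$ relative to $p$ is $\Sigma_p(q) = q\cdot(2\pi(p)-2\pi(q),0)$ (equivalently $\Sigma_p(q) = p\cdot\overline{p^{-1}\cdot q}$). For $\tau>0$, a closed set $E$ is $\tau$-symmetric in a ball $B(p,r)$ if for all $q_1,q_2 \in E\cap B(p,r)$ there exists $q_1' \in E\cap B(q_1,r\tau)$ such that $\operatorname{dist}(\Sigma_{q_1'}(q_2),E)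 \leq \tau r$. *)

theory Defs
  imports "HOL-Analysis.Analysis"
begin

section \<open>The Heisenberg group with the Koranyi metric\<close>

datatype heis = Heis (xcoord: real) (ycoord: real) (tcoord: real)

definition hmult :: "heis \<Rightarrow> heis \<Rightarrow> heis" (infixl \<open>\<cdot>\<close> 70) where
  "p \<cdot> q = Heis (xcoord p + xcoord q) (ycoord p + ycoord q)
     (tcoord p + tcoord q + (xcoord p * ycoord q - ycoord p * xcoord q) / 2)"

definition hzero :: heis where
  "hzero = Heis 0 0 0"

definition hinv :: "heis \<Rightarrow> heis" where
  "hinv p = Heis (- xcoord p) (- ycoord p) (- tcoord p)"

lemma hmult_assoc: "(p \<cdot> q) \<cdot> r = p \<cdot> (q \<cdot> r)"
  by (simp add: hmult_def field_simps)

lemma hmult_hzero [simp]: "hzero \<cdot> p = p" "p \<cdot> hzero = p"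
  by (simp_all add: hmult_def hzero_def)

lemma hmult_hinv [simp]: "hinv p \<cdot> p = hzero" "p \<cdot> hinv p = hzero"
  by (simp_all add: hmult_def hzero_def hinv_def)

definition hnorm :: "heis \<Rightarrow> real" where
  "hnorm p = root 4 (((xcoord p)\<^sup>2 + (ycoord p)\<^sup>2)\<^sup>2 + 16 * (tcoord p)\<^sup>2)"

lemma hnorm_ge_0 [simp]: "0 \<le> hnorm p"
  by (simp add: hnorm_def)

lemma hnorm_square: "(hnorm p)\<^sup>2 = cmod (Complex ((xcoord p)\<^sup>2 + (ycoord p)\<^sup>2) (4 * tcoord p))"
proof -
  let ?a = "((xcoord p)\<^sup>2 + (ycoord p)\<^sup>2)\<^sup>2 + 16 * (tcoord p)\<^sup>2"
  have "hnorm p = sqrt (sqrt ?a)"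
    using real_root_mult_exp[of 2 2 ?a] by (simp add: hnorm_def sqrt_def)
  then show ?thesis
    by (simp add: cmod_def power_mult_distrib)
qed

lemma hnorm_eq_0_iff: "hnorm p = 0 \<longleftrightarrow> p = hzero"
proof -
  have "hnorm p = 0 \<longleftrightarrow> (hnorm p)\<^sup>2 = 0"
    by simp
  also have "\<dots> \<longleftrightarrow> p = hzero"
    unfolding hnorm_square by (cases p) (auto simp: hzero_def complex_eq_iff sum_power2_eq_zero_iff)
  finally show ?thesis .
qed

lemma hnorm_hinv: "hnorm (hinv p) = hnorm p"
  by (simp add: hnorm_def hinv_def)

lemma hnorm_hmult: "hnorm (p \<cdot> q) \<le> hnorm p + hnorm q"
proof -
  define z where "z p = Complex (xcoord p) (ycoord p)" for p
  define w where "w p = Complex ((xcoord p)\<^sup>2 + (ycoord p)\<^sup>2) (4 * tcoord p)" for p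
  have sq: "(hnorm p)\<^sup>2 = cmod (w p)" for p
    by (simp add: hnorm_square w_def)
  have z_le: "cmod (z p) \<le> hnorm p" for p
  proof (rule power2_le_imp_le)
    have "(cmod (z p))\<^sup>2 = \<bar>Re (w p)\<bar>"
      by (simp add: z_def w_def cmod_def)
    also have "\<dots> \<le> (hnorm p)\<^sup>2"
      unfolding sq by (rule abs_Re_le_cmod)
    finally show "(cmod (z p))\<^sup>2 \<le> (hnorm p)\<^sup>2" .
  qed simp
  have "w (p \<cdot> q) = w p + w q + 2 * (cnj (z p) * z q)"
    by (simp add: w_def z_def hmult_def complex_eq_iff power2_eq_square field_simps)
  then have "cmod (w (p \<cdot> q)) \<le> cmod (w p) + cmod (w q) + cmod (2 * (cnj (z p) * z q))"
    by (metis norm_triangle_le norm_triangle_ineq add_right_mono)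
  also have "cmod (2 * (cnj (z p) * z q)) = 2 * (cmod (z p) * cmod (z q))"
    by (simp add: norm_mult)
  also have "\<dots> \<le> 2 * (hnorm p * hnorm q)"
    by (intro mult_left_mono mult_mono z_le) auto
  finally have "(hnorm (p \<cdot> q))\<^sup>2 \<le> (hnorm p + hnorm q)\<^sup>2"
    unfolding power2_sum sq[symmetric] by simp
  then show ?thesis
    by (rule power2_le_imp_le) simp
qed

instantiation heis :: metric_space
begin

definition dist_heis :: "heis \<Rightarrow> heis \<Rightarrow> real" where
  "dist p q = hnorm (hinv q \<cdot> p)"

definition uniformity_heis :: "(heis \<times> heis) filter" where
  "uniformity_heis = (INF e\<in>{0<..}. principal {(p, q). dist p q < e})"

definition open_heis :: "heis set \<Rightarrow> bool" where
  "open_heis U \<longleftrightarrow> (\<forall>p\<in>U. eventually (\<lambda>(p', q). p' = p \<longrightarrow> q \<in> U) uniformity)"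

instance
proof
  fix p q r :: heis
  show "dist p q = 0 \<longleftrightarrow> p = q"
    unfolding dist_heis_def hnorm_eq_0_iff
    by (metis hmult_assoc hmult_hinv hmult_hzero)
  have "hinv q \<cdot> p = (hinv q \<cdot> r) \<cdot> (hinv r \<cdot> p)"
    by (metis hmult_assoc hmult_hinv(2) hmult_hzero(2))
  moreover have "hinv (hinv r \<cdot> q) = hinv q \<cdot> r"
    by (simp add: hinv_def hmult_def field_simps)
  ultimately show "dist p q \<le> dist p r + dist q r"
    unfolding dist_heis_def by (metis hnorm_hmult hnorm_hinv add.commute)
qed (simp_all add: uniformity_heis_def open_heis_def)

end

section \<open>Hausdorff measures\<close>

text \<open>
  Normalized so that a set of diameter \<open>d\<close> contributes \<open>d powr s\<close>; meant for \<open>s > 0\<close>.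
  Boundedness of the covering sets is required since \<^const>\<open>diameter\<close> is unspecified on
  unbounded sets.
\<close>
definition hausdorff :: "real \<Rightarrow> 'a::metric_space set \<Rightarrow> ennreal" where
  "hausdorff s A = (SUP \<delta>\<in>{0<..}.
     INF U\<in>{U :: nat \<Rightarrow> 'a set. A \<subseteq> (\<Union>i. U i) \<and> (\<forall>i. bounded (U i) \<and> diameter (U i) \<le> \<delta>)}.
       \<Sum>i. ennreal (diameter (U i) powr s))"

text \<open>Caratheodory measurability with respect to the outer measure \<^term>\<open>hausdorff s\<close>.\<close>
definition hausdorff_measurable :: "real \<Rightarrow> 'a::metric_space set \<Rightarrow> bool" where
  "hausdorff_measurable s E \<longleftrightarrow> E \<in> lambda_system UNIV (Pow UNIV) (hausdorff s)"

text \<open>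
  The restriction of the \<open>s\<close>-dimensional Hausdorff measure to \<open>E\<close>, as a Borel measure on the whole
  space. \<^const>\<open>hausdorff\<close> is a metric outer measure, so it is countably additive on Borel sets.
\<close>
definition hausdorff_restr :: "real \<Rightarrow> 'a::metric_space set \<Rightarrow> 'a measure" where
  "hausdorff_restr s E = measure_of UNIV (sets borel) (\<lambda>A. hausdorff s (A \<inter> E))"

text \<open>For unbounded \<open>E\<close> the diameter is infinite, so all radii are admitted.\<close>
definition three_regular :: "heis set \<Rightarrow> bool" where
  "three_regular E \<longleftrightarrow> hausdorff_measurable 3 E \<and>
     (\<exists>A\<ge>1. \<forall>p\<in>E. \<forall>r>0. (bounded E \<longrightarrow> r \<le> diameter E) \<longrightarrow>
        ennreal (r ^ 3 / A) \<le> hausdorff 3 (E \<inter> ball p r) \<and>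
        hausdorff 3 (E \<inter> ball p r) \<le> ennreal (A * r ^ 3))"

section \<open>Admissible kernels\<close>

text \<open>\<open>k\<close>-fold continuous differentiability of \<open>f\<close> on an open set \<open>S\<close>.\<close>
fun C_k_on :: "nat \<Rightarrow> 'a::real_normed_vector set \<Rightarrow> ('a \<Rightarrow> 'b::real_normed_vector) \<Rightarrow> bool" where
  "C_k_on 0 S f \<longleftrightarrow> continuous_on S f"
| "C_k_on (Suc k) S f \<longleftrightarrow>
     (\<forall>x\<in>S. f differentiable (at x)) \<and> (\<forall>v. C_k_on k S (\<lambda>x. frechet_derivative f (at x) v))"

definition smooth_on :: "'a::real_normed_vector set \<Rightarrow> ('a \<Rightarrow> 'b::real_normed_vector) \<Rightarrow> bool" where
  "smooth_on S f \<longleftrightarrow> (\<forall>k. C_k_on k S f)"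

text \<open>The vector fields \<open>X = \<partial>\<^sub>x - (y/2) \<partial>\<^sub>t\<close> and \<open>Y = \<partial>\<^sub>y + (x/2) \<partial>\<^sub>t\<close>.\<close>
fun X_deriv :: "(heis \<Rightarrow> real) \<Rightarrow> heis \<Rightarrow> real" where
  "X_deriv f (Heis x y t) =
     deriv (\<lambda>s. f (Heis s y t)) x - y / 2 * deriv (\<lambda>s. f (Heis x y s)) t"

fun Y_deriv :: "(heis \<Rightarrow> real) \<Rightarrow> heis \<Rightarrow> real" where
  "Y_deriv f (Heis x y t) =
     deriv (\<lambda>s. f (Heis x s t)) y + x / 2 * deriv (\<lambda>s. f (Heis x y s)) t"

primrec horizontal_derivs :: "nat \<Rightarrow> (heis \<Rightarrow> real) \<Rightarrow> (heis \<Rightarrow> real) set" where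
  "horizontal_derivs 0 f = {f}"
| "horizontal_derivs (Suc j) f =
     X_deriv ` horizontal_derivs j f \<union> Y_deriv ` horizontal_derivs j f"

definition hbar :: "heis \<Rightarrow> heis" where
  "hbar p = Heis (- xcoord p) (- ycoord p) (tcoord p)"

text \<open>A kernel is a total function whose value at the origin is irrelevant.\<close>
definition admissible_kernel :: "(heis \<Rightarrow> real) \<Rightarrow> bool" where
  "admissible_kernel K \<longleftrightarrow>
     smooth_on (UNIV - {(0, 0, 0)}) (\<lambda>(x, y, t). K (Heis x y t)) \<and>
     (\<forall>p. p \<noteq> hzero \<longrightarrow> K (hbar p) = - K p) \<and>
     (\<forall>j. \<exists>C. \<forall>g\<in>horizontal_derivs j K. \<forall>p. p \<noteq> hzero \<longrightarrow> \<bar>g p\<bar> \<le> C / hnorm p ^ (3 + j))"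

section \<open>Truncated singular integrals\<close>

text \<open>\<open>T\<^bsub>K,\<epsilon>\<^esub>(f\<mu>)(p)\<close>, where \<open>f\<mu>\<close> is the complex measure with density \<open>f \<in> L\<^sup>1(\<mu>)\<close>.\<close>
definition T_trunc ::
    "(heis \<Rightarrow> real) \<Rightarrow> real \<Rightarrow> heis measure \<Rightarrow> (heis \<Rightarrow> complex) \<Rightarrow> heis \<Rightarrow> complex" where
  "T_trunc K \<epsilon> \<mu> f p =
     (LINT q:{q. hnorm (hinv q \<cdot> p) > \<epsilon>}|\<mu>. complex_of_real (K (hinv q \<cdot> p)) * f q)"

text \<open>The \<open>L\<^sup>2(\<mu>)\<close> norm, with values in \<open>[0, \<infinity>]\<close>.\<close>
definition L2_enorm :: "'a measure \<Rightarrow> ('a \<Rightarrow> complex) \<Rightarrow> ennreal" where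
  "L2_enorm \<mu> f = (let I = \<integral>\<^sup>+ p. ennreal ((cmod (f p))\<^sup>2) \<partial>\<mu>
     in if I = \<infinity> then \<infinity> else ennreal (sqrt (enn2real I)))"

definition T_bounded_L2 :: "(heis \<Rightarrow> real) \<Rightarrow> heis measure \<Rightarrow> bool" where
  "T_bounded_L2 K \<mu> \<longleftrightarrow> (\<exists>C::real. C \<ge> 1 \<and>
     (\<forall>\<epsilon>>0. \<forall>f. integrable \<mu> f \<longrightarrow> L2_enorm \<mu> f < \<infinity> \<longrightarrow>
        L2_enorm \<mu> (T_trunc K \<epsilon> \<mu> f) \<le> ennreal C * L2_enorm \<mu> f))"

section \<open>Symmetric points\<close>

definition sym_point :: "heis \<Rightarrow> heis \<Rightarrow> heis" where
  "sym_point p q = q \<cdot> Heis (2 * xcoord p - 2 * xcoord q) (2 * ycoord p - 2 * ycoord q) 0"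

lemma sym_point_eq: "sym_point p q = p \<cdot> hbar (hinv p \<cdot> q)"
  by (simp add: sym_point_def hbar_def hinv_def hmult_def field_simps)

definition tau_symmetric :: "real \<Rightarrow> heis set \<Rightarrow> heis \<Rightarrow> real \<Rightarrow> bool" where
  "tau_symmetric \<tau> E p r \<longleftrightarrow>
     (\<forall>q1\<in>E \<inter> ball p r. \<forall>q2\<in>E \<inter> ball p r.
        \<exists>q1'\<in>E \<inter> ball q1 (r * \<tau>). infdist (sym_point q1' q2) E \<le> \<tau> * r)"

end

theory Submission
  imports Defs
begin

text \<open>
  For a smooth bump \<open>\<psi>\<close> that is horizontally antisymmetric and supported in an annulus, every signed sum
  \<open>\<Sum>\<^sub>j \<omega>\<^sub>j 2\<^sup>-\<^sup>3\<^sup>j \<psi>(\<delta>\<^bsub>2^-j\<^esub> p)\<close>, \<open>\<omega>\<^sub>j = \<plusminus>1\<close>, is an admissible kernel. The bounds on the associated operators,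
  tested on indicators of balls and made uniform in the signs by a gliding hump argument, give a Carleson
  estimate for the square function with components \<open>g\<^sub>j(p) = \<integral> 2\<^sup>-\<^sup>3\<^sup>j \<psi>(\<delta>\<^bsub>2^-j\<^esub> (q\<^sup>-\<^sup>1 \<cdot> p)) d\<mu>(q)\<close>.

  If \<open>E\<close> is not \<open>\<tau>\<close>-symmetric in \<open>B(p,r)\<close>, as witnessed by \<open>q\<^sub>1, q\<^sub>2\<close>, take \<open>\<psi>(u) = \<phi>(u) - \<phi>(hbar u)\<close> where \<open>\<phi> \<ge> 0\<close>
  is concentrated near the rescaled \<open>q\<^sub>2\<^sup>-\<^sup>1 \<cdot> q\<^sub>1\<close>. At points of \<open>E\<close> near \<open>q\<^sub>1\<close> the positive part sees the mass of \<open>E\<close> near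
  \<open>q\<^sub>2\<close>, while the negative part would only see points of \<open>E\<close> near the symmetric points of \<open>q\<^sub>2\<close>, and there
  are none; so \<open>g\<^sub>j\<close> is bounded below there. Finitely many \<open>\<psi>\<close> suffice by compactness of the annulus, and
  summing the Carleson estimates over them bounds the set of bad points and scales.
\<close>

section \<open>Geometry of the Heisenberg group\<close>

text \<open>Signs are picked one at a time instead; were the square functions unbounded, a single
  sequence of signs would violate its own bound. Identities rather than estimates link kernels and
  scales because of gaps: the bump of scale 2^j lives well inside the shell between a 2^j and 2a
  2^j, so at each point one summand survives, and truncation at a 2^m removes whole scales. Neither
  the set of bad points nor the dependence of its measure on r is known to be measurable. Hence the
  bad set is only handled by the outer measure, and at each dyadic scale it is compared with a Borel
  set on which one of finitely many g_j is large. That set is found near q1, not at the bad point p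
  itself, so the comparison goes through balls around p of radius comparable to r. The free choice
  of q1' in the notion of symmetry provides the room: when symmetry fails, it fails for all q1' of E
  close to q1, and these carry mass comparable to r^3.\<close>

definition hdil :: "real \<Rightarrow> heis \<Rightarrow> heis" where
  "hdil l p = Heis (l * xcoord p) (l * ycoord p) (l\<^sup>2 * tcoord p)"

lemma hnorm_pow4: "hnorm p ^ 4 = ((xcoord p)\<^sup>2 + (ycoord p)\<^sup>2)\<^sup>2 + 16 * (tcoord p)\<^sup>2"
  by (simp add: hnorm_def)

lemma hnorm_hdil: "0 \<le> l \<Longrightarrow> hnorm (hdil l p) = l * hnorm p"
proof (rule power_eq_imp_eq_base[of _ 4])
  show "hnorm (hdil l p) ^ 4 = (l * hnorm p) ^ 4"
    unfolding power_mult_distrib hnorm_pow4 by (simp add: hdil_def power_mult_distrib) algebra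
qed auto

lemma hdil_hmult: "hdil l (p \<cdot> q) = hdil l p \<cdot> hdil l q"
  by (simp add: hdil_def hmult_def power2_eq_square field_simps)

lemma hdil_hinv: "hdil l (hinv p) = hinv (hdil l p)"
  by (simp add: hdil_def hinv_def)

lemma hbar_hmult: "hbar (p \<cdot> q) = hbar p \<cdot> hbar q"
  by (simp add: hbar_def hmult_def field_simps)

lemma hbar_hinv: "hbar (hinv p) = hinv (hbar p)"
  by (simp add: hbar_def hinv_def)

lemma hbar_hbar [simp]: "hbar (hbar p) = p"
  by (simp add: hbar_def)

lemma hbar_hdil: "hbar (hdil l p) = hdil l (hbar p)"
  by (simp add: hbar_def hdil_def)

lemma hnorm_hbar [simp]: "hnorm (hbar p) = hnorm p"
  by (simp add: hbar_def hnorm_def)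

lemma hinv_hinv [simp]: "hinv (hinv p) = p"
  by (simp add: hinv_def)

lemma hinv_hmult: "hinv (p \<cdot> q) = hinv q \<cdot> hinv p"
  by (simp add: hinv_def hmult_def field_simps)

lemma hinv_hmult_cancel [simp]: "hinv p \<cdot> (p \<cdot> q) = q" "p \<cdot> (hinv p \<cdot> q) = q"
  by (simp_all add: hmult_assoc[symmetric])

lemma hnorm_hzero [simp]: "hnorm hzero = 0"
  by (simp add: hnorm_eq_0_iff)

lemma hnorm_pos_iff [simp]: "0 < hnorm p \<longleftrightarrow> p \<noteq> hzero"
  using hnorm_eq_0_iff[of p] hnorm_ge_0[of p] by linarith

lemma dist_hmult_left [simp]: "dist (p \<cdot> q) (p \<cdot> r) = dist q (r::heis)"
  by (simp add: dist_heis_def hinv_hmult hmult_assoc)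

lemma dist_hbar [simp]: "dist (hbar q) (hbar r) = dist q r"
  by (simp add: dist_heis_def flip: hbar_hinv hbar_hmult)

lemma dist_hdil: "0 \<le> l \<Longrightarrow> dist (hdil l q) (hdil l r) = l * dist q r"
  by (simp add: dist_heis_def hnorm_hdil flip: hdil_hinv hdil_hmult)

lemma dist_hzero: "dist p hzero = hnorm p"
  by (simp add: dist_heis_def hinv_def hmult_def hzero_def)

lemma hnorm_dist: "\<bar>hnorm p - hnorm q\<bar> \<le> dist p q"
  using abs_dist_diff_le[of p hzero q] by (simp add: dist_commute[of hzero] dist_hzero)

lemma sym_point_dist: "dist p (sym_point p q) = dist p q"
proof -
  have "dist p (sym_point p q) = hnorm (hinv (hbar (hinv p \<cdot> q)))"
    by (simp add: dist_heis_def sym_point_eq hinv_hmult hmult_assoc)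
  also have "\<dots> = dist q p"
    by (simp add: hnorm_hinv dist_heis_def)
  finally show ?thesis by (simp add: dist_commute)
qed

lemma abs_coord_le:
  shows "\<bar>xcoord p\<bar> \<le> hnorm p" "\<bar>ycoord p\<bar> \<le> hnorm p" "4 * \<bar>tcoord p\<bar> \<le> (hnorm p)\<^sup>2"
proof -
  have sq: "(hnorm p)\<^sup>2 = cmod (Complex ((xcoord p)\<^sup>2 + (ycoord p)\<^sup>2) (4 * tcoord p))"
    by (rule hnorm_square)
  have "(xcoord p)\<^sup>2 + (ycoord p)\<^sup>2 \<le> (hnorm p)\<^sup>2"
    unfolding sq using complex_Re_le_cmod[of "Complex ((xcoord p)\<^sup>2 + (ycoord p)\<^sup>2) (4 * tcoord p)"] by simp
  then have "(xcoord p)\<^sup>2 \<le> (hnorm p)\<^sup>2" "(ycoord p)\<^sup>2 \<le> (hnorm p)\<^sup>2"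
    by (smt (verit) zero_le_power2)+
  then show "\<bar>xcoord p\<bar> \<le> hnorm p" "\<bar>ycoord p\<bar> \<le> hnorm p"
    using hnorm_ge_0 by (metis abs_le_square_iff abs_of_nonneg)+
  show "4 * \<bar>tcoord p\<bar> \<le> (hnorm p)\<^sup>2"
    unfolding sq using abs_Im_le_cmod[of "Complex ((xcoord p)\<^sup>2 + (ycoord p)\<^sup>2) (4 * tcoord p)"] by simp
qed

text \<open>\<open>dist\<close> is only left-invariant; this controls the effect of multiplying a point on the left.\<close>
lemma hnorm_conj: "hnorm (hinv w \<cdot> (v \<cdot> w)) \<le> hnorm v + 2 * sqrt (hnorm v * hnorm w)"
proof -
  define c where "c = xcoord v * ycoord w - ycoord v * xcoord w"
  \<comment> \<open>The commutator of \<open>v\<close> and \<open>w\<close> is central, so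
    conjugation changes only the vertical coordinate; the two halves from the group law add up to
    \<open>c\<close>.\<close>
  have eq: "hinv w \<cdot> (v \<cdot> w) = v \<cdot> Heis 0 0 c"
    by (simp add: hmult_def hinv_def c_def field_simps)
  have "\<bar>c\<bar> \<le> hnorm v * hnorm w"
  proof (rule power2_le_imp_le)
    let ?zv = "Complex (xcoord v) (ycoord v)" and ?zw = "Complex (xcoord w) (ycoord w)"
    have z: "cmod (Complex (xcoord p) (ycoord p)) \<le> hnorm p" for p
    proof (rule power2_le_imp_le)
      show "(cmod (Complex (xcoord p) (ycoord p)))\<^sup>2 \<le> (hnorm p)\<^sup>2"
        using complex_Re_le_cmod[of "Complex ((xcoord p)\<^sup>2 + (ycoord p)\<^sup>2) (4 * tcoord p)"]
        by (simp add: hnorm_square cmod_def)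
    qed simp
    have "\<bar>c\<bar> = \<bar>Im (cnj ?zv * ?zw)\<bar>" by (simp add: c_def)
    also have "\<dots> \<le> cmod ?zv * cmod ?zw"
      by (metis abs_Im_le_cmod complex_mod_cnj norm_mult)
    also have "\<dots> \<le> hnorm v * hnorm w" by (intro mult_mono z) auto
    finally show "\<bar>c\<bar>\<^sup>2 \<le> (hnorm v * hnorm w)\<^sup>2" by (intro power_mono) auto
  qed simp
  moreover have "hnorm (Heis 0 0 c) = 2 * sqrt \<bar>c\<bar>"
  proof (rule power_eq_imp_eq_base[of _ 4])
    have "(2 * sqrt \<bar>c\<bar>) ^ 4 = 16 * ((sqrt \<bar>c\<bar>)\<^sup>2)\<^sup>2"
      by (simp add: power4_eq_xxxx power2_eq_square)
    then show "hnorm (Heis 0 0 c) ^ 4 = (2 * sqrt \<bar>c\<bar>) ^ 4"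
      by (simp add: hnorm_pow4)
  qed auto
  ultimately show ?thesis
    using hnorm_hmult[of v "Heis 0 0 c"] unfolding eq by (smt (verit) real_sqrt_le_iff)
qed

section \<open>Topology: the Koranyi metric against Euclidean coordinates\<close>

definition of3 :: "real \<times> real \<times> real \<Rightarrow> heis" where
  "of3 = (\<lambda>(x, y, t). Heis x y t)"

text \<open>Together with \<open>continuous_on_to3\<close> this identifies the metric topology with
  the Euclidean one, so that Euclidean compactness and differentiability can be carried over to
  \<open>heis\<close>.\<close>

lemma continuous_on_of3: "continuous_on UNIV of3"
proof -
  have "continuous (at u) of3" for u
  proof -
    obtain a b c where u: "u = (a, b, c)" by (cases u)
    have "((\<lambda>v. dist (of3 v) (of3 u)) \<longlongrightarrow> 0) (at u)"
    proof -
      have "((\<lambda>v. root 4 (((fst v - a)\<^sup>2 + (fst (snd v) - b)\<^sup>2)\<^sup>2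
         + 16 * (snd (snd v) - c + (fst (snd v) * b' - fst v * a') / 2)\<^sup>2))
         \<longlongrightarrow> root 4 (((fst u - a)\<^sup>2 + (fst (snd u) - b)\<^sup>2)\<^sup>2
         + 16 * (snd (snd u) - c + (fst (snd u) * b' - fst u * a') / 2)\<^sup>2)) (at u)" for a' b'
        by (intro tendsto_intros) auto
      from this[of "-a" "-b"] show ?thesis
        unfolding u by (simp add: dist_heis_def of3_def hnorm_def hmult_def hinv_def split_def algebra_simps)
    qed
    then show ?thesis
      unfolding continuous_within tendsto_dist_iff[of of3] .
  qed
  then show ?thesis by (simp add: continuous_on_eq_continuous_at)
qed

text \<open>A closed ball at the origin is a closed subset of the continuous image of a Euclidean
  box, by \<open>abs_coord_le\<close>; left translation, an isometry, moves it to
  \<open>p\<close>.\<close>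

lemma compact_cball_heis: "compact (cball (p::heis) r)"
proof -
  have cz: "compact (cball hzero r)" for r
  proof (cases "r \<ge> 0")
    case r: True
    have "compact (of3 ` ({-r..r} \<times> {-r..r} \<times> {-r\<^sup>2..r\<^sup>2}))"
      by (intro compact_continuous_image continuous_on_subset[OF continuous_on_of3] compact_Times) auto
    moreover have "cball hzero r \<subseteq> of3 ` ({-r..r} \<times> {-r..r} \<times> {-r\<^sup>2..r\<^sup>2})"
    proof
      fix q assume "q \<in> cball hzero r"
      then have q: "hnorm q \<le> r" by (simp add: dist_commute[of hzero] dist_hzero)
      then have "(hnorm q)\<^sup>2 \<le> r\<^sup>2" by (intro power_mono) auto
      then have "\<bar>tcoord q\<bar> \<le> r\<^sup>2" using abs_coord_le(3)[of q] by linarith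
      then have "(xcoord q, ycoord q, tcoord q) \<in> {-r..r} \<times> {-r..r} \<times> {-r\<^sup>2..r\<^sup>2}"
        using q abs_coord_le[of q] by auto
      moreover have "q = of3 (xcoord q, ycoord q, tcoord q)" by (simp add: of3_def)
      ultimately show "q \<in> of3 ` ({-r..r} \<times> {-r..r} \<times> {-r\<^sup>2..r\<^sup>2})" by blast
    qed
    ultimately show ?thesis
      by (metis closed_cball compact_Int_closed inf.absorb_iff2)
  qed (auto simp: not_le)
  have "continuous_on UNIV (\<lambda>q. p \<cdot> q)"
    unfolding continuous_on_iff by auto
  then have "compact ((\<lambda>q. p \<cdot> q) ` cball hzero r)"
    using compact_continuous_image[OF continuous_on_subset[OF _ subset_UNIV] cz] by blast
  also have "(\<lambda>q. p \<cdot> q) ` cball hzero r = cball p r"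
  proof (intro set_eqI iffI)
    fix q assume "q \<in> cball p r"
    then have "hinv p \<cdot> q \<in> cball hzero r"
      using dist_hmult_left[of p hzero "hinv p \<cdot> q"] by simp
    then show "q \<in> (\<lambda>q. p \<cdot> q) ` cball hzero r"
      by (metis hinv_hmult_cancel(2) image_eqI)
  qed (use dist_hmult_left[of p hzero] in auto)
  finally show ?thesis .
qed

lemma compact_heis: "closed S \<Longrightarrow> bounded S \<Longrightarrow> compact (S :: heis set)"
  by (metis bounded_subset_cball compact_Int_closed compact_cball_heis inf.absorb_iff2)

lemma continuous_on_xcoord [continuous_intros]: "continuous_on UNIV xcoord"
  and continuous_on_ycoord [continuous_intros]: "continuous_on UNIV ycoord"
proof -
  have "dist (xcoord p) (xcoord q) \<le> dist p q" "dist (ycoord p) (ycoord q) \<le> dist p q" for p q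
  proof -
    have "xcoord (hinv q \<cdot> p) = xcoord p - xcoord q" "ycoord (hinv q \<cdot> p) = ycoord p - ycoord q"
      by (simp_all add: hmult_def hinv_def)
    then show "dist (xcoord p) (xcoord q) \<le> dist p q" "dist (ycoord p) (ycoord q) \<le> dist p q"
      using abs_coord_le(1,2)[of "hinv q \<cdot> p"] unfolding dist_heis_def dist_real_def by metis+
  qed
  then show "continuous_on UNIV xcoord" "continuous_on UNIV ycoord"
    unfolding continuous_on_iff by (meson order_le_less_trans)+
qed

text \<open>Unlike the horizontal coordinates, \<open>tcoord\<close> is not Lipschitz. The vertical
  coordinate of \<open>hinv q \<cdot> p\<close> is at most a quarter of the squared distance, and it
  differs from the difference of the \<open>tcoord\<close> values by a linear expression in the
  horizontal coordinates, already known to be continuous.\<close>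

lemma continuous_on_tcoord [continuous_intros]: "continuous_on UNIV tcoord"
proof -
  have "(tcoord \<longlongrightarrow> tcoord q) (at q)" for q
  proof -
    have x: "(xcoord \<longlongrightarrow> xcoord q) (at q)" and y: "(ycoord \<longlongrightarrow> ycoord q) (at q)"
      using continuous_on_xcoord continuous_on_ycoord
      by (auto simp: continuous_on_eq_continuous_at continuous_at)
    have d: "((\<lambda>p. (dist p q)\<^sup>2) \<longlongrightarrow> 0) (at q)"
      by (rule tendsto_eq_intros tendsto_dist tendsto_ident_at refl)+ simp
    have "((\<lambda>p. tcoord (hinv q \<cdot> p)) \<longlongrightarrow> 0) (at q)"
    proof (rule Lim_null_comparison[OF _ d])
      show "\<forall>\<^sub>F p in at q. norm (tcoord (hinv q \<cdot> p)) \<le> (dist p q)\<^sup>2"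
        using abs_coord_le(3) by (intro always_eventually allI) (smt (verit) dist_heis_def real_norm_def)
    qed
    then have "((\<lambda>p. tcoord (hinv q \<cdot> p) + tcoord q - ((- xcoord q) * ycoord p + ycoord q * xcoord p) / 2)
       \<longlongrightarrow> 0 + tcoord q - ((- xcoord q) * ycoord q + ycoord q * xcoord q) / 2) (at q)"
      by (intro tendsto_intros x y) auto
    then show ?thesis by (simp add: hmult_def hinv_def)
  qed
  then show ?thesis by (simp add: continuous_on_eq_continuous_at continuous_at)
qed

definition to3 :: "heis \<Rightarrow> real \<times> real \<times> real" where
  "to3 p = (xcoord p, ycoord p, tcoord p)"

lemma continuous_on_to3: "continuous_on UNIV to3"
  unfolding to3_def by (intro continuous_intros)

lemma of3_to3 [simp]: "of3 (to3 p) = p"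
  by (auto simp: of3_def to3_def split: prod.split)

lemma continuous_hmult_right: "continuous_on UNIV (\<lambda>p. q \<cdot> p)"
  unfolding continuous_on_iff by auto

lemma continuous_on_heisI:
  assumes "continuous_on UNIV (\<lambda>p. xcoord (f p))" "continuous_on UNIV (\<lambda>p. ycoord (f p))"
    "continuous_on UNIV (\<lambda>p. tcoord (f p))"
  shows "continuous_on UNIV f"
proof -
  have "continuous_on UNIV (\<lambda>p. of3 (xcoord (f p), ycoord (f p), tcoord (f p)))"
    by (intro continuous_on_compose2[OF continuous_on_of3] continuous_intros assms) auto
  then show ?thesis by (simp add: of3_def)
qed

lemma continuous_hdil: "continuous_on UNIV (hdil l)"
  by (rule continuous_on_heisI) (auto simp: hdil_def intro!: continuous_intros)

lemma continuous_hinv_hmult: "continuous_on UNIV (\<lambda>q. hinv q \<cdot> p)"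
  by (rule continuous_on_heisI) (auto simp: hinv_def hmult_def intro!: continuous_intros)

lemma continuous_hnorm: "continuous_on UNIV hnorm"
  unfolding continuous_on_iff
  using hnorm_dist by (metis dist_real_def order_le_less_trans)

section \<open>Hausdorff measures on Borel sets\<close>

locale metric_outer =
  fixes m :: "'a::metric_space set \<Rightarrow> ennreal"
  assumes m_empty [simp]: "m {} = 0"
    and m_mono: "A \<subseteq> B \<Longrightarrow> m A \<le> m B"
    and m_UN: "m (\<Union>i. F i) \<le> (\<Sum>i::nat. m (F i))"
    and m_separated: "0 < d \<Longrightarrow> (\<And>a b. a \<in> A \<Longrightarrow> b \<in> B \<Longrightarrow> d \<le> dist a b) \<Longrightarrow> m A + m B \<le> m (A \<union> B)"
begin

lemma m_Un: "m (A \<union> B) \<le> m A + m B"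
proof -
  let ?C = "\<lambda>i::nat. if i = 0 then A else if i = 1 then B else {}"
  have "A \<union> B = (\<Union>i. ?C i)"
    by (auto split: if_splits)
  also have "m \<dots> \<le> (\<Sum>i. m (?C i))" by (rule m_UN)
  also have "\<dots> = (\<Sum>i\<in>{0,1}. m (?C i))"
    by (rule suminf_finite) auto
  finally show ?thesis by simp
qed

lemma m_finite_UN:
  "finite P \<Longrightarrow> m (\<Union>i\<in>P. F i) \<le> (\<Sum>i\<in>P. m (F i))"
proof (induction rule: finite_induct)
  case (insert i P)
  have "m (\<Union>i\<in>insert i P. F i) \<le> m (F i) + m (\<Union>i\<in>P. F i)" using m_Un by simp
  also have "\<dots> \<le> m (F i) + (\<Sum>i\<in>P. m (F i))" by (intro add_left_mono insert.IH)
  finally show ?case using insert.hyps by simp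
qed simp

text \<open>Pairwise separation suffices: among finitely many sets the smallest gap is still
  positive, so the last set is separated from the union of the earlier ones.\<close>

lemma m_UN_separated:
  assumes "\<And>j i. j < i \<Longrightarrow> \<exists>d>0. \<forall>x\<in>D j. \<forall>y\<in>D (i::nat). d \<le> dist x y"
  shows "(\<Sum>i<n. m (D i)) \<le> m (\<Union>i<n. D i)"
proof (induction n)
  case (Suc n)
  have "\<exists>d>0. \<forall>x\<in>(\<Union>i<n. D i). \<forall>y\<in>D n. d \<le> dist x y"
  proof -
    have "\<forall>i\<in>{..<n}. \<exists>d. d > 0 \<and> (\<forall>x\<in>D i. \<forall>y\<in>D n. d \<le> dist x y)"
      using assms by blast
    then have "\<exists>d. \<forall>i\<in>{..<n}. d i > 0 \<and> (\<forall>x\<in>D i. \<forall>y\<in>D n. d i \<le> dist x y)"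
      by (rule bchoice)
    then obtain d where d: "\<And>i. i < n \<Longrightarrow> d i > 0 \<and> (\<forall>x\<in>D i. \<forall>y\<in>D n. d i \<le> dist x y)" by auto
    \<comment> \<open>The extra element 1 keeps \<open>Min\<close> meaningful when
      \<open>n = 0\<close>.\<close>
    let ?d = "Min (insert 1 (d ` {..<n}))"
    have "?d > 0" using d by auto
    moreover have "\<forall>x\<in>(\<Union>i<n. D i). \<forall>y\<in>D n. ?d \<le> dist x y"
    proof (intro ballI)
      fix x y assume "x \<in> (\<Union>i<n. D i)" "y \<in> D n"
      then obtain i where i: "i < n" "x \<in> D i" by auto
      have "?d \<le> d i" using i by (intro Min_le) auto
      also have "\<dots> \<le> dist x y" using d i \<open>y \<in> D n\<close> by auto
      finally show "?d \<le> dist x y" .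
    qed
    ultimately show ?thesis by blast
  qed
  then obtain d where "d > 0" "\<And>x y. x\<in>(\<Union>i<n. D i) \<Longrightarrow> y\<in>D n \<Longrightarrow> d \<le> dist x y" by blast
  from m_separated[OF this] have "m (\<Union>i<n. D i) + m (D n) \<le> m ((\<Union>i<n. D i) \<union> D n)" .
  also have "(\<Union>i<n. D i) \<union> D n = (\<Union>i<Suc n. D i)" by (auto simp: less_Suc_eq)
  finally show ?case using Suc.IH by (simp add: order_trans[OF add_right_mono])
qed simp

text \<open>Caratheodory's criterion: the shells \<open>D n\<close> around \<open>C\<close> are pairwise separated when their indices
  have the same parity, so \<open>\<Sum>n. m (D n) \<le> 2 * m A\<close> and the tails of this series vanish.\<close>
lemma closed_split:
  assumes "closed C"
  shows "m (A \<inter> C) + m (A - C) \<le> m A"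
proof (cases "C = {} \<or> m A = \<infinity>")
  case True
  then show ?thesis by auto
next
  case False
  then have C: "C \<noteq> {}" and fin: "m A < \<infinity>" by (auto simp: less_top)
  define B where "B n = {x\<in>A. 1 / real (Suc n) \<le> infdist x C}" for n
  define D where "D n = B (Suc n) - B n" for n
  have B_mono: "B n \<subseteq> B (Suc n)" for n
  proof -
    have "1 / real (Suc (Suc n)) \<le> 1 / real (Suc n)" by (simp add: field_simps)
    then show ?thesis by (force simp: B_def)
  qed
  then have incB: "mono B" by (simp add: mono_iff_le_Suc)
  have AC: "A - C \<subseteq> B n \<union> (\<Union>k. D (n + k))" for n
  proof
    fix x assume x: "x \<in> A - C"
    then have "infdist x C > 0"
      using assms C infdist_pos_not_in_closed by blast
    then obtain N where "1 / real (Suc N) < infdist x C"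
      using nat_approx_posE by blast
    then have "\<exists>N. x \<in> B N" using x by (auto simp: B_def intro!: exI[of _ N])
    define N where "N = (LEAST N. x \<in> B N)"
    have N: "x \<in> B N" using \<open>\<exists>N. x \<in> B N\<close> unfolding N_def by (rule LeastI_ex)
    show "x \<in> B n \<union> (\<Union>k. D (n + k))"
    proof (cases "N \<le> n")
      case True
      then show ?thesis using N incB by (auto simp: mono_def)
    next
      case False
      then obtain k where k: "N = Suc (n + k)" by (metis add_Suc_right less_iff_Suc_add not_less)
      then have "x \<notin> B (n + k)" using not_less_Least[of "n+k" "\<lambda>N. x \<in> B N"] by (auto simp: N_def)
      then have "x \<in> D (n + k)" using N k by (auto simp: D_def)
      then show ?thesis by auto
    qed
  qed
  \<comment> \<open>\<open>infdist\<close> is 1-Lipschitz, and between the shells \<open>D j\<close>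
    and \<open>D i\<close> lies at least the whole shell \<open>D (Suc j)\<close>; its width is the
    gap.\<close>
  have sep: "\<exists>d>0. \<forall>x\<in>D j. \<forall>y\<in>D i. d \<le> dist x y" if "Suc j < i" for i j
  proof (intro exI conjI ballI)
    show "1 / real (Suc (Suc j)) - 1 / real (Suc (Suc (Suc j))) > 0"
      by (simp add: frac_less2)
    fix x y assume x: "x \<in> D j" and y: "y \<in> D i"
    have 1: "1 / real (Suc (Suc j)) \<le> infdist x C" using x by (auto simp: D_def B_def)
    have "infdist y C < 1 / real (Suc i)" using y by (auto simp: D_def B_def)
    also have "\<dots> \<le> 1 / real (Suc (Suc (Suc j)))" using that by (simp add: field_simps)
    finally have 2: "infdist y C < 1 / real (Suc (Suc (Suc j)))" .
    have "infdist x C \<le> infdist y C + dist x y" by (rule infdist_triangle)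
    then show "1 / real (Suc (Suc j)) - 1 / real (Suc (Suc (Suc j))) \<le> dist x y" using 1 2 by linarith
  qed
  have half: "(\<Sum>i<n. m (D (2*i + b))) \<le> m A" for n b
  proof -
    have "(\<Sum>i<n. m (D (2*i + b))) \<le> m (\<Union>i<n. D (2*i + b))"
      by (rule m_UN_separated, rule sep) simp
    also have "\<dots> \<le> m A" by (rule m_mono) (auto simp: D_def B_def)
    finally show ?thesis .
  qed
  have "(\<Sum>i<n. m (D i)) \<le> m A + m A" for n
  proof -
    have "(\<Sum>i<n. m (D i)) \<le> (\<Sum>i<2*n. m (D i))" by (rule sum_mono2) auto
    also have "\<dots> = (\<Sum>i<n. m (D (2*i+0))) + (\<Sum>i<n. m (D (2*i+1)))"
      by (induction n) (auto simp: algebra_simps)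
    also have "\<dots> \<le> m A + m A" by (intro add_mono half)
    finally show ?thesis .
  qed
  then have "(\<Sum>i. m (D i)) \<le> m A + m A"
    by (intro suminf_le_const) auto
  also have "\<dots> < \<infinity>" using fin by simp
  finally have Dfin: "(\<Sum>i. m (D i)) \<noteq> \<infinity>" by simp
  then have Di: "m (D i) \<noteq> \<infinity>" for i
    using ennreal_suminf_lessD[of "\<lambda>i. m (D i)" \<infinity>] by (metis infinity_ennreal_def less_top)
  define e where "e i = enn2real (m (D i))" for i
  have me: "m (D i) = ennreal (e i)" for i using Di[of i] by (simp add: e_def less_top)
  have sume: "summable e"
    using Dfin unfolding me by (intro summable_suminf_not_top) (auto simp: e_def)
  have main: "m (A \<inter> C) + m (B n) \<le> m A" for n
  proof -
    have "m (A \<inter> C) + m (B n) \<le> m (A \<inter> C \<union> B n)"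
    proof (rule m_separated)
      show "0 < 1 / real (Suc n)" by simp
      fix a b assume "a \<in> A \<inter> C" "b \<in> B n"
      then show "1 / real (Suc n) \<le> dist a b"
        using infdist_le[of a C b] by (auto simp: B_def dist_commute)
    qed
    also have "\<dots> \<le> m A" by (rule m_mono) (auto simp: B_def)
    finally show ?thesis .
  qed
  show ?thesis
  proof (rule ennreal_le_epsilon)
    fix \<epsilon> :: real assume "\<epsilon> > 0"
    obtain n where n: "(\<Sum>k. e (k + n)) < \<epsilon>"
      using suminf_exist_split[OF \<open>\<epsilon> > 0\<close> sume] by (metis order_refl real_norm_def abs_le_D1 le_less_trans)
    have "m (A - C) \<le> m (B n) + m (\<Union>k. D (n + k))"
      using m_mono[OF AC] m_Un order_trans by blast
    also have "m (\<Union>k. D (n + k)) \<le> (\<Sum>k. m (D (n + k)))" by (rule m_UN)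
    also have "\<dots> = ennreal (\<Sum>k. e (k + n))"
      unfolding me by (subst suminf_ennreal2) (auto simp: e_def add.commute summable_iff_shift sume[unfolded e_def] intro!: sume[unfolded e_def, THEN summable_ignore_initial_segment])
    also have "\<dots> \<le> ennreal \<epsilon>" using n by (intro ennreal_leI) simp
    finally have "m (A - C) \<le> m (B n) + ennreal \<epsilon>" by (simp add: add_left_mono)
    then have "m (A \<inter> C) + m (A - C) \<le> (m (A \<inter> C) + m (B n)) + ennreal \<epsilon>"
      by (metis add.assoc add_left_mono)
    also have "\<dots> \<le> m A + ennreal \<epsilon>" by (intro add_right_mono main)
    finally show "m (A \<inter> C) + m (A - C) \<le> m A + ennreal \<epsilon>" .
  qed
qed

lemma borel_lambda_system: "sets borel \<subseteq> lambda_system UNIV (Pow UNIV) m"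
proof -
  interpret P: sigma_algebra UNIV "Pow UNIV :: 'a set set" by (rule sigma_algebra_Pow)
  have oms: "outer_measure_space (Pow UNIV) m"
    by (auto simp: outer_measure_space_def positive_def increasing_def countably_subadditive_def
        intro: m_mono m_UN)
  have "measure_space UNIV (lambda_system UNIV (Pow UNIV) m) m"
    using P.caratheodory_lemma[OF oms] by simp
  then interpret L: sigma_algebra UNIV "lambda_system UNIV (Pow UNIV) m"
    by (simp add: measure_space_def)
  have "C \<in> lambda_system UNIV (Pow UNIV) m" if "closed C" for C
  proof -
    have "m (x \<inter> C) + m (x - C) = m x" for x
      using closed_split[OF that, of x] m_Un[of "x \<inter> C" "x - C"]
      by (simp add: Int_Diff_Un antisym)
    then show ?thesis by (simp add: P.lambda_system_eq del: Pow_UNIV)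
  qed
  then show ?thesis
    unfolding borel_eq_closed
    by (subst sets_measure_of, simp) (intro L.sigma_sets_subset, auto)
qed

lemma measure_space_borel: "measure_space UNIV (sets borel) m"
proof -
  interpret P: sigma_algebra UNIV "Pow UNIV :: 'a set set" by (rule sigma_algebra_Pow)
  have oms: "outer_measure_space (Pow UNIV) m"
    by (auto simp: outer_measure_space_def positive_def increasing_def countably_subadditive_def
        intro: m_mono m_UN)
  have 1: "measure_space UNIV (lambda_system UNIV (Pow UNIV) m) m"
    using P.caratheodory_lemma[OF oms] by simp
  show ?thesis
    using 1 borel_lambda_system sets.sigma_algebra_axioms[of "borel :: 'a measure"]
    by (auto simp: measure_space_def countably_additive_def positive_def subset_iff image_subset_iff)
qed

end

section \<open>Hausdorff measures are metric outer measures\<close>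

lemma hausdorff_empty: "hausdorff s {} = 0"
proof -
  have "(INF U\<in>{U :: nat \<Rightarrow> 'a set. {} \<subseteq> (\<Union>i. U i) \<and> (\<forall>i. bounded (U i) \<and> diameter (U i) \<le> \<delta>)}.
       \<Sum>i. ennreal (diameter (U i) powr s)) = 0" if "\<delta> > 0" for \<delta>
  proof (rule antisym)
    show "(INF U\<in>{U :: nat \<Rightarrow> 'a set. {} \<subseteq> (\<Union>i. U i) \<and> (\<forall>i. bounded (U i) \<and> diameter (U i) \<le> \<delta>)}.
       \<Sum>i. ennreal (diameter (U i) powr s)) \<le> 0"
      by (rule INF_lower2[of "\<lambda>_. {}"]) (use that in auto)
  qed simp
  then show ?thesis unfolding hausdorff_def by simp
qed

lemma hausdorff_mono: "A \<subseteq> B \<Longrightarrow> hausdorff s A \<le> hausdorff s B"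
  unfolding hausdorff_def by (intro SUP_mono' INF_superset_mono) auto

text \<open>At fixed mesh \<delta>, covers of the pieces that are optimal up to e/2^(n+1) are
  enumerated together through \<open>prod_decode\<close>; the errors add up to e for every
  \<delta>.\<close>

lemma hausdorff_UN: "hausdorff s (\<Union>i::nat. A i) \<le> (\<Sum>i. hausdorff s (A i))"
proof (rule ennreal_le_epsilon)
  fix e :: real assume fin: "(\<Sum>i. hausdorff s (A i)) < top" and e: "e > 0"
  define cov where "cov \<delta> A = {U :: nat \<Rightarrow> 'a set. A \<subseteq> (\<Union>i. U i) \<and> (\<forall>i. bounded (U i) \<and> diameter (U i) \<le> \<delta>)}" for \<delta> A
  define w where "w U = ennreal (diameter U powr s)" for U :: "'a set"
  have hd: "hausdorff s A = (SUP \<delta>\<in>{0<..}. INF U\<in>cov \<delta> A. \<Sum>i. w (U i))" for A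
    by (simp add: hausdorff_def cov_def w_def)
  have "(INF U\<in>cov \<delta> (\<Union>i. A i). \<Sum>i. w (U i)) \<le> (\<Sum>i. hausdorff s (A i)) + e" if \<delta>: "\<delta> > 0" for \<delta>
  proof -
    have "\<exists>U\<in>cov \<delta> (A n). (\<Sum>i. w (U i)) \<le> hausdorff s (A n) + e * (1/2)^Suc n" for n
    proof -
      have f: "hausdorff s (A n) < top" using fin by (rule ennreal_suminf_lessD)
      have "(INF U\<in>cov \<delta> (A n). \<Sum>i. w (U i)) \<le> hausdorff s (A n)"
        unfolding hd using \<delta> by (intro SUP_upper) auto
      also have "\<dots> < hausdorff s (A n) + e * (1/2)^Suc n" using f e by (auto simp: less_top)
      finally show ?thesis by (auto simp: INF_less_iff intro: less_imp_le)
    qed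
    then obtain B where B: "\<And>n. B n \<in> cov \<delta> (A n)"
      and Ble: "\<And>n. (\<Sum>i. w (B n i)) \<le> hausdorff s (A n) + e * (1/2)^Suc n" by metis
    define C where "C = case_prod B o prod_decode"
    have "C \<in> cov \<delta> (\<Union>i. A i)"
    proof -
      have "(\<Union>i. A i) \<subseteq> (\<Union>i. C i)"
        using B by (auto simp add: C_def cov_def subset_eq) (metis prod.case prod_encode_inverse)
      moreover have "bounded (C i) \<and> diameter (C i) \<le> \<delta>" for i
        using B by (auto simp: C_def cov_def split: prod.split)
      ultimately show ?thesis by (auto simp: cov_def)
    qed
    then have "(INF U\<in>cov \<delta> (\<Union>i. A i). \<Sum>i. w (U i)) \<le> (\<Sum>i. w (C i))" by (rule INF_lower)
    also have "\<dots> = (\<Sum>i. (\<lambda>(n,k). w (B n k)) (prod_decode i))"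
      by (simp add: C_def split_def)
    also have "\<dots> = (\<Sum>n. \<Sum>i. w (B n i))"
      by (rule suminf_ennreal_2dimen) auto
    also have "\<dots> \<le> (\<Sum>n. hausdorff s (A n) + e * (1/2) ^ Suc n)"
      by (intro suminf_le allI Ble) auto
    also have "... = (\<Sum>n. hausdorff s (A n)) + (\<Sum>n. ennreal e * ennreal ((1/2) ^ Suc n))"
      using e by (subst suminf_add[symmetric])
        (auto simp del: ennreal_suminf_cmult simp add: ennreal_mult[symmetric])
    also have "\<dots> = (\<Sum>n. hausdorff s (A n)) + e"
      unfolding ennreal_suminf_cmult
      by (subst suminf_ennreal_eq[OF zero_le_power power_half_series]) auto
    finally show ?thesis .
  qed
  then show "hausdorff s (\<Union>i. A i) \<le> (\<Sum>i. hausdorff s (A i)) + ennreal e"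
    unfolding hd[of "\<Union>i. A i"] by (intro SUP_least) auto
qed

text \<open>Once the mesh is below \<open>d\<close>, no covering set meets both \<open>A\<close> and
  \<open>B\<close>, so every cover of the union splits into a cover of each without increasing the
  sum.\<close>

lemma hausdorff_separated:
  assumes d: "0 < d" and sep: "\<And>a b. a \<in> A \<Longrightarrow> b \<in> B \<Longrightarrow> d \<le> dist a b"
  shows "hausdorff s A + hausdorff s B \<le> hausdorff s (A \<union> B)"
proof -
  define cov where "cov \<delta> A = {U :: nat \<Rightarrow> 'a set. A \<subseteq> (\<Union>i. U i) \<and> (\<forall>i. bounded (U i) \<and> diameter (U i) \<le> \<delta>)}" for \<delta> A
  define w where "w U = ennreal (diameter U powr s)" for U :: "'a set"
  define h where "h \<delta> A = (INF U\<in>cov \<delta> A. \<Sum>i. w (U i))" for \<delta> A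
  have hd: "hausdorff s A = (SUP \<delta>\<in>{0<..}. h \<delta> A)" for A
    by (simp add: hausdorff_def cov_def w_def h_def)
  have anti: "h \<delta> A \<le> h \<delta>' A" if "\<delta>' \<le> \<delta>" for \<delta> \<delta>' A
    unfolding h_def using that by (intro INF_superset_mono) (auto simp: cov_def intro: order_trans)
  have w0: "w {} = 0" by (simp add: w_def)
  have small: "h \<delta> A + h \<delta> B \<le> h \<delta> (A \<union> B)" if \<delta>: "0 < \<delta>" "\<delta> < d" for \<delta>
    unfolding h_def[of \<delta> "A \<union> B"]
  proof (rule INF_greatest)
    fix U assume U: "U \<in> cov \<delta> (A \<union> B)"
    define V where "V S i = (if U i \<inter> S = {} then {} else U i)" for S i
    have V: "V S \<in> cov \<delta> S" if "S \<subseteq> A \<union> B" for S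
      using U that \<delta> unfolding cov_def V_def by (fastforce simp: subset_eq)
    have "h \<delta> A + h \<delta> B \<le> (\<Sum>i. w (V A i)) + (\<Sum>i. w (V B i))"
      unfolding h_def by (intro add_mono INF_lower V) auto
    also have "\<dots> = (\<Sum>i. w (V A i) + w (V B i))" by (simp add: suminf_add)
    also have "\<dots> \<le> (\<Sum>i. w (U i))"
    proof (intro suminf_le)
      fix i
      show "w (V A i) + w (V B i) \<le> w (U i)"
      proof (cases "U i \<inter> A = {} \<or> U i \<inter> B = {}")
        case False
        then obtain a b where ab: "a \<in> U i" "a \<in> A" "b \<in> U i" "b \<in> B" by blast
        have "d \<le> dist a b" using ab sep by blast
        also have "\<dots> \<le> diameter (U i)"
          using U ab by (intro diameter_bounded_bound) (auto simp: cov_def)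
        also have "\<dots> \<le> \<delta>" using U by (auto simp: cov_def)
        finally show ?thesis using \<delta> by simp
      qed (auto simp: V_def w0)
    qed auto
    finally show "h \<delta> A + h \<delta> B \<le> (\<Sum>i. w (U i))" .
  qed
  \<comment> \<open>\<open>h\<close> grows as the mesh shrinks, so the two suprema run over a
    directed family and may be merged.\<close>
  have "hausdorff s A + hausdorff s B = (SUP \<delta>\<in>{0<..}. h \<delta> A + h \<delta> B)"
    unfolding hd
  proof (rule SUP_add_directed_ennreal[symmetric])
    fix i j :: real assume "i \<in> {0<..}" "j \<in> {0<..}"
    then show "\<exists>k\<in>{0<..}. h i A + h j B \<le> h k A + h k B"
      by (intro bexI[of _ "min i j"] add_mono anti) auto
  qed
  also have "\<dots> \<le> hausdorff s (A \<union> B)"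
  proof (rule SUP_least)
    fix \<delta> :: real assume \<delta>: "\<delta> \<in> {0<..}"
    let ?e = "min \<delta> (d/2)"
    have "h \<delta> A + h \<delta> B \<le> h ?e A + h ?e B" by (intro add_mono anti) auto
    also have "\<dots> \<le> h ?e (A \<union> B)" using \<delta> d by (intro small) auto
    also have "\<dots> \<le> hausdorff s (A \<union> B)" unfolding hd using \<delta> d by (intro SUP_upper) auto
    finally show "h \<delta> A + h \<delta> B \<le> hausdorff s (A \<union> B)" .
  qed
  finally show ?thesis .
qed

lemma metric_outer_hausdorff: "metric_outer (\<lambda>A. hausdorff s (A \<inter> E))"
proof
  show "hausdorff s ({} \<inter> E) = 0" by (simp add: hausdorff_empty)
  show "hausdorff s (A \<inter> E) \<le> hausdorff s (B \<inter> E)" if "A \<subseteq> B" for A B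
    using that by (intro hausdorff_mono) auto
  show "hausdorff s ((\<Union>i::nat. A i) \<inter> E) \<le> (\<Sum>i. hausdorff s (A i \<inter> E))" for A
    using hausdorff_UN[of s "\<lambda>i. A i \<inter> E"] by simp
  show "hausdorff s (A \<inter> E) + hausdorff s (B \<inter> E) \<le> hausdorff s ((A \<union> B) \<inter> E)"
    if "0 < d" "\<And>a b. a \<in> A \<Longrightarrow> b \<in> B \<Longrightarrow> d \<le> dist a b" for d A B
    using hausdorff_separated[OF that(1), of "A \<inter> E" "B \<inter> E" s] that(2) by (simp add: Int_Un_distrib2)
qed

lemma sets_hausdorff_restr [simp, measurable_cong]: "sets (hausdorff_restr s E) = sets borel"
  and space_hausdorff_restr [simp]: "space (hausdorff_restr s E) = UNIV"
  unfolding hausdorff_restr_def using sets.sigma_sets_eq[of "borel :: 'a::metric_space measure"]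
  by (simp_all add: sets_measure_of_conv space_measure_of_conv)

text \<open>\<open>measure_of\<close> keeps the given set function only if it is a measure on the
  generated \<sigma>-algebra, and is zero otherwise; Caratheodory's criterion for metric outer
  measures excludes the second case.\<close>

lemma emeasure_hausdorff_restr:
  assumes "A \<in> sets borel"
  shows "emeasure (hausdorff_restr s E) A = hausdorff s (A \<inter> E)"
proof -
  interpret metric_outer "\<lambda>A. hausdorff s (A \<inter> E)" by (rule metric_outer_hausdorff)
  have ms: "measure_space UNIV (sets borel) (\<lambda>A. hausdorff s (A \<inter> E))" by (rule measure_space_borel)
  show ?thesis
    unfolding hausdorff_restr_def
    using ms assms sets.sigma_algebra_axioms[of "borel :: 'a measure"]
    by (intro emeasure_measure_of_sigma) (auto simp: measure_space_def)
qed

section \<open>An algebra of smooth functions\<close>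

text \<open>The standard flat function exp(-1/x), with powers of x in the denominator so that the
  family is closed under differentiation up to linear combinations.\<close>

definition flat :: "nat \<Rightarrow> real \<Rightarrow> real" where
  "flat n x = (if x \<le> 0 then 0 else exp (- 1 / x) / x ^ n)"

lemma flat_nonneg [simp]: "0 \<le> flat n x"
  and flat_eq_0_iff [simp]: "flat n x = 0 \<longleftrightarrow> x \<le> 0"
  by (auto simp: flat_def)

lemma flat_0_mono: "x \<le> y \<Longrightarrow> flat 0 x \<le> flat 0 y"
  by (auto simp: flat_def divide_simps)

lemma flat_tendsto_0: "(flat n \<longlongrightarrow> 0) (at 0)"
proof -
  have "((\<lambda>x::real. (inverse x) ^ n / exp (inverse x)) \<longlongrightarrow> 0) (at_right 0)"
    by (rule filterlim_compose[OF tendsto_power_div_exp_0 filterlim_inverse_at_top_right])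
  then have "(flat n \<longlongrightarrow> 0) (at_right 0)"
    by (rule Lim_transform_eventually)
      (auto simp: eventually_at_filter flat_def exp_minus field_simps)
  moreover have "(flat n \<longlongrightarrow> 0) (at_left 0)"
    by (rule Lim_transform_eventually[OF tendsto_const]) (auto simp: eventually_at_filter flat_def)
  ultimately show ?thesis by (simp add: filterlim_split_at)
qed

lemma flat_has_derivative:
  "(flat n has_real_derivative (flat (n + 2) x - real n * flat (n + 1) x)) (at x)"
proof -
  consider "x < 0" | "x = 0" | "x > 0" by linarith
  then show ?thesis
  proof cases
    case 1
    have "((\<lambda>_. 0) has_real_derivative 0) (at x)" by simp
    then have "(flat n has_real_derivative 0) (at x)"
      by (rule has_field_derivative_transform_within_open[of _ _ _ "{..<0}"]) (use 1 in \<open>auto simp: flat_def\<close>)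
    then show ?thesis using 1 by (simp add: flat_def)
  next
    case 2
    have "((\<lambda>y. (flat n y - flat n 0) / (y - 0)) \<longlongrightarrow> 0) (at 0)"
      \<comment> \<open>At the origin the difference quotient of \<open>flat n\<close> is
        \<open>flat (n + 1)\<close>, on both sides.\<close>
      by (rule Lim_transform_eventually[OF flat_tendsto_0[of "n+1"]])
        (auto simp: eventually_at_filter flat_def)
    then show ?thesis using 2 by (simp add: has_field_derivative_iff flat_def)
  next
    case 3
    have "((\<lambda>x. exp (- 1 / x) / x ^ n) has_real_derivative (flat (n + 2) x - real n * flat (n + 1) x)) (at x)"
      using 3 by (auto intro!: derivative_eq_intros)
        (cases n; simp add: flat_def field_simps power2_eq_square)
    then show ?thesis
      by (rule has_field_derivative_transform_within_open[of _ _ _ "{0<..}"]) (use 3 in \<open>auto simp: flat_def\<close>)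
  qed
qed

text \<open>A class closed under partial derivatives and polynomial changes of variables, yet rich
  enough for bumps of bounded support. Being a member replaces being smooth, and derivatives of all
  orders are treated by one induction.\<close>

inductive_set alg :: "(heis \<Rightarrow> real) set" where
  const: "(\<lambda>_. c) \<in> alg"
| xcoord: "xcoord \<in> alg"
| ycoord: "ycoord \<in> alg"
| tcoord: "tcoord \<in> alg"
| add: "f \<in> alg \<Longrightarrow> g \<in> alg \<Longrightarrow> (\<lambda>p. f p + g p) \<in> alg"
| mult: "f \<in> alg \<Longrightarrow> g \<in> alg \<Longrightarrow> (\<lambda>p. f p * g p) \<in> alg"
| flat: "f \<in> alg \<Longrightarrow> (\<lambda>p. flat n (f p)) \<in> alg"

lemma alg_diff: "f \<in> alg \<Longrightarrow> g \<in> alg \<Longrightarrow> (\<lambda>p. f p - g p) \<in> alg"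
  using alg.add[OF _ alg.mult[OF alg.const[of "-1"]]] by simp

lemma alg_power: "f \<in> alg \<Longrightarrow> (\<lambda>p. f p ^ n) \<in> alg"
  by (induction n) (auto intro: alg.const alg.mult)

lemma alg_compose:
  assumes "f \<in> alg" "(\<lambda>p. xcoord (g p)) \<in> alg" "(\<lambda>p. ycoord (g p)) \<in> alg" "(\<lambda>p. tcoord (g p)) \<in> alg"
  shows "(\<lambda>p. f (g p)) \<in> alg"
  using assms(1) by induction (auto intro: assms alg.intros)

abbreviation D3 :: "real \<Rightarrow> real \<Rightarrow> real \<Rightarrow> real \<times> real \<times> real \<Rightarrow> real" where
  "D3 a b c \<equiv> (\<lambda>h. a * fst h + b * fst (snd h) + c * snd (snd h))"

lemma D3_mult: "a * D3 x y z h + D3 x' y' z' h * b = D3 (a * x + x' * b) (a * y + y' * b) (a * z + z' * b) h"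
  by (simp add: algebra_simps)

lemma alg_has_derivative:
  assumes "f \<in> alg"
  shows "\<exists>fx\<in>alg. \<exists>fy\<in>alg. \<exists>ft\<in>alg. \<forall>u.
    ((\<lambda>u. f (of3 u)) has_derivative D3 (fx (of3 u)) (fy (of3 u)) (ft (of3 u))) (at u)"
  using assms
proof induction
  case (const c)
  show ?case by (intro bexI[of _ "\<lambda>_. 0"] alg.const) auto
next
  case xcoord
  show ?case
    by (rule bexI[of _ "\<lambda>_. 1"], rule bexI[of _ "\<lambda>_. 0"], rule bexI[of _ "\<lambda>_. 0"])
      (auto simp: of3_def split_def intro!: derivative_eq_intros alg.const)
next
  case ycoord
  show ?case
    by (rule bexI[of _ "\<lambda>_. 0"], rule bexI[of _ "\<lambda>_. 1"], rule bexI[of _ "\<lambda>_. 0"])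
      (auto simp: of3_def split_def intro!: derivative_eq_intros alg.const)
next
  case tcoord
  show ?case
    by (rule bexI[of _ "\<lambda>_. 0"], rule bexI[of _ "\<lambda>_. 0"], rule bexI[of _ "\<lambda>_. 1"])
      (auto simp: of3_def split_def intro!: derivative_eq_intros alg.const)
next
  case (add f g)
  from add.IH(1) obtain fx fy ft where af: "fx \<in> alg" "fy \<in> alg" "ft \<in> alg"
    and df: "\<And>u. ((\<lambda>u. f (of3 u)) has_derivative D3 (fx (of3 u)) (fy (of3 u)) (ft (of3 u))) (at u)"
    by blast
  from add.IH(2) obtain gx gy gt where ag: "gx \<in> alg" "gy \<in> alg" "gt \<in> alg"
    and dg: "\<And>u. ((\<lambda>u. g (of3 u)) has_derivative D3 (gx (of3 u)) (gy (of3 u)) (gt (of3 u))) (at u)"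
    by blast
  note a = af ag and d = df dg
  have "((\<lambda>u. f (of3 u) + g (of3 u)) has_derivative
     D3 (fx (of3 u) + gx (of3 u)) (fy (of3 u) + gy (of3 u)) (ft (of3 u) + gt (of3 u))) (at u)" for u
    by (rule has_derivative_eq_rhs[OF has_derivative_add[OF d]], rule ext) (simp add: algebra_simps)
  note D = this
  show ?case
    by (rule bexI[of _ "\<lambda>p. fx p + gx p"], rule bexI[of _ "\<lambda>p. fy p + gy p"], rule bexI[of _ "\<lambda>p. ft p + gt p"])
      (auto intro!: D alg.add a)
next
  case (mult f g)
  from mult.IH(1) obtain fx fy ft where af: "fx \<in> alg" "fy \<in> alg" "ft \<in> alg"
    and df: "\<And>u. ((\<lambda>u. f (of3 u)) has_derivative D3 (fx (of3 u)) (fy (of3 u)) (ft (of3 u))) (at u)"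
    by blast
  from mult.IH(2) obtain gx gy gt where ag: "gx \<in> alg" "gy \<in> alg" "gt \<in> alg"
    and dg: "\<And>u. ((\<lambda>u. g (of3 u)) has_derivative D3 (gx (of3 u)) (gy (of3 u)) (gt (of3 u))) (at u)"
    by blast
  note a = af ag and d = df dg
  have "((\<lambda>u. f (of3 u) * g (of3 u)) has_derivative
     D3 (f (of3 u) * gx (of3 u) + fx (of3 u) * g (of3 u)) (f (of3 u) * gy (of3 u) + fy (of3 u) * g (of3 u))
      (f (of3 u) * gt (of3 u) + ft (of3 u) * g (of3 u))) (at u)" for u
    by (rule has_derivative_eq_rhs[OF has_derivative_mult[OF d]], rule ext) (rule D3_mult)
  note D = this
  show ?case
    by (rule bexI[of _ "\<lambda>p. f p * gx p + fx p * g p"], rule bexI[of _ "\<lambda>p. f p * gy p + fy p * g p"],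
        rule bexI[of _ "\<lambda>p. f p * gt p + ft p * g p"])
      (auto intro!: D alg.add alg.mult a mult.hyps)
next
  case (flat f n)
  then obtain fx fy ft where a: "fx \<in> alg" "fy \<in> alg" "ft \<in> alg"
    and d: "\<And>u. ((\<lambda>u. f (of3 u)) has_derivative D3 (fx (of3 u)) (fy (of3 u)) (ft (of3 u))) (at u)"
    by blast
  define e where "e p = flat (n + 2) (f p) - real n * flat (n + 1) (f p)" for p
  have e: "e \<in> alg"
    unfolding e_def by (intro alg_diff alg.mult alg.const alg.flat flat.hyps)
  have "((\<lambda>u. flat n (f (of3 u))) has_derivative
     D3 (e (of3 u) * fx (of3 u)) (e (of3 u) * fy (of3 u)) (e (of3 u) * ft (of3 u))) (at u)" for u
    by (rule has_derivative_eq_rhs[OF has_derivative_compose[OF d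
        flat_has_derivative[unfolded has_field_derivative_def]]]) (auto simp: e_def algebra_simps)
  note D = this
  show ?case
    by (rule bexI[of _ "\<lambda>p. e p * fx p"], rule bexI[of _ "\<lambda>p. e p * fy p"],
        rule bexI[of _ "\<lambda>p. e p * ft p"])
      (auto intro!: D alg.mult a e)
qed

lemma continuous_on_alg:
  assumes "f \<in> alg"
  shows "continuous_on UNIV f"
proof -
  have "isCont (\<lambda>u. f (of3 u)) u" for u
    using alg_has_derivative[OF assms] has_derivative_continuous by blast
  then have "continuous_on UNIV (\<lambda>u. f (of3 u))"
    by (simp add: continuous_on_eq_continuous_at)
  then have "continuous_on UNIV (\<lambda>p. f (of3 (to3 p)))"
    by (rule continuous_on_compose2[OF _ continuous_on_to3]) auto
  then show ?thesis by simp
qed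

text \<open>The kernels agree with a member of \<open>alg\<close> on each annulus only, with a
  different member on each, so the criterion has to be local. In this form it passes to directional
  derivatives, which is what the induction on \<open>k\<close> needs.\<close>

lemma C_k_on_locally_alg:
  assumes "open S"
    and "\<And>u. u \<in> S \<Longrightarrow> \<exists>U g. open U \<and> u \<in> U \<and> g \<in> alg \<and> (\<forall>v\<in>U. f v = g (of3 v))"
  shows "C_k_on k S f"
  using assms(2)
proof (induction k arbitrary: f)
  case 0
  have "isCont f u" if u: "u \<in> S" for u
  proof -
    obtain U g where U: "open U" "u \<in> U" "g \<in> alg" "\<And>v. v \<in> U \<Longrightarrow> f v = g (of3 v)"
      using 0[OF u] by blast
    have "continuous_on UNIV (\<lambda>v. g (of3 v))"
      by (rule continuous_on_compose2[OF continuous_on_alg[OF U(3)] continuous_on_of3]) auto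
    then have "continuous_on U (\<lambda>v. g (of3 v))"
      by (rule continuous_on_subset) simp
    then have "continuous_on U f"
      by (rule continuous_on_eq) (simp add: U(4))
    then show ?thesis using U(1,2) continuous_on_eq_continuous_at by blast
  qed
  then show ?case by (simp add: continuous_at_imp_continuous_on)
next
  case (Suc k)
  have loc: "\<exists>U gx gy gt. open U \<and> u \<in> U \<and> gx \<in> alg \<and> gy \<in> alg \<and> gt \<in> alg \<and>
     (\<forall>v\<in>U. (f has_derivative D3 (gx (of3 v)) (gy (of3 v)) (gt (of3 v))) (at v))" if u: "u \<in> S" for u
  proof -
    obtain U g where U: "open U" "u \<in> U" "g \<in> alg" "\<And>v. v \<in> U \<Longrightarrow> f v = g (of3 v)"
      using Suc.prems[OF u] by blast
    from alg_has_derivative[OF U(3)] obtain gx gy gt where a: "gx \<in> alg" "gy \<in> alg" "gt \<in> alg"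
      and d: "\<And>u. ((\<lambda>u. g (of3 u)) has_derivative D3 (gx (of3 u)) (gy (of3 u)) (gt (of3 u))) (at u)"
      by blast
    have "(f has_derivative D3 (gx (of3 v)) (gy (of3 v)) (gt (of3 v))) (at v)" if "v \<in> U" for v
      by (rule has_derivative_transform_within_open[OF d U(1) that]) (simp add: U(4))
    then show ?thesis using U a by blast
  qed
  have "f differentiable (at u)" if "u \<in> S" for u
    using loc[OF that] by (auto simp: differentiable_def)
  moreover have "C_k_on k S (\<lambda>x. frechet_derivative f (at x) h)" for h
  proof (rule Suc.IH)
    fix u assume "u \<in> S"
    from loc[OF this] obtain U gx gy gt where U: "open U" "u \<in> U" and a: "gx \<in> alg" "gy \<in> alg" "gt \<in> alg"
     and d: "\<And>v. v \<in> U \<Longrightarrow> (f has_derivative D3 (gx (of3 v)) (gy (of3 v)) (gt (of3 v))) (at v)" by blast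
    let ?g = "\<lambda>p. gx p * fst h + gy p * fst (snd h) + gt p * snd (snd h)"
    have "?g \<in> alg" by (intro alg.add alg.mult alg.const a)
    moreover have "frechet_derivative f (at v) h = ?g (of3 v)" if "v \<in> U" for v
      using fun_cong[OF frechet_derivative_at[OF d[OF that]], of h] by simp
    ultimately show "\<exists>U g. open U \<and> u \<in> U \<and> g \<in> alg \<and> (\<forall>v\<in>U. frechet_derivative f (at v) h = g (of3 v))"
      using U by (intro exI[of _ U] exI[of _ ?g]) auto
  qed
  ultimately show ?case by simp
qed

section \<open>Dyadic scales\<close>

definition sc :: "int \<Rightarrow> real" where
  "sc j = 2 powr real_of_int j"

lemma sc_pos [simp]: "0 < sc j"
  by (simp add: sc_def)

lemma sc_nonneg [simp]: "0 \<le> sc j" and sc_neq_0 [simp]: "sc j \<noteq> 0"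
  by (simp_all add: sc_def)

lemma sc_add: "sc (i + j) = sc i * sc j"
  by (simp add: sc_def powr_add)

lemma sc_1 [simp]: "sc 1 = 2"
  by (simp add: sc_def)

lemma sc_le: "i \<le> j \<Longrightarrow> sc i \<le> sc j"
  by (simp add: sc_def)

lemma sc_less: "i < j \<Longrightarrow> 2 * sc i \<le> sc j"
  using sc_le[of "i + 1" j] by (simp add: sc_add)

lemma sc_floor:
  assumes "0 < x"
  shows "sc \<lfloor>log 2 x\<rfloor> \<le> x" "x < 2 * sc \<lfloor>log 2 x\<rfloor>"
proof -
  have "2 powr real_of_int \<lfloor>log 2 x\<rfloor> \<le> 2 powr log 2 x"
    by (intro powr_mono) auto
  then show "sc \<lfloor>log 2 x\<rfloor> \<le> x" using assms by (simp add: sc_def)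
  have "2 powr log 2 x < 2 powr (real_of_int \<lfloor>log 2 x\<rfloor> + 1)"
    by (intro powr_less_mono) linarith+
  then show "x < 2 * sc \<lfloor>log 2 x\<rfloor>" using assms by (simp add: sc_def powr_add)
qed

lemma sc_floor_unique:
  assumes "sc j \<le> x" "x < 2 * sc j"
  shows "\<lfloor>log 2 x\<rfloor> = j"
proof -
  have x: "0 < x" using assms(1) sc_pos[of j] by linarith
  show ?thesis
    using sc_floor[OF x] sc_less[of j "\<lfloor>log 2 x\<rfloor>"] sc_less[of "\<lfloor>log 2 x\<rfloor>" j] assms
    by (cases "\<lfloor>log 2 x\<rfloor>" j rule: linorder_cases) auto
qed

section \<open>Kernels assembled from dyadic dilates\<close>

text \<open>An open enlargement of the dyadic shell. The constants are half of 7/4 and twice 5/4: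
  the largest enlargement that misses the bump supports of the two neighbouring scales.\<close>

definition ann :: "real \<Rightarrow> int \<Rightarrow> heis set" where
  "ann a j = {p. 7 / 8 * (a * sc j) < hnorm p \<and> hnorm p < 5 / 2 * (a * sc j)}"

lemma open_ann: "open (ann a j)"
  unfolding ann_def by (intro open_Collect_conj open_Collect_less continuous_hnorm continuous_on_const)

lemma ann_cover:
  assumes "0 < a" "p \<noteq> hzero"
  obtains j where "p \<in> ann a j" "a * sc j \<le> hnorm p" "hnorm p < 2 * (a * sc j)"
    "\<lfloor>log 2 (hnorm p / a)\<rfloor> = j"
proof -
  define j where "j = \<lfloor>log 2 (hnorm p / a)\<rfloor>"
  have pos: "0 < hnorm p / a" using assms by simp
  have 1: "a * sc j \<le> hnorm p" "hnorm p < 2 * (a * sc j)"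
    using sc_floor[OF pos] assms(1) by (simp_all add: j_def field_simps)
  moreover have "0 < a * sc j" using assms(1) by simp
  ultimately have "p \<in> ann a j" unfolding ann_def by auto
  then show ?thesis using that 1 by (simp add: j_def)
qed

text \<open>The invariant behind the kernel estimates: on every annulus \<open>K\<close> is a
  multiple of the dilate of one fixed profile, while \<open>c\<close> records the size. A horizontal
  derivative changes the profile and divides \<open>c j\<close> by \<open>sc j\<close>.\<close>

definition scaled :: "real \<Rightarrow> (int \<Rightarrow> real) \<Rightarrow> (heis \<Rightarrow> real) \<Rightarrow> (heis \<Rightarrow> real) \<Rightarrow> bool" where
  "scaled a c \<psi> K \<longleftrightarrow> (\<forall>j. \<forall>p\<in>ann a j. K p = c j * \<psi> (hdil (1 / sc j) p))"

text \<open>The profile is bounded on the compact ball of radius 5a/2, and with the index of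
  \<open>ann_cover\<close> the scale \<open>sc j\<close> is comparable to the norm of
  \<open>p\<close>; this turns the powers of \<open>sc j\<close> into powers of
  \<open>hnorm p\<close>.\<close>

lemma scaled_bound:
  assumes a: "0 < a" and \<psi>: "\<psi> \<in> alg" and K: "scaled a c \<psi> K" and c: "\<And>j. \<bar>c j\<bar> \<le> 1 / sc j ^ m"
  shows "\<exists>C\<ge>0. \<forall>p. p \<noteq> hzero \<longrightarrow> \<bar>K p\<bar> \<le> C / hnorm p ^ m"
proof -
  have "compact (\<psi> ` cball hzero (5 / 2 * a))"
    using compact_continuous_image[OF continuous_on_subset[OF continuous_on_alg[OF \<psi>] subset_UNIV] compact_cball_heis] .
  then have "bounded (\<psi> ` cball hzero (5 / 2 * a))" by (rule compact_imp_bounded)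
  then obtain M where M: "0 < M" "\<And>p. p \<in> cball hzero (5 / 2 * a) \<Longrightarrow> \<bar>\<psi> p\<bar> \<le> M"
    by (auto simp: bounded_pos)
  have "\<bar>K p\<bar> \<le> (M * (2 * a) ^ m) / hnorm p ^ m" if "p \<noteq> hzero" for p
  proof -
    obtain j where j: "p \<in> ann a j" "a * sc j \<le> hnorm p" "hnorm p < 2 * (a * sc j)"
      using ann_cover[OF a \<open>p \<noteq> hzero\<close>] by blast
    have "hnorm (hdil (1 / sc j) p) \<le> 5 / 2 * a"
      using j a by (simp add: hnorm_hdil field_simps)
    then have "\<bar>\<psi> (hdil (1 / sc j) p)\<bar> \<le> M"
      by (intro M) (simp add: dist_commute[of hzero] dist_hzero)
    moreover have "\<bar>K p\<bar> = \<bar>c j\<bar> * \<bar>\<psi> (hdil (1 / sc j) p)\<bar>"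
      using K j(1) by (simp add: scaled_def abs_mult)
    ultimately have "\<bar>K p\<bar> \<le> (1 / sc j ^ m) * M"
      using mult_mono[OF c[of j]] by simp
    also have "1 / sc j ^ m = (2 * a) ^ m / (2 * (a * sc j)) ^ m"
      using a by (simp add: power_mult_distrib)
    also have "\<dots> \<le> (2 * a) ^ m / hnorm p ^ m"
      using j a that by (intro divide_left_mono power_mono mult_pos_pos zero_less_power) auto
    finally show ?thesis using M by (simp add: mult.commute mult_right_mono)
  qed
  then show ?thesis using M a by (intro exI[of _ "M * (2 * a) ^ m"]) auto
qed

text \<open>A horizontal coordinate derivative of the dilated profile gains \<open>1 / sc j\<close>.
  The vertical one gains the square of this, but its coefficient \<open>x / 2\<close> or
  \<open>y / 2\<close> is \<open>sc j\<close> times the corresponding coefficient at the dilated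
  point, so both terms have the same degree.\<close>

lemma scaled_XY:
  assumes a: "0 < a" and \<psi>: "\<psi> \<in> alg" and K: "scaled a c \<psi> K"
  shows "\<exists>\<psi>'\<in>alg. scaled a (\<lambda>j. c j / sc j) \<psi>' (X_deriv K)"
    and "\<exists>\<psi>'\<in>alg. scaled a (\<lambda>j. c j / sc j) \<psi>' (Y_deriv K)"
proof -
  obtain \<psi>x \<psi>y \<psi>t where al: "\<psi>x \<in> alg" "\<psi>y \<in> alg" "\<psi>t \<in> alg"
    and d: "\<And>u. ((\<lambda>u. \<psi> (of3 u)) has_derivative D3 (\<psi>x (of3 u)) (\<psi>y (of3 u)) (\<psi>t (of3 u))) (at u)"
    using alg_has_derivative[OF \<psi>] by blast
  have der: "deriv (\<lambda>s. K (Heis s y t)) x = c j * (\<psi>x (hdil (1 / sc j) (Heis x y t)) / sc j)"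
      "deriv (\<lambda>s. K (Heis x s t)) y = c j * (\<psi>y (hdil (1 / sc j) (Heis x y t)) / sc j)"
      "deriv (\<lambda>s. K (Heis x y s)) t = c j * (\<psi>t (hdil (1 / sc j) (Heis x y t)) / (sc j)\<^sup>2)"
    if p: "Heis x y t \<in> ann a j" for x y t j
  proof -
    let ?l = "1 / sc j"
    have op: "open ((\<lambda>s. of3 (f s)) -` ann a j)" if "continuous_on UNIV f" for f :: "real \<Rightarrow> real \<times> real \<times> real"
      by (intro open_vimage[OF open_ann] continuous_on_compose2[OF continuous_on_of3 that]) auto
    \<comment> \<open>The formula for \<open>K\<close> holds on the annulus only; a continuous curve
      stays in this open set for parameters near \<open>s0\<close>, which is enough for the
      derivative.\<close>
    have gen: "deriv (\<lambda>s. K (of3 (f s))) s0 = c j * D"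
      if f: "continuous_on UNIV f" and f0: "of3 (f s0) \<in> ann a j"
        and g: "((\<lambda>s. \<psi> (hdil ?l (of3 (f s)))) has_real_derivative D) (at s0)"
      for f :: "real \<Rightarrow> real \<times> real \<times> real" and s0 D
    proof -
      have "((\<lambda>s. c j * \<psi> (hdil ?l (of3 (f s)))) has_real_derivative c j * D) (at s0)"
        by (rule DERIV_cmult[OF g])
      then have "((\<lambda>s. K (of3 (f s))) has_real_derivative c j * D) (at s0)"
        by (rule has_field_derivative_transform_within_open[OF _ op[OF f]])
          (use f0 K in \<open>auto simp: scaled_def\<close>)
      then show ?thesis by (rule DERIV_imp_deriv)
    qed
    let ?q = "(?l * x, ?l * y, ?l\<^sup>2 * t)"
    have hq: "hdil ?l (of3 (x', y', t')) = of3 (?l * x', ?l * y', ?l\<^sup>2 * t')" for x' y' t'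
      by (simp add: of3_def hdil_def)
    have q: "of3 ?q = hdil ?l (Heis x y t)" by (simp add: of3_def hdil_def)
    have "((\<lambda>s. \<psi> (of3 (?l * s, ?l * y, ?l\<^sup>2 * t))) has_derivative
        (\<lambda>h. D3 (\<psi>x (of3 ?q)) (\<psi>y (of3 ?q)) (\<psi>t (of3 ?q)) (?l * h, 0, 0))) (at x)"
      by (rule has_derivative_compose[OF _ d]) (auto simp: zero_prod_def intro!: derivative_eq_intros)
    then have "((\<lambda>s. \<psi> (hdil ?l (of3 (s, y, t)))) has_real_derivative \<psi>x (of3 ?q) / sc j) (at x)"
      unfolding hq by (rule has_derivative_imp_has_field_derivative) simp
    moreover have "continuous_on UNIV (\<lambda>s. (s, y, t))" by (intro continuous_intros)
    ultimately show "deriv (\<lambda>s. K (Heis s y t)) x = c j * (\<psi>x (hdil (1 / sc j) (Heis x y t)) / sc j)"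
      using gen[of "\<lambda>s. (s, y, t)" x "\<psi>x (of3 ?q) / sc j"] p unfolding q by (simp add: of3_def)
    have "((\<lambda>s. \<psi> (of3 (?l * x, ?l * s, ?l\<^sup>2 * t))) has_derivative
        (\<lambda>h. D3 (\<psi>x (of3 ?q)) (\<psi>y (of3 ?q)) (\<psi>t (of3 ?q)) (0, ?l * h, 0))) (at y)"
      by (rule has_derivative_compose[OF _ d]) (auto simp: zero_prod_def intro!: derivative_eq_intros)
    then have "((\<lambda>s. \<psi> (hdil ?l (of3 (x, s, t)))) has_real_derivative \<psi>y (of3 ?q) / sc j) (at y)"
      unfolding hq by (rule has_derivative_imp_has_field_derivative) simp
    moreover have "continuous_on UNIV (\<lambda>s. (x, s, t))" by (intro continuous_intros)
    ultimately show "deriv (\<lambda>s. K (Heis x s t)) y = c j * (\<psi>y (hdil (1 / sc j) (Heis x y t)) / sc j)"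
      using gen[of "\<lambda>s. (x, s, t)" y "\<psi>y (of3 ?q) / sc j"] p unfolding q by (simp add: of3_def)
    have "((\<lambda>s. \<psi> (of3 (?l * x, ?l * y, ?l\<^sup>2 * s))) has_derivative
        (\<lambda>h. D3 (\<psi>x (of3 ?q)) (\<psi>y (of3 ?q)) (\<psi>t (of3 ?q)) (0, 0, ?l\<^sup>2 * h))) (at t)"
      by (rule has_derivative_compose[OF _ d]) (auto simp: zero_prod_def intro!: derivative_eq_intros)
    then have "((\<lambda>s. \<psi> (hdil ?l (of3 (x, y, s)))) has_real_derivative \<psi>t (of3 ?q) / (sc j)\<^sup>2) (at t)"
      unfolding hq by (rule has_derivative_imp_has_field_derivative) (simp add: power_divide)
    moreover have "continuous_on UNIV (\<lambda>s. (x, y, s))" by (intro continuous_intros)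
    ultimately show "deriv (\<lambda>s. K (Heis x y s)) t = c j * (\<psi>t (hdil (1 / sc j) (Heis x y t)) / (sc j)\<^sup>2)"
      using gen[of "\<lambda>s. (x, y, s)" t "\<psi>t (of3 ?q) / (sc j)\<^sup>2"] p unfolding q by (simp add: of3_def)
  qed
  have "(\<lambda>p. \<psi>x p - (1/2) * ycoord p * \<psi>t p) \<in> alg" "(\<lambda>p. \<psi>y p + (1/2) * xcoord p * \<psi>t p) \<in> alg"
    by (intro alg_diff alg.add alg.mult alg.const alg.xcoord alg.ycoord al)+
  moreover have "scaled a (\<lambda>j. c j / sc j) (\<lambda>p. \<psi>x p - (1/2) * ycoord p * \<psi>t p) (X_deriv K)"
    unfolding scaled_def
  proof (intro allI ballI)
    fix j p assume p: "p \<in> ann a j"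
    obtain x y t where "p = Heis x y t" by (cases p)
    with p show "X_deriv K p = c j / sc j * (\<psi>x (hdil (1 / sc j) p)
       - 1 / 2 * ycoord (hdil (1 / sc j) p) * \<psi>t (hdil (1 / sc j) p))"
      by (simp add: der) (simp add: hdil_def field_simps power2_eq_square)
  qed
  moreover have "scaled a (\<lambda>j. c j / sc j) (\<lambda>p. \<psi>y p + (1/2) * xcoord p * \<psi>t p) (Y_deriv K)"
    unfolding scaled_def
  proof (intro allI ballI)
    fix j p assume p: "p \<in> ann a j"
    obtain x y t where "p = Heis x y t" by (cases p)
    with p show "Y_deriv K p = c j / sc j * (\<psi>y (hdil (1 / sc j) p)
       + 1 / 2 * xcoord (hdil (1 / sc j) p) * \<psi>t (hdil (1 / sc j) p))"
      by (simp add: der) (simp add: hdil_def field_simps power2_eq_square)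
  qed
  ultimately show "\<exists>\<psi>'\<in>alg. scaled a (\<lambda>j. c j / sc j) \<psi>' (X_deriv K)"
    "\<exists>\<psi>'\<in>alg. scaled a (\<lambda>j. c j / sc j) \<psi>' (Y_deriv K)" by blast+
qed

lemma finite_horizontal_derivs: "finite (horizontal_derivs j f)"
  by (induction j) auto

lemma scaled_horizontal_derivs:
  assumes a: "0 < a" and \<psi>: "\<psi> \<in> alg" and K: "scaled a c \<psi> K"
    and g: "g \<in> horizontal_derivs i K"
  shows "\<exists>\<psi>'\<in>alg. scaled a (\<lambda>j. c j / sc j ^ i) \<psi>' g"
  using g
proof (induction i arbitrary: g)
  case 0
  then show ?case using \<psi> K by auto
next
  case (Suc i)
  then obtain f where f: "f \<in> horizontal_derivs i K" "g = X_deriv f \<or> g = Y_deriv f" by auto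
  from Suc.IH[OF f(1)] obtain \<psi>' where "\<psi>' \<in> alg" "scaled a (\<lambda>j. c j / sc j ^ i) \<psi>' f" by blast
  from scaled_XY[OF a this] show ?case using f(2) by (auto simp: mult.commute)
qed

text \<open>The support condition leaves room around the spheres that separate the dyadic annuli,
  so that \<open>dker\<close> below is smooth there.\<close>
definition antisym_bump :: "real \<Rightarrow> (heis \<Rightarrow> real) \<Rightarrow> bool" where
  "antisym_bump a \<psi> \<longleftrightarrow> 0 < a \<and> \<psi> \<in> alg \<and> (\<forall>p. \<psi> (hbar p) = - \<psi> p) \<and>
     (\<forall>p. \<psi> p \<noteq> 0 \<longrightarrow> 5 / 4 * a \<le> hnorm p \<and> hnorm p \<le> 7 / 4 * a)"

definition dbump :: "(heis \<Rightarrow> real) \<Rightarrow> int \<Rightarrow> heis \<Rightarrow> real" where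
  "dbump \<psi> j p = \<psi> (hdil (1 / sc j) p) / sc j ^ 3"

text \<open>The signed sum over all scales, written as its only possibly nonzero term: by
  \<open>dbump_index\<close>, the bump of scale \<open>j\<close> vanishes at \<open>p\<close> unless
  \<open>j\<close> is this floor.\<close>

definition dker :: "real \<Rightarrow> (heis \<Rightarrow> real) \<Rightarrow> (int \<Rightarrow> real) \<Rightarrow> heis \<Rightarrow> real" where
  "dker a \<psi> \<omega> p = (let j = \<lfloor>log 2 (hnorm p / a)\<rfloor> in \<omega> j * dbump \<psi> j p)"

lemma dbump_support:
  assumes "antisym_bump a \<psi>" "dbump \<psi> j p \<noteq> 0"
  shows "5 / 4 * (a * sc j) \<le> hnorm p" "hnorm p \<le> 7 / 4 * (a * sc j)"
proof -
  have "5 / 4 * a \<le> hnorm (hdil (1 / sc j) p)" "hnorm (hdil (1 / sc j) p) \<le> 7 / 4 * a"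
    using assms by (auto simp: antisym_bump_def dbump_def)
  then show "5 / 4 * (a * sc j) \<le> hnorm p" "hnorm p \<le> 7 / 4 * (a * sc j)"
    by (simp_all add: hnorm_hdil field_simps)
qed

lemma dbump_index:
  assumes "antisym_bump a \<psi>" "dbump \<psi> j p \<noteq> 0"
  shows "\<lfloor>log 2 (hnorm p / a)\<rfloor> = j"
proof (rule sc_floor_unique)
  have a: "0 < a" "0 < a * sc j" using assms(1) by (auto simp: antisym_bump_def)
  have "a * sc j \<le> hnorm p" "hnorm p < 2 * (a * sc j)"
    using dbump_support[OF assms] a(2) by linarith+
  then show "sc j \<le> hnorm p / a" "hnorm p / a < 2 * sc j"
    using a(1) by (auto simp: field_simps)
qed

lemma dker_eq_sum:
  assumes "antisym_bump a \<psi>" "finite J" "\<lfloor>log 2 (hnorm p / a)\<rfloor> \<in> J"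
  shows "dker a \<psi> \<omega> p = (\<Sum>j\<in>J. \<omega> j * dbump \<psi> j p)"
proof -
  let ?j = "\<lfloor>log 2 (hnorm p / a)\<rfloor>"
  have "(\<Sum>j\<in>J. \<omega> j * dbump \<psi> j p) = (\<Sum>j\<in>J. if j = ?j then \<omega> j * dbump \<psi> j p else 0)"
    using dbump_index[OF assms(1)] by (intro sum.cong) auto
  also have "\<dots> = dker a \<psi> \<omega> p"
    using assms(2,3) by (simp add: dker_def Let_def)
  finally show ?thesis ..
qed

text \<open>The annulus \<open>ann a j\<close> reaches into neighbouring shells, where the floor in
  \<open>dker\<close> is an index other than \<open>j\<close>. At such points both the bump of that
  index and the bump of index \<open>j\<close> vanish, so the formula with \<open>j\<close> remains
  correct.\<close>

lemma dker_scaled: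
  assumes \<psi>: "antisym_bump a \<psi>"
  shows "scaled a (\<lambda>j. \<omega> j / sc j ^ 3) \<psi> (dker a \<psi> \<omega>)"
  unfolding scaled_def
proof (intro allI ballI)
  fix j p assume p: "p \<in> ann a j"
  have a: "0 < a" "0 < a * sc j" using \<psi> by (auto simp: antisym_bump_def)
  define i where "i = \<lfloor>log 2 (hnorm p / a)\<rfloor>"
  have "p \<noteq> hzero" using p a(2) by (force simp: ann_def)
  then have i: "a * sc i \<le> hnorm p" "hnorm p < 2 * (a * sc i)"
    using ann_cover[OF a(1), of p] by (metis i_def)+
  have "dker a \<psi> \<omega> p = \<omega> j * dbump \<psi> j p"
  proof (cases "i = j")
    case True
    then show ?thesis by (simp add: dker_def Let_def i_def)
  next
    case False
    have "dbump \<psi> j p = 0" using dbump_index[OF \<psi>, of j p] False by (auto simp: i_def)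
    moreover have "dbump \<psi> i p = 0"
    proof (rule ccontr)
      assume nz: "dbump \<psi> i p \<noteq> 0"
      note s = dbump_support[OF \<psi> nz]
      show False
      proof (cases "i < j")
        case True
        then have "2 * sc i \<le> sc j" by (rule sc_less)
        then have "2 * (a * sc i) \<le> a * sc j" using a by (simp add: mult.left_commute[of 2 a])
        then show False using s(2) p by (auto simp: ann_def)
      next
        case F: False
        then have "2 * sc j \<le> sc i" using False by (intro sc_less) auto
        then have "2 * (a * sc j) \<le> a * sc i" using a by (simp add: mult.left_commute[of 2 a])
        then show False using s(1) p by (auto simp: ann_def)
      qed
    qed
    ultimately show ?thesis by (simp add: dker_def Let_def flip: i_def)
  qed
  then show "dker a \<psi> \<omega> p = \<omega> j / sc j ^ 3 * \<psi> (hdil (1 / sc j) p)"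
    by (simp add: dbump_def)
qed

lemma admissible_dker:
  assumes \<psi>: "antisym_bump a \<psi>" and \<omega>: "\<And>j. \<bar>\<omega> j\<bar> \<le> 1"
  shows "admissible_kernel (dker a \<psi> \<omega>)"
proof -
  have a: "0 < a" and al: "\<psi> \<in> alg" using \<psi> by (auto simp: antisym_bump_def)
  note K = dker_scaled[OF \<psi>, of \<omega>]
  have "C_k_on k (UNIV - {(0, 0, 0)}) (\<lambda>u. dker a \<psi> \<omega> (of3 u))" for k
  proof (rule C_k_on_locally_alg)
    fix u :: "real \<times> real \<times> real" assume "u \<in> UNIV - {(0, 0, 0)}"
    then have "of3 u \<noteq> hzero" by (auto simp: of3_def hzero_def split: prod.splits)
    then obtain j where j: "of3 u \<in> ann a j" using ann_cover[OF a] by blast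
    have "(\<lambda>p. \<omega> j / sc j ^ 3 * \<psi> (hdil (1 / sc j) p)) \<in> alg"
      by (intro alg.mult alg.const alg_compose[OF al])
       (auto simp: hdil_def intro: alg.mult[OF alg.const alg.xcoord, of "1 / sc j", simplified]
          alg.mult[OF alg.const alg.ycoord, of "1 / sc j", simplified] alg.mult[OF alg.const alg.tcoord, of "(1 / sc j)^2", simplified])
    moreover have "open (of3 -` ann a j)" by (rule open_vimage[OF open_ann continuous_on_of3])
    ultimately show "\<exists>U g. open U \<and> u \<in> U \<and> g \<in> alg \<and> (\<forall>v\<in>U. dker a \<psi> \<omega> (of3 v) = g (of3 v))"
      using j K by (intro exI[of _ "of3 -` ann a j"]
          exI[of _ "\<lambda>p. \<omega> j / sc j ^ 3 * \<psi> (hdil (1 / sc j) p)"]) (auto simp: scaled_def)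
  qed auto
  then have smooth: "smooth_on (UNIV - {(0, 0, 0)}) (\<lambda>(x, y, t). dker a \<psi> \<omega> (Heis x y t))"
    by (simp add: smooth_on_def of3_def split_def)
  have anti: "dker a \<psi> \<omega> (hbar p) = - dker a \<psi> \<omega> p" for p
    using \<psi> by (simp add: dker_def dbump_def antisym_bump_def Let_def flip: hbar_hdil)
  have "\<exists>C. \<forall>g\<in>horizontal_derivs i (dker a \<psi> \<omega>). \<forall>p. p \<noteq> hzero \<longrightarrow> \<bar>g p\<bar> \<le> C / hnorm p ^ (3 + i)" for i
  proof -
    have "\<exists>C\<ge>0. \<forall>p. p \<noteq> hzero \<longrightarrow> \<bar>g p\<bar> \<le> C / hnorm p ^ (3 + i)"
      if g: "g \<in> horizontal_derivs i (dker a \<psi> \<omega>)" for g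
    proof -
      obtain \<psi>' where 1: "\<psi>' \<in> alg" "scaled a (\<lambda>j. \<omega> j / sc j ^ 3 / sc j ^ i) \<psi>' g"
        using scaled_horizontal_derivs[OF a al K g] by blast
      show ?thesis
        by (rule scaled_bound[OF a 1]) (use \<omega> in \<open>simp add: power_add divide_right_mono\<close>)
    qed
    then obtain C where C: "\<And>g. g \<in> horizontal_derivs i (dker a \<psi> \<omega>) \<Longrightarrow>
       C g \<ge> 0 \<and> (\<forall>p. p \<noteq> hzero \<longrightarrow> \<bar>g p\<bar> \<le> C g / hnorm p ^ (3 + i))" by metis
    \<comment> \<open>There are only finitely many iterated derivatives of order \<open>i\<close>,
      and their constants are nonnegative, so the sum serves for all.\<close>
    let ?C = "\<Sum>g\<in>horizontal_derivs i (dker a \<psi> \<omega>). C g"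
    have "\<bar>g p\<bar> \<le> ?C / hnorm p ^ (3 + i)"
      if g: "g \<in> horizontal_derivs i (dker a \<psi> \<omega>)" and p: "p \<noteq> hzero" for g p
    proof -
      have "C g \<le> ?C" using C g finite_horizontal_derivs by (intro member_le_sum) auto
      then have "C g / hnorm p ^ (3 + i) \<le> ?C / hnorm p ^ (3 + i)"
        by (intro divide_right_mono) auto
      then show ?thesis using C[OF g] p by fastforce
    qed
    then show ?thesis by blast
  qed
  with smooth anti show ?thesis by (auto simp: admissible_kernel_def)
qed

section \<open>Uniformity in the signs\<close>

text \<open>In the application \<open>B\<close> is a normalised Gram matrix, so this is a multiple
  of the squared L^2 norm of a signed sum over \<open>J\<close>, and its diagonal part is the square
  function.\<close>

definition qform :: "('i \<Rightarrow> 'i \<Rightarrow> real) \<Rightarrow> 'i set \<Rightarrow> ('i \<Rightarrow> real) \<Rightarrow> real" where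
  "qform B J \<omega> = (\<Sum>j\<in>J. \<Sum>k\<in>J. \<omega> j * \<omega> k * B j k)"

lemma qform_insert:
  assumes "finite J" "i \<notin> J" "\<And>j k. B j k = B k j"
  shows "qform B (insert i J) \<omega> = qform B J \<omega> + 2 * \<omega> i * (\<Sum>k\<in>J. \<omega> k * B i k) + (\<omega> i)\<^sup>2 * B i i"
proof -
  have "(\<Sum>j\<in>J. \<omega> j * \<omega> i * B j i) = \<omega> i * (\<Sum>k\<in>J. \<omega> k * B i k)"
    using assms(3) by (simp add: sum_distrib_left algebra_simps)
  moreover have "(\<Sum>k\<in>J. \<omega> i * \<omega> k * B i k) = \<omega> i * (\<Sum>k\<in>J. \<omega> k * B i k)"
    by (simp add: sum_distrib_left algebra_simps)
  ultimately show ?thesis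
    using assms(1,2) by (simp add: qform_def sum.distrib power2_eq_square algebra_simps)
qed

lemma qform_cong: "(\<And>j. j \<in> J \<Longrightarrow> \<omega> j = \<omega>' j) \<Longrightarrow> qform B J \<omega> = qform B J \<omega>'"
  unfolding qform_def by (intro sum.cong) auto

text \<open>Adding an index \<open>i\<close> contributes \<open>B i i\<close> and a cross term that
  is linear in the new sign. Choosing the sign that makes the cross term nonnegative gives for one
  explicit choice what averaging over signs would give, while the signs on \<open>F\<close> stay
  fixed.\<close>

lemma qform_good_signs:
  assumes "finite J" "\<And>j k. B j k = B k j" "F \<inter> J = {}" "finite F"
  shows "\<exists>\<omega>'. (\<forall>j. j \<notin> J \<longrightarrow> \<omega>' j = \<omega> j) \<and> (\<forall>j\<in>J. \<omega>' j \<in> {-1, 1}) \<and>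
    qform B F \<omega> + (\<Sum>j\<in>J. B j j) \<le> qform B (F \<union> J) \<omega>'"
  using assms(1,3)
proof induction
  case empty
  then show ?case by auto
next
  case (insert i J)
  then obtain \<omega>' where \<omega>': "\<And>j. j \<notin> J \<Longrightarrow> \<omega>' j = \<omega> j" "\<And>j. j\<in>J \<Longrightarrow> \<omega>' j \<in> {-1, 1}"
    "qform B F \<omega> + (\<Sum>j\<in>J. B j j) \<le> qform B (F \<union> J) \<omega>'" by auto
  define c where "c = (\<Sum>k\<in>F \<union> J. \<omega>' k * B i k)"
  define s where "s = (if c \<ge> 0 then 1 else - 1 :: real)"
  define \<omega>'' where "\<omega>'' = \<omega>'(i := s)"
  have i: "i \<notin> F \<union> J" using insert by auto
  have "qform B (F \<union> J) \<omega>'' = qform B (F \<union> J) \<omega>'"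
    using i by (intro qform_cong) (auto simp: \<omega>''_def)
  moreover have "(\<Sum>k\<in>F \<union> J. \<omega>'' k * B i k) = c"
    unfolding c_def using i by (intro sum.cong) (auto simp: \<omega>''_def)
  moreover have "finite (F \<union> J)" using insert assms(4) by auto
  ultimately have "qform B (insert i (F \<union> J)) \<omega>'' = qform B (F \<union> J) \<omega>' + 2 * s * c + s\<^sup>2 * B i i"
    using qform_insert[of "F \<union> J" i B \<omega>''] i assms(2) by (simp add: \<omega>''_def)
  moreover have "2 * s * c + s\<^sup>2 * B i i \<ge> B i i" by (auto simp: s_def)
  ultimately have "qform B F \<omega> + (\<Sum>j\<in>insert i J. B j j) \<le> qform B (F \<union> insert i J) \<omega>''"
    using \<omega>'(3) insert.hyps by simp
  moreover have "\<forall>j. j \<notin> insert i J \<longrightarrow> \<omega>'' j = \<omega> j" "\<forall>j\<in>insert i J. \<omega>'' j \<in> {-1, 1}"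
    using \<omega>'(1,2) by (auto simp: \<omega>''_def s_def)
  ultimately show ?case by blast
qed

text \<open>Gliding hump: signs that are good for one test object keep their effect when the
  signs outside its finite index set are changed later.\<close>
lemma gliding_hump:
  fixes B :: "'x \<Rightarrow> 'i \<Rightarrow> 'i \<Rightarrow> real"
  assumes fin: "\<And>x. x \<in> T \<Longrightarrow> finite (I x)"
    and sym: "\<And>x j k. B x j k = B x k j"
    and nonneg: "\<And>x F \<omega>. x \<in> T \<Longrightarrow> F \<subseteq> I x \<Longrightarrow> 0 \<le> qform (B x) F \<omega>"
    and diag: "\<And>x j. x \<in> T \<Longrightarrow> j \<in> I x \<Longrightarrow> B x j j \<le> M"
    and bdd: "\<And>\<omega>. (\<And>j. \<omega> j \<in> {-1, 1}) \<Longrightarrow> \<exists>C. \<forall>x\<in>T. qform (B x) (I x) \<omega> \<le> C"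
  shows "\<exists>C. \<forall>x\<in>T. (\<Sum>j\<in>I x. B x j j) \<le> C"
proof (rule ccontr)
  assume "\<not> ?thesis"
  then have unb: "\<exists>x\<in>T. C < (\<Sum>j\<in>I x. B x j j)" for C by (auto simp: not_le)
  define P where "P n s \<longleftrightarrow> finite (fst s) \<and> (\<forall>j. snd s j \<in> {-1, 1 :: real})"
    for n :: nat and s :: "'i set \<times> ('i \<Rightarrow> real)"
  define Q where "Q n s s' \<longleftrightarrow> fst s \<subseteq> fst s' \<and> (\<forall>j\<in>fst s. snd s' j = snd s j) \<and>
      (\<exists>x\<in>T. I x \<subseteq> fst s' \<and> real n \<le> qform (B x) (I x) (snd s'))"
    for n :: nat and s s' :: "'i set \<times> ('i \<Rightarrow> real)"
  have "\<exists>f. \<forall>n. P n (f n) \<and> Q n (f n) (f (Suc n))"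
  proof (rule dependent_nat_choice)
    show "\<exists>s. P 0 s" by (intro exI[of _ "({}, \<lambda>_. 1)"]) (simp add: P_def)
    fix s n assume "P n s"
    obtain F \<omega> where s: "s = (F, \<omega>)" by (cases s)
    have F: "finite F" and \<omega>: "\<And>j. \<omega> j \<in> {-1, 1}" using \<open>P n s\<close> by (auto simp: P_def s)
    obtain x where x: "x \<in> T" "real n + real (card F) * max M 0 < (\<Sum>j\<in>I x. B x j j)" using unb by blast
    have "\<exists>\<omega>'. (\<forall>j. j \<notin> I x - F \<longrightarrow> \<omega>' j = \<omega> j) \<and> (\<forall>j\<in>I x - F. \<omega>' j \<in> {-1, 1}) \<and>
      qform (B x) (I x \<inter> F) \<omega> + (\<Sum>j\<in>I x - F. B x j j) \<le> qform (B x) (I x \<inter> F \<union> (I x - F)) \<omega>'"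
      by (rule qform_good_signs) (use fin[OF x(1)] sym F in auto)
    then obtain \<omega>' where \<omega>': "\<And>j. j \<notin> I x - F \<Longrightarrow> \<omega>' j = \<omega> j" "\<And>j. j\<in>I x - F \<Longrightarrow> \<omega>' j \<in> {-1, 1}"
      "qform (B x) (I x \<inter> F) \<omega> + (\<Sum>j\<in>I x - F. B x j j) \<le> qform (B x) (I x \<inter> F \<union> (I x - F)) \<omega>'"
      by blast
    have "(\<Sum>j\<in>I x \<inter> F. B x j j) \<le> real (card (I x \<inter> F)) * max M 0"
      using diag[OF x(1)] by (intro sum_bounded_above) (auto simp: le_max_iff_disj)
    also have "\<dots> \<le> real (card F) * max M 0"
      using F by (intro mult_right_mono) (auto intro: card_mono)
    finally have "real n \<le> (\<Sum>j\<in>I x - F. B x j j)"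
      using x(2) sum.Int_Diff[OF fin[OF x(1)], of "\<lambda>j. B x j j" F] by linarith
    moreover have "0 \<le> qform (B x) (I x \<inter> F) \<omega>" using x by (intro nonneg) auto
    moreover have "I x \<inter> F \<union> (I x - F) = I x" by blast
    ultimately have "real n \<le> qform (B x) (I x) \<omega>'" using \<omega>'(3) by simp
    then have "Q n s (F \<union> I x, \<omega>')" using x \<omega>' by (auto simp: Q_def s)
    moreover have "P (Suc n) (F \<union> I x, \<omega>')"
      using F fin[OF x(1)] \<omega>'(1,2) \<omega> unfolding P_def by (metis fst_conv snd_conv finite_UnI)
    ultimately show "\<exists>s'. P (Suc n) s' \<and> Q n s s'" by blast
  qed
  then obtain f where f: "\<And>n. P n (f n)" "\<And>n. Q n (f n) (f (Suc n))" by blast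
  have step: "fst (f n) \<subseteq> fst (f (Suc n)) \<and> (\<forall>j\<in>fst (f n). snd (f (Suc n)) j = snd (f n) j)" for n
    using f(2)[of n] by (auto simp: Q_def)
  have agree: "fst (f n) \<subseteq> fst (f m) \<and> (\<forall>j\<in>fst (f n). snd (f m) j = snd (f n) j)" if "n \<le> m" for n m
    using that
  proof (induction rule: dec_induct)
    case (step m)
    then show ?case using \<open>\<And>n. fst (f n) \<subseteq> fst (f (Suc n)) \<and> (\<forall>j\<in>fst (f n). snd (f (Suc n)) j = snd (f n) j)\<close>[of m]
      by (auto simp: subset_iff)
  qed auto
  \<comment> \<open>The limiting signs: each index takes the sign it had at the first stage at which
    it was frozen, and 1 if it never was.\<close>
  define \<omega> where "\<omega> j = (if \<exists>n. j \<in> fst (f n) then snd (f (LEAST n. j \<in> fst (f n))) j else 1)" for j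
  have \<omega>f: "\<omega> j = snd (f n) j" if "j \<in> fst (f n)" for n j
    using agree[OF Least_le[of "\<lambda>n. j \<in> fst (f n)", OF that]] LeastI[of "\<lambda>n. j \<in> fst (f n)", OF that] that
    by (auto simp: \<omega>_def)
  have "\<omega> j \<in> {-1, 1}" for j using f(1) by (auto simp: \<omega>_def P_def)
  then obtain C where C: "\<And>x. x \<in> T \<Longrightarrow> qform (B x) (I x) \<omega> \<le> C" using bdd by blast
  obtain n where n: "C < real n" using reals_Archimedean2 by blast
  obtain x where x: "x \<in> T" "I x \<subseteq> fst (f (Suc n))" "real n \<le> qform (B x) (I x) (snd (f (Suc n)))"
    using f(2)[of n] by (auto simp: Q_def)
  have "qform (B x) (I x) \<omega> = qform (B x) (I x) (snd (f (Suc n)))"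
    using x(2) by (intro qform_cong \<omega>f) auto
  then show False using x C[OF x(1)] n by simp
qed

section \<open>The Carleson estimate\<close>

text \<open>Here the centres are arbitrary and the radii unrestricted, whereas
  \<open>three_regular\<close> speaks of centres in the set and radii up to the diameter.\<close>

locale upper_regular =
  fixes \<mu> :: "heis measure" and A :: real
  assumes sets_\<mu> [simp, measurable_cong]: "sets \<mu> = sets borel"
    and A_ge: "1 \<le> A"
    and ball_le: "0 < r \<Longrightarrow> emeasure \<mu> (ball p r) \<le> ennreal (A * r ^ 3)"
begin

lemma space_\<mu> [simp]: "space \<mu> = UNIV"
  using sets_eq_imp_space_eq[OF sets_\<mu>] by simp

lemma emeasure_ball_finite: "emeasure \<mu> (ball p r) < \<infinity>"
proof (cases "0 < r")
  case True
  then show ?thesis using ball_le[OF True, of p] by (metis ennreal_less_top infinity_ennreal_def le_less_trans)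
qed (auto simp: not_less ball_empty)

lemma measure_ball_le: "0 < r \<Longrightarrow> measure \<mu> (ball p r) \<le> A * r ^ 3"
  using ball_le[of r p] A_ge by (simp add: measure_def enn2real_leI)

text \<open>The piece of scale \<open>j\<close> of the singular integral, applied to the indicator
  of \<open>ball p0 R\<close>; the indicator is the test function for the L^2 bound.\<close>

definition cutoff :: "(heis \<Rightarrow> real) \<Rightarrow> heis \<Rightarrow> real \<Rightarrow> int \<Rightarrow> heis \<Rightarrow> real" where
  "cutoff \<psi> p0 R j p = (\<integral>q. indicator (ball p0 R) q *\<^sub>R dbump \<psi> j (hinv q \<cdot> p) \<partial>\<mu>)"

context
  fixes a :: real and \<psi> :: "heis \<Rightarrow> real"
  assumes \<psi>: "antisym_bump a \<psi>"
begin

lemma a_pos: "0 < a" and \<psi>_alg: "\<psi> \<in> alg"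
  using \<psi> by (auto simp: antisym_bump_def)

lemma dbump_bounded: "\<exists>M\<ge>0. \<forall>j p. \<bar>dbump \<psi> j p\<bar> \<le> M / sc j ^ 3"
proof -
  have "compact (\<psi> ` cball hzero (2 * a))"
    using compact_continuous_image[OF continuous_on_subset[OF continuous_on_alg[OF \<psi>_alg] subset_UNIV] compact_cball_heis] .
  then have "bounded (\<psi> ` cball hzero (2 * a))" by (rule compact_imp_bounded)
  then obtain M where M: "0 < M" "\<And>p. p \<in> cball hzero (2 * a) \<Longrightarrow> \<bar>\<psi> p\<bar> \<le> M"
    by (auto simp: bounded_pos)
  have "\<bar>\<psi> p\<bar> \<le> M" for p
  proof (cases "\<psi> p = 0")
    case False
    then have "hnorm p \<le> 7 / 4 * a" using \<psi> by (auto simp: antisym_bump_def)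
    then show ?thesis using a_pos by (intro M) (simp add: dist_commute[of hzero] dist_hzero)
  qed (use M in auto)
  then show ?thesis
    using M by (intro exI[of _ M]) (auto simp: dbump_def divide_right_mono)
qed

lemma continuous_dbump: "continuous_on UNIV (dbump \<psi> j)"
  unfolding dbump_def
  by (intro continuous_intros continuous_on_compose2[OF continuous_on_alg[OF \<psi>_alg] continuous_hdil]) auto

lemma measurable_dbump_left: "(\<lambda>q. dbump \<psi> j (hinv q \<cdot> p)) \<in> borel_measurable \<mu>"
proof -
  have "continuous_on UNIV (\<lambda>q. dbump \<psi> j (hinv q \<cdot> p))"
    by (rule continuous_on_compose2[OF continuous_dbump continuous_hinv_hmult]) auto
  then have "(\<lambda>q. dbump \<psi> j (hinv q \<cdot> p)) \<in> borel_measurable borel"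
    by (rule borel_measurable_continuous_onI)
  then show ?thesis by (simp cong: measurable_cong_sets)
qed

lemma cutoff_integrable: "integrable \<mu> (\<lambda>q. indicator (ball p0 R) q *\<^sub>R dbump \<psi> j (hinv q \<cdot> p))"
proof -
  obtain M where M: "\<And>j p. \<bar>dbump \<psi> j p\<bar> \<le> M / sc j ^ 3" using dbump_bounded by blast
  show ?thesis
    by (rule integrableI_bounded_set_indicator[where B = "M / sc j ^ 3"])
      (use M emeasure_ball_finite measurable_dbump_left in auto)
qed

lemma continuous_cutoff: "continuous_on UNIV (cutoff \<psi> p0 R j)"
proof -
  obtain M where M: "0 \<le> M" "\<And>j p. \<bar>dbump \<psi> j p\<bar> \<le> M / sc j ^ 3" using dbump_bounded by blast
  have "(\<lambda>n. cutoff \<psi> p0 R j (s n)) \<longlonglongrightarrow> cutoff \<psi> p0 R j p" if s: "s \<longlonglongrightarrow> p" for s p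
    unfolding cutoff_def
  proof (rule integral_dominated_convergence)
    show "integrable \<mu> (\<lambda>q. indicator (ball p0 R) q *\<^sub>R (M / sc j ^ 3))"
      by (rule integrableI_bounded_set_indicator[where B = "M / sc j ^ 3"])
        (use M emeasure_ball_finite in auto)
    have "(\<lambda>n. dbump \<psi> j (hinv q \<cdot> s n)) \<longlonglongrightarrow> dbump \<psi> j (hinv q \<cdot> p)" for q
    proof -
      have "continuous_on UNIV (\<lambda>p. dbump \<psi> j (hinv q \<cdot> p))"
        by (rule continuous_on_compose2[OF continuous_dbump continuous_hmult_right]) auto
      then show ?thesis
        using s by (auto simp: continuous_on_sequentially comp_def)
    qed
    then show "AE q in \<mu>. (\<lambda>n. indicator (ball p0 R) q *\<^sub>R dbump \<psi> j (hinv q \<cdot> s n))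
        \<longlonglongrightarrow> indicator (ball p0 R) q *\<^sub>R dbump \<psi> j (hinv q \<cdot> p)"
      by (intro always_eventually allI tendsto_scaleR tendsto_const)
    show "AE q in \<mu>. norm (indicator (ball p0 R) q *\<^sub>R dbump \<psi> j (hinv q \<cdot> s n))
          \<le> indicator (ball p0 R) q *\<^sub>R (M / sc j ^ 3)" for n
      using M by (auto simp: indicator_def)
  qed (use cutoff_integrable in auto)
  then show ?thesis by (auto simp: continuous_on_sequentially comp_def)
qed

lemma measurable_cutoff [measurable]: "cutoff \<psi> p0 R j \<in> borel_measurable \<mu>"
proof -
  have "cutoff \<psi> p0 R j \<in> borel_measurable borel"
    by (rule borel_measurable_continuous_onI[OF continuous_cutoff])
  then show ?thesis by (simp cong: measurable_cong_sets)
qed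

text \<open>The bump has height of order 2^(-3j) and lives in a ball of radius of order 2^j, whose
  mass is of order 2^(3j): the powers cancel. This is the diagonal bound needed by
  \<open>gliding_hump\<close>.\<close>

lemma cutoff_bounded: "\<exists>M\<ge>0. \<forall>p0 R j p. \<bar>cutoff \<psi> p0 R j p\<bar> \<le> M"
proof -
  obtain M where M: "0 \<le> M" "\<And>j p. \<bar>dbump \<psi> j p\<bar> \<le> M / sc j ^ 3" using dbump_bounded by blast
  have "\<bar>cutoff \<psi> p0 R j p\<bar> \<le> M * A * (2 * a) ^ 3" for p0 R j p
  proof -
    let ?B = "ball p (2 * (a * sc j))"
    have "norm (cutoff \<psi> p0 R j p) \<le> (\<integral>q. norm (indicator (ball p0 R) q *\<^sub>R dbump \<psi> j (hinv q \<cdot> p)) \<partial>\<mu>)"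
      unfolding cutoff_def by (rule integral_norm_bound)
    also have "\<dots> \<le> (\<integral>q. indicator ?B q *\<^sub>R (M / sc j ^ 3) \<partial>\<mu>)"
    proof (rule integral_mono)
      show "integrable \<mu> (\<lambda>q. norm (indicator (ball p0 R) q *\<^sub>R dbump \<psi> j (hinv q \<cdot> p)))"
        by (rule integrable_norm[OF cutoff_integrable])
      show "integrable \<mu> (\<lambda>q. indicator ?B q *\<^sub>R (M / sc j ^ 3))"
        by (rule integrableI_bounded_set_indicator[where B = "M / sc j ^ 3"])
          (use M emeasure_ball_finite in auto)
      fix q
      show "norm (indicator (ball p0 R) q *\<^sub>R dbump \<psi> j (hinv q \<cdot> p)) \<le> indicator ?B q *\<^sub>R (M / sc j ^ 3)"
      proof (cases "dbump \<psi> j (hinv q \<cdot> p) = 0")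
        case False
        have "dist p q \<le> 7 / 4 * (a * sc j)"
          using dbump_support(2)[OF \<psi> False] by (simp add: dist_heis_def)
        moreover have "0 < a * sc j" using a_pos by simp
        ultimately have "q \<in> ?B" by simp
        then show ?thesis using M by (simp add: indicator_def)
      qed (use M in auto)
    qed
    also have "\<dots> = measure \<mu> ?B * (M / sc j ^ 3)" using emeasure_ball_finite by simp
    also have "\<dots> \<le> (A * (2 * (a * sc j)) ^ 3) * (M / sc j ^ 3)"
      using M a_pos by (intro mult_right_mono measure_ball_le) auto
    also have "\<dots> = M * A * (2 * a) ^ 3"
      by (simp add: power_mult_distrib)
    finally show ?thesis by simp
  qed
  then show ?thesis using M A_ge a_pos by (intro exI[of _ "M * A * (2 * a) ^ 3"]) auto
qed

text \<open>The scales that remain after truncation at \<open>a * sc m\<close> and are small enough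
  to matter for two points of one ball of radius \<open>R\<close>, whose distance is below
  \<open>2 * R\<close>.\<close>

definition scales :: "real \<Rightarrow> int \<Rightarrow> int set" where
  "scales R m = {j. m \<le> j \<and> a * sc j < 2 * R}"

lemma finite_scales: "finite (scales R m)"
proof -
  have "scales R m \<subseteq> {m..\<lfloor>log 2 (2 * R / a)\<rfloor>}"
  proof
    fix j assume "j \<in> scales R m"
    then have j: "m \<le> j" "sc j < 2 * R / a" using a_pos by (auto simp: scales_def field_simps)
    then have "0 < 2 * R / a" using sc_pos[of j] by linarith
    then have "real_of_int j < log 2 (2 * R / a)"
      using j(2) by (simp add: sc_def less_log_iff)
    then show "j \<in> {m..\<lfloor>log 2 (2 * R / a)\<rfloor>}" using j by (auto simp: le_floor_iff)
  qed
  then show ?thesis by (rule finite_subset) simp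
qed

text \<open>The radius \<open>a * sc m\<close> lies in the gap between the supports of the scales
  \<open>m - 1\<close> and \<open>m\<close>. Truncation therefore cuts no bump in two, and the
  truncated operator is exactly a finite signed sum.\<close>

lemma T_trunc_indicator:
  assumes p: "p \<in> ball p0 R"
  shows "T_trunc (dker a \<psi> \<omega>) (a * sc m) \<mu> (\<lambda>q. complex_of_real (indicator (ball p0 R) q)) p
    = complex_of_real (\<Sum>j\<in>scales R m. \<omega> j * cutoff \<psi> p0 R j p)"
proof -
  have eq: "indicator {q. hnorm (hinv q \<cdot> p) > a * sc m} q *\<^sub>R
      (complex_of_real (dker a \<psi> \<omega> (hinv q \<cdot> p)) * complex_of_real (indicator (ball p0 R) q))
    = complex_of_real (\<Sum>j\<in>scales R m. \<omega> j * (indicator (ball p0 R) q *\<^sub>R dbump \<psi> j (hinv q \<cdot> p)))"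
    (is "?l = ?r") for q
  proof (cases "q \<in> ball p0 R")
    case True
    let ?u = "hinv q \<cdot> p"
    have less: "hnorm ?u < 2 * R"
      using True p dist_triangle[of p q p0] by (simp add: dist_heis_def[of p q, symmetric] dist_commute)
    show ?thesis
    proof (cases "hnorm ?u > a * sc m")
      case large: True
      define j where "j = \<lfloor>log 2 (hnorm ?u / a)\<rfloor>"
      have "0 < a * sc m" using a_pos by simp
      then have "?u \<noteq> hzero" using large by auto
      then have j: "a * sc j \<le> hnorm ?u" "hnorm ?u < 2 * (a * sc j)"
        using ann_cover[OF a_pos, of ?u] by (metis j_def)+
      have "m \<le> j"
      proof (rule ccontr)
        assume "\<not> m \<le> j"
        then have "2 * sc j \<le> sc m" by (intro sc_less) auto
        then have "2 * (a * sc j) \<le> a * sc m" using a_pos by (simp add: mult.left_commute[of 2 a])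
        then show False using large j by linarith
      qed
      then have "j \<in> scales R m" using j less by (auto simp: scales_def)
      then have "dker a \<psi> \<omega> ?u = (\<Sum>j\<in>scales R m. \<omega> j * dbump \<psi> j ?u)"
        by (intro dker_eq_sum[OF \<psi> finite_scales]) (simp add: j_def)
      then show ?thesis using True large by simp
    next
      case False
      have "dbump \<psi> j ?u = 0" if "j \<in> scales R m" for j
      proof (rule ccontr)
        assume "dbump \<psi> j ?u \<noteq> 0"
        then have "5 / 4 * (a * sc j) \<le> hnorm ?u" by (rule dbump_support[OF \<psi>])
        moreover have "a * sc m \<le> a * sc j" using that a_pos by (auto simp: scales_def intro: sc_le)
        moreover have "0 < a * sc j" using a_pos by simp
        ultimately show False using False by linarith
      qed
      then show ?thesis using False by simp
    qed
  qed simp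
  have "T_trunc (dker a \<psi> \<omega>) (a * sc m) \<mu> (\<lambda>q. complex_of_real (indicator (ball p0 R) q)) p
     = complex_of_real (\<integral>q. (\<Sum>j\<in>scales R m. \<omega> j * (indicator (ball p0 R) q *\<^sub>R dbump \<psi> j (hinv q \<cdot> p))) \<partial>\<mu>)"
    unfolding T_trunc_def set_lebesgue_integral_def eq by (rule integral_complex_of_real)
  also have "(\<integral>q. (\<Sum>j\<in>scales R m. \<omega> j * (indicator (ball p0 R) q *\<^sub>R dbump \<psi> j (hinv q \<cdot> p))) \<partial>\<mu>)
     = (\<Sum>j\<in>scales R m. \<omega> j * cutoff \<psi> p0 R j p)"
    by (subst Bochner_Integration.integral_sum)
      (use cutoff_integrable in \<open>auto simp: cutoff_def intro!: integrable_mult_right\<close>)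
  finally show ?thesis .
qed

lemma cutoff_mult_integrable:
  "integrable \<mu> (\<lambda>p. indicator (ball p0 R) p *\<^sub>R (cutoff \<psi> p0 R j p * cutoff \<psi> p0 R k p))"
proof -
  obtain M where M: "0 \<le> M" "\<And>p0 R j p. \<bar>cutoff \<psi> p0 R j p\<bar> \<le> M" using cutoff_bounded by blast
  show ?thesis
    by (rule integrableI_bounded_set_indicator[where B = "M * M"])
      (use M emeasure_ball_finite in \<open>auto simp: abs_mult intro!: mult_mono\<close>)
qed

text \<open>Division by \<open>R ^ 3\<close>, the order of the mass of the ball, lets one bound
  serve all balls at once.\<close>

definition gram :: "heis \<times> real \<times> int \<Rightarrow> int \<Rightarrow> int \<Rightarrow> real" where
  "gram = (\<lambda>(p0, R, m) j k. (\<integral>p. indicator (ball p0 R) p *\<^sub>R (cutoff \<psi> p0 R j p * cutoff \<psi> p0 R k p) \<partial>\<mu>) / R ^ 3)"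

lemma qform_gram:
  assumes "finite F"
  shows "qform (gram (p0, R, m)) F \<omega>
    = (\<integral>p. indicator (ball p0 R) p *\<^sub>R (\<Sum>j\<in>F. \<omega> j * cutoff \<psi> p0 R j p)\<^sup>2 \<partial>\<mu>) / R ^ 3"
proof -
  have "(\<integral>p. indicator (ball p0 R) p *\<^sub>R (\<Sum>j\<in>F. \<omega> j * cutoff \<psi> p0 R j p)\<^sup>2 \<partial>\<mu>)
    = (\<integral>p. (\<Sum>j\<in>F. \<Sum>k\<in>F. \<omega> j * \<omega> k * (indicator (ball p0 R) p *\<^sub>R (cutoff \<psi> p0 R j p * cutoff \<psi> p0 R k p))) \<partial>\<mu>)"
    by (intro Bochner_Integration.integral_cong refl)
      (simp add: power2_eq_square sum_product sum_distrib_left mult_ac)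
  also have "\<dots> = (\<Sum>j\<in>F. \<integral>p. (\<Sum>k\<in>F. \<omega> j * \<omega> k *
      (indicator (ball p0 R) p *\<^sub>R (cutoff \<psi> p0 R j p * cutoff \<psi> p0 R k p))) \<partial>\<mu>)"
    by (rule Bochner_Integration.integral_sum)
      (intro Bochner_Integration.integrable_sum integrable_mult_right cutoff_mult_integrable)
  also have "\<dots> = (\<Sum>j\<in>F. \<Sum>k\<in>F. \<integral>p. \<omega> j * \<omega> k *
      (indicator (ball p0 R) p *\<^sub>R (cutoff \<psi> p0 R j p * cutoff \<psi> p0 R k p)) \<partial>\<mu>)"
    by (intro sum.cong refl Bochner_Integration.integral_sum integrable_mult_right cutoff_mult_integrable)
  also have "\<dots> = (\<Sum>j\<in>F. \<Sum>k\<in>F. \<omega> j * \<omega> k *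
      (\<integral>p. indicator (ball p0 R) p *\<^sub>R (cutoff \<psi> p0 R j p * cutoff \<psi> p0 R k p) \<partial>\<mu>))"
    by (intro sum.cong refl integral_mult_right_zero)
  finally show ?thesis
    by (simp add: qform_def gram_def sum_divide_distrib)
qed

text \<open>For fixed signs the L^2 bound, tested on indicators of balls, bounds the quadratic form
  for all balls and truncations. \<open>gliding_hump\<close> converts these separate bounds into one
  bound for the diagonal sums, independent of the ball and of \<open>m\<close>.\<close>

lemma carleson:
  assumes T: "\<And>\<omega>. (\<And>j. \<bar>\<omega> j\<bar> \<le> 1) \<Longrightarrow> T_bounded_L2 (dker a \<psi> \<omega>) \<mu>"
  shows "\<exists>C. \<forall>p0 m. \<forall>R>0.
    (\<Sum>j\<in>scales R m. \<integral>p. indicator (ball p0 R) p *\<^sub>R (cutoff \<psi> p0 R j p)\<^sup>2 \<partial>\<mu>) \<le> C * R ^ 3"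
proof -
  obtain M where M: "0 \<le> M" "\<And>p0 R j p. \<bar>cutoff \<psi> p0 R j p\<bar> \<le> M" using cutoff_bounded by blast
  define X where "X = {(p0 :: heis, R :: real, m :: int). 0 < R}"
  have "\<exists>C. \<forall>x\<in>X. (\<Sum>j\<in>(case x of (p0, R, m) \<Rightarrow> scales R m). gram x j j) \<le> C"
  proof (rule gliding_hump[where M = "M\<^sup>2 * A" and B = gram and T = X and I = "\<lambda>x. case x of (p0, R, m) \<Rightarrow> scales R m"])
    show "finite (case x of (p0, R, m) \<Rightarrow> scales R m)" for x :: "heis \<times> real \<times> int"
      using finite_scales by (auto split: prod.split)
    show "gram x j k = gram x k j" for x j k
      by (auto simp: gram_def mult.commute split: prod.split)
    show "0 \<le> qform (gram x) F \<omega>" if "x \<in> X" "F \<subseteq> (case x of (p0, R, m) \<Rightarrow> scales R m)" for x F \<omega>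
    proof -
      obtain p0 R m where x: "x = (p0, R, m)" by (cases x)
      have "finite F" using that(2) finite_subset[OF _ finite_scales] by (auto simp: x)
      then show ?thesis using that(1) unfolding x by (subst qform_gram) (auto simp: X_def intro!: divide_nonneg_nonneg)
    qed
    show "gram x j j \<le> M\<^sup>2 * A" if x: "x \<in> X" for x j
    proof -
      obtain p0 R m where x: "x = (p0, R, m)" "0 < R" using x by (auto simp: X_def)
      have "(\<integral>p. indicator (ball p0 R) p *\<^sub>R (cutoff \<psi> p0 R j p * cutoff \<psi> p0 R j p) \<partial>\<mu>)
         \<le> (\<integral>p. indicator (ball p0 R) p *\<^sub>R M\<^sup>2 \<partial>\<mu>)"
      proof (rule integral_mono[OF cutoff_mult_integrable])
        show "integrable \<mu> (\<lambda>p. indicator (ball p0 R) p *\<^sub>R M\<^sup>2)"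
          by (rule integrableI_bounded_set_indicator[where B = "M\<^sup>2"])
            (use M emeasure_ball_finite in auto)
        show "indicator (ball p0 R) p *\<^sub>R (cutoff \<psi> p0 R j p * cutoff \<psi> p0 R j p) \<le> indicator (ball p0 R) p *\<^sub>R M\<^sup>2" for p
          using power_mono[OF M(2)[of p0 R j p] abs_ge_zero, of 2] by (auto simp: indicator_def power2_eq_square)
      qed
      also have "\<dots> = measure \<mu> (ball p0 R) * M\<^sup>2" using emeasure_ball_finite by simp
      also have "\<dots> \<le> A * R ^ 3 * M\<^sup>2" using x by (intro mult_right_mono measure_ball_le) auto
      finally show ?thesis using x by (simp add: gram_def field_simps)
    qed
    show "\<exists>C. \<forall>x\<in>X. qform (gram x) (case x of (p0, R, m) \<Rightarrow> scales R m) \<omega> \<le> C"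
      if \<omega>: "\<And>j. \<omega> j \<in> {-1, 1}" for \<omega>
    proof -
      have "T_bounded_L2 (dker a \<psi> \<omega>) \<mu>"
      proof (rule T)
        show "\<bar>\<omega> j\<bar> \<le> 1" for j using \<omega>[of j] by auto
      qed
      then obtain C where C: "C \<ge> 1" "\<And>\<epsilon> f. \<epsilon> > 0 \<Longrightarrow> integrable \<mu> f \<Longrightarrow> L2_enorm \<mu> f < \<infinity> \<Longrightarrow>
        L2_enorm \<mu> (T_trunc (dker a \<psi> \<omega>) \<epsilon> \<mu> f) \<le> ennreal C * L2_enorm \<mu> f"
        unfolding T_bounded_L2_def by blast
      have "qform (gram (p0, R, m)) (scales R m) \<omega> \<le> C\<^sup>2 * A" if R: "0 < R" for p0 R m
      proof -
        let ?B = "ball p0 R"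
        let ?f = "\<lambda>q. complex_of_real (indicator ?B q)"
        let ?K = "T_trunc (dker a \<psi> \<omega>) (a * sc m) \<mu> ?f"
        let ?S = "\<lambda>p. (\<Sum>j\<in>scales R m. \<omega> j * cutoff \<psi> p0 R j p)"
        define N where "N = (\<integral>\<^sup>+ p. ennreal ((cmod (?K p))\<^sup>2) \<partial>\<mu>)"
        have eB: "emeasure \<mu> ?B = ennreal (measure \<mu> ?B)"
          using emeasure_ball_finite[of p0 R] by (intro emeasure_eq_ennreal_measure) auto
        have "(\<integral>\<^sup>+ p. ennreal ((cmod (?f p))\<^sup>2) \<partial>\<mu>) = (\<integral>\<^sup>+ p. indicator ?B p \<partial>\<mu>)"
          by (intro nn_integral_cong) (auto simp: indicator_def)
        also have "\<dots> = ennreal (measure \<mu> ?B)" using eB by simp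
        finally have f: "L2_enorm \<mu> ?f = ennreal (sqrt (measure \<mu> ?B))"
          by (simp add: L2_enorm_def Let_def)
        have "integrable \<mu> (\<lambda>q. indicator ?B q :: real)"
          using emeasure_ball_finite by (intro integrable_real_indicator) auto
        then have "integrable \<mu> ?f" by (rule integrable_of_real)
        then have "L2_enorm \<mu> ?K \<le> ennreal C * ennreal (sqrt (measure \<mu> ?B))"
          using C(2)[of "a * sc m" ?f] a_pos f by simp
        also have "\<dots> = ennreal (C * sqrt (measure \<mu> ?B))"
          using C(1) by (simp add: ennreal_mult)
        finally have le: "L2_enorm \<mu> ?K \<le> ennreal (C * sqrt (measure \<mu> ?B))" .
        \<comment> \<open>\<open>L2_enorm\<close> is infinite if its integral is, so the finite
          bound permits real arithmetic from here on.\<close>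
        then have "N \<noteq> \<infinity>" unfolding L2_enorm_def N_def[symmetric] Let_def
          by (metis ennreal_less_top infinity_ennreal_def not_less)
        then have "ennreal (sqrt (enn2real N)) \<le> ennreal (C * sqrt (measure \<mu> ?B))"
          using le by (simp add: L2_enorm_def N_def[symmetric] Let_def)
        then have "sqrt (enn2real N) \<le> C * sqrt (measure \<mu> ?B)"
          using C(1) by (simp add: ennreal_le_iff)
        then have "(sqrt (enn2real N))\<^sup>2 \<le> (C * sqrt (measure \<mu> ?B))\<^sup>2"
          by (intro power_mono) auto
        then have "enn2real N \<le> C\<^sup>2 * measure \<mu> ?B" by (simp add: power_mult_distrib)
        also have "\<dots> \<le> C\<^sup>2 * (A * R ^ 3)" using measure_ball_le[OF R] by (intro mult_left_mono) auto
        finally have N: "enn2real N \<le> C\<^sup>2 * (A * R ^ 3)" .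
        have "(\<integral>p. indicator ?B p *\<^sub>R (?S p)\<^sup>2 \<partial>\<mu>) = enn2real (\<integral>\<^sup>+ p. ennreal (indicator ?B p *\<^sub>R (?S p)\<^sup>2) \<partial>\<mu>)"
        proof (rule integral_eq_nn_integral)
          have "?B \<in> sets \<mu>" by simp
          then show "(\<lambda>p. indicator ?B p *\<^sub>R (?S p)\<^sup>2) \<in> borel_measurable \<mu>"
            by measurable
        qed (auto simp: indicator_def)
        also have "\<dots> \<le> enn2real N"
        proof (rule enn2real_mono)
          show "(\<integral>\<^sup>+ p. ennreal (indicator ?B p *\<^sub>R (?S p)\<^sup>2) \<partial>\<mu>) \<le> N"
            unfolding N_def
          proof (rule nn_integral_mono)
            fix p
            show "ennreal (indicator ?B p *\<^sub>R (?S p)\<^sup>2) \<le> ennreal ((cmod (?K p))\<^sup>2)"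
            proof (cases "p \<in> ?B")
              case True
              have "cmod (?K p) = \<bar>?S p\<bar>"
                unfolding T_trunc_indicator[OF True] by (rule norm_of_real)
              then show ?thesis using True by simp
            qed simp
          qed
          show "N < top" using \<open>N \<noteq> \<infinity>\<close> by (simp add: less_top)
        qed
        also note N
        finally show ?thesis
          using R by (simp add: qform_gram finite_scales field_simps)
      qed
      then show ?thesis by (intro exI[of _ "C\<^sup>2 * A"]) (auto simp: X_def)
    qed
  qed
  then obtain C where C: "\<And>x. x \<in> X \<Longrightarrow> (\<Sum>j\<in>(case x of (p0, R, m) \<Rightarrow> scales R m). gram x j j) \<le> C" by blast
  have "(\<Sum>j\<in>scales R m. \<integral>p. indicator (ball p0 R) p *\<^sub>R (cutoff \<psi> p0 R j p)\<^sup>2 \<partial>\<mu>) \<le> C * R ^ 3"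
    if "0 < R" for p0 m R
    using C[of "(p0, R, m)"] that
    by (simp add: X_def gram_def power2_eq_square field_simps flip: sum_divide_distrib)
  then show ?thesis by blast
qed

end

end

section \<open>Bumps detecting asymmetry\<close>

text \<open>Kernels are evaluated at \<open>u = hinv q \<cdot> p\<close>, and \<open>hinv u\<close>
  is the position of \<open>q\<close> seen from \<open>p\<close>; the left-invariant distance
  measures errors in this position. Fourth powers make the distance polynomial, so that the bump
  lies in \<open>alg\<close>.\<close>

definition phi :: "heis \<Rightarrow> real \<Rightarrow> heis \<Rightarrow> real" where
  "phi u0 \<rho> u = flat 0 (\<rho> ^ 4 - dist (hinv u) u0 ^ 4)"

definition psi :: "heis \<Rightarrow> real \<Rightarrow> heis \<Rightarrow> real" where
  "psi u0 \<rho> u = phi u0 \<rho> u - phi u0 \<rho> (hbar u)"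

lemma phi_eq_0_iff: "0 < \<rho> \<Longrightarrow> phi u0 \<rho> u = 0 \<longleftrightarrow> \<rho> \<le> dist (hinv u) u0"
  using power_mono_iff[of \<rho> "dist (hinv u) u0" 4] by (simp add: phi_def)

lemma phi_alg: "phi u0 \<rho> \<in> alg"
proof -
  have "(\<lambda>p. hnorm p ^ 4) \<in> alg"
    unfolding hnorm_pow4
    by (intro alg.add alg.mult alg_power alg.const alg.xcoord alg.ycoord alg.tcoord)
  moreover have "(\<lambda>u. - xcoord u0 - xcoord u) \<in> alg" "(\<lambda>u. - ycoord u0 - ycoord u) \<in> alg"
    "(\<lambda>u. - tcoord u0 - tcoord u + (1/2) * (xcoord u0 * ycoord u - ycoord u0 * xcoord u)) \<in> alg"
    by (intro alg.add alg_diff alg.mult alg.const alg.xcoord alg.ycoord alg.tcoord)+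
  moreover have "xcoord (hinv u0 \<cdot> hinv u) = - xcoord u0 - xcoord u"
    "ycoord (hinv u0 \<cdot> hinv u) = - ycoord u0 - ycoord u"
    "tcoord (hinv u0 \<cdot> hinv u) = - tcoord u0 - tcoord u + (1/2) * (xcoord u0 * ycoord u - ycoord u0 * xcoord u)"
    for u by (simp_all add: hmult_def hinv_def)
  ultimately have "(\<lambda>u. hnorm (hinv u0 \<cdot> hinv u) ^ 4) \<in> alg"
    using alg_compose[of "\<lambda>p. hnorm p ^ 4" "\<lambda>u. hinv u0 \<cdot> hinv u"] by presburger
  then show ?thesis
    unfolding phi_def dist_heis_def by (intro alg.flat alg_diff alg.const)
qed

text \<open>With a = 2/3 |u0| the permitted window from 5a/4 to 7a/4 reaches from 5/6 |u0| to 7/6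
  |u0|. It is centred at |u0|, and \<rho> is at most its half-width.\<close>

lemma antisym_bump_psi:
  assumes "0 < \<rho>" "6 * \<rho> \<le> hnorm u0"
  shows "antisym_bump (2 / 3 * hnorm u0) (psi u0 \<rho>)"
proof -
  have "(\<lambda>u. phi u0 \<rho> (hbar u)) \<in> alg"
  proof (rule alg_compose[OF phi_alg])
    have "(\<lambda>p. (-1) * xcoord p) \<in> alg" "(\<lambda>p. (-1) * ycoord p) \<in> alg"
      by (intro alg.mult alg.const alg.xcoord alg.ycoord)+
    then show "(\<lambda>p. xcoord (hbar p)) \<in> alg" "(\<lambda>p. ycoord (hbar p)) \<in> alg"
      by (simp_all add: hbar_def)
  qed (simp add: hbar_def alg.tcoord)
  then have "psi u0 \<rho> \<in> alg"
    unfolding psi_def by (intro alg_diff phi_alg)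
  moreover have "5 / 4 * (2 / 3 * hnorm u0) \<le> hnorm p \<and> hnorm p \<le> 7 / 4 * (2 / 3 * hnorm u0)"
    if "psi u0 \<rho> p \<noteq> 0" for p
  proof -
    have "dist (hinv p) u0 < \<rho> \<or> dist (hinv (hbar p)) u0 < \<rho>"
      using that phi_eq_0_iff[OF assms(1), of u0 p] phi_eq_0_iff[OF assms(1), of u0 "hbar p"]
      by (auto simp: psi_def)
    then have "\<bar>hnorm p - hnorm u0\<bar> < \<rho>"
      using hnorm_dist[of "hinv p" u0] hnorm_dist[of "hinv (hbar p)" u0] by (auto simp: hnorm_hinv)
    then show ?thesis using assms by (auto simp: abs_le_iff)
  qed
  ultimately show ?thesis
    using assms by (auto simp: antisym_bump_def psi_def)
qed

lemma dist_hmult_perturb: "dist (v \<cdot> w) w \<le> hnorm v + 2 * sqrt (hnorm v * hnorm w)"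
  using hnorm_conj[of w v] by (simp add: dist_heis_def)

lemma sym_point_self: "sym_point p p = p"
  by (simp add: sym_point_def hmult_def)

lemma tau_symmetric_mono:
  assumes "tau_symmetric \<tau>' E p r" "\<tau>' \<le> \<tau>" "0 < r"
  shows "tau_symmetric \<tau> E p r"
proof -
  have "r * \<tau>' \<le> r * \<tau>" using assms by simp
  then show ?thesis
    using assms unfolding tau_symmetric_def
    by (smt (verit, ccfv_threshold) Int_iff mem_ball mult.commute)
qed

text \<open>Seen from \<open>q1'\<close>, the symmetric point of \<open>q2\<close> is
  \<open>hbar w'\<close>. If the reflected bump were nonzero at some \<open>q\<close> of
  \<open>E\<close>, then \<open>q\<close> would be within \<tau> s of that symmetric point. The
  rescaled position of \<open>q2\<close> may be off by \<rho>/8 from the net and by \<rho>/8 from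
  replacing \<open>q1\<close> by \<open>q1'\<close>. The latter is a perturbation on the left, whose
  effect is of the order of a square root; hence \<eta> is quadratic in \<rho>.\<close>

lemma phi_at_nonsymmetric:
  assumes \<tau>: "0 < \<tau>" and s: "0 < s" and \<rho>: "\<rho> = \<tau> / 6" and \<eta>: "\<eta> = (\<rho> / 48)\<^sup>2" "\<rho> \<le> 1"
    and near: "dist q1' q1 < \<eta> * s" and far: "dist q1 q2 \<le> 4 * s"
    and u0: "dist (hdil (1 / s) (hinv q1 \<cdot> q2)) u0 < \<rho> / 8"
  shows "q \<in> E \<Longrightarrow> \<tau> * s < infdist (sym_point q1' q2) E \<Longrightarrow>
      phi u0 \<rho> (hbar (hdil (1 / s) (hinv q \<cdot> q1'))) = 0"
    and "dist q2 q < \<rho> / 8 * s \<Longrightarrow>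
      flat 0 (\<rho> ^ 4 - (\<rho> / 2) ^ 4) \<le> phi u0 \<rho> (hdil (1 / s) (hinv q \<cdot> q1'))"
proof -
  define d where "d = hdil (1 / s)"
  define w where "w = hinv q1 \<cdot> q2"
  define w' where "w' = hinv q1' \<cdot> q2"
  define h where "h = hinv q1' \<cdot> q"
  have \<rho>0: "0 < \<rho>" using \<tau> \<rho> by simp
  have \<eta>s: "0 \<le> \<eta> * s" using s by (simp add: \<eta>)
  have dd: "dist x y = s * dist (d x) (d y)" for x y
    using s by (simp add: d_def dist_hdil)
  have inv: "hinv (d (hinv q \<cdot> q1')) = d h"
    by (simp add: d_def h_def hinv_hmult flip: hdil_hinv)
  have "w' = (hinv q1' \<cdot> q1) \<cdot> w"
    by (simp add: w'_def w_def hmult_assoc)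
  then have "dist w' w \<le> hnorm (hinv q1' \<cdot> q1) + 2 * sqrt (hnorm (hinv q1' \<cdot> q1) * hnorm w)"
    using dist_hmult_perturb by simp
  also have "\<dots> \<le> \<eta> * s + 2 * sqrt ((\<eta> * s) * (4 * s))"
    using near far \<eta>s by (intro add_mono mult_left_mono real_sqrt_le_mono mult_mono)
      (auto simp: w_def dist_commute[of q1] simp flip: dist_heis_def)
  \<comment> \<open>The square in \<eta> cancels the root; the factor 4 s bounds the distance of
    \<open>q1\<close> and \<open>q2\<close>.\<close>
  also have "(\<eta> * s) * (4 * s) = (\<rho> / 24 * s)\<^sup>2"
    by (simp add: \<eta> power2_eq_square)
  also have "\<eta> * s + 2 * sqrt ((\<rho> / 24 * s)\<^sup>2) = (\<eta> + \<rho> / 12) * s"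
    using s \<rho>0 by (simp add: algebra_simps)
  also have "\<dots> \<le> (\<rho> / 8) * s"
  proof (rule mult_right_mono)
    have "\<rho> * \<rho> \<le> \<rho> * 1" using \<rho>0 \<eta>(2) by (intro mult_left_mono) auto
    moreover have "\<eta> = \<rho> * \<rho> / 2304" by (simp add: \<eta> power2_eq_square)
    ultimately show "\<eta> + \<rho> / 12 \<le> \<rho> / 8" using \<rho>0 by linarith
  qed (use s in auto)
  finally have "s * dist (d w') (d w) \<le> s * (\<rho> / 8)" using dd[of w' w] by (simp add: mult.commute)
  then have dw: "dist (d w') (d w) \<le> \<rho> / 8" using s by simp
  have dw0: "dist (d w') u0 < \<rho> / 4"
    using dw u0 dist_triangle[of "d w'" u0 "d w"] by (simp add: d_def w_def)
  {
    assume q: "q \<in> E" and sym: "\<tau> * s < infdist (sym_point q1' q2) E"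
    show "phi u0 \<rho> (hbar (hdil (1 / s) (hinv q \<cdot> q1'))) = 0"
    proof (rule ccontr)
      assume "\<not> ?thesis"
      then have "dist (hbar (d h)) u0 < \<rho>"
        using \<rho>0 inv by (simp add: phi_eq_0_iff not_le flip: d_def hbar_hinv)
      \<comment> \<open>Radius \<rho> of the bump plus the error \<rho>/4; the sum stays below
        \<tau> because \<rho> = \<tau>/6.\<close>
      then have *: "dist (hbar (d h)) (d w') < 5 / 4 * \<rho>"
        using dw0 dist_triangle2[of "hbar (d h)" "d w'" u0] by simp
      have "infdist (sym_point q1' q2) E \<le> dist (sym_point q1' q2) q"
        by (rule infdist_le[OF q])
      also have "\<dots> = dist (q1' \<cdot> hbar w') (q1' \<cdot> h)"
        by (simp add: sym_point_eq w'_def h_def)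
      also have "\<dots> = dist (hbar h) w'"
        using dist_hbar[of "hbar w'" h] by (simp add: dist_commute)
      also have "\<dots> = s * dist (hbar (d h)) (d w')"
        using dd[of "hbar h" w'] by (simp add: d_def hbar_hdil)
      also have "\<dots> < s * \<tau>"
        using * \<rho> \<tau> s by (intro mult_strict_left_mono) auto
      finally show False using sym by (simp add: mult.commute)
    qed
  }
  assume "dist q2 q < \<rho> / 8 * s"
  then have "s * dist (d h) (d w') < s * (\<rho> / 8)"
    using dd[of h w'] by (simp add: h_def w'_def dist_commute mult.commute)
  then have "dist (d h) (d w') < \<rho> / 8" using s by simp
  then have "dist (d h) u0 \<le> \<rho> / 2"
    using dw0 dist_triangle[of "d h" u0 "d w'"] \<rho>0 by simp
  then show "flat 0 (\<rho> ^ 4 - (\<rho> / 2) ^ 4) \<le> phi u0 \<rho> (hdil (1 / s) (hinv q \<cdot> q1'))"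
    unfolding phi_def using inv by (intro flat_0_mono diff_left_mono) (simp add: d_def power_mono)
qed

text \<open>If \<open>E\<close> is bounded with diameter D, finitely many balls of radius D bound
  its total mass, which settles radii beyond D. A ball centred off \<open>E\<close> that meets
  \<open>E\<close> lies in a ball of twice the radius centred in \<open>E\<close>; this costs the
  factor 8.\<close>

lemma upper_regular_hausdorff:
  assumes "closed E" "three_regular E" "bounded E \<Longrightarrow> 0 < diameter E"
  shows "\<exists>A. upper_regular (hausdorff_restr 3 E) A"
proof -
  obtain A where A: "A \<ge> 1" "\<And>p r. p \<in> E \<Longrightarrow> r > 0 \<Longrightarrow> (bounded E \<longrightarrow> r \<le> diameter E) \<Longrightarrow>
        hausdorff 3 (E \<inter> ball p r) \<le> ennreal (A * r ^ 3)"
    using assms(2) unfolding three_regular_def by blast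
  interpret H: metric_outer "\<lambda>S. hausdorff 3 (S \<inter> E)" by (rule metric_outer_hausdorff)
  have "\<exists>A1\<ge>1. \<forall>p\<in>E. \<forall>r>0. hausdorff 3 (ball p r \<inter> E) \<le> ennreal (A1 * r ^ 3)"
  proof (cases "bounded E")
    case False
    then show ?thesis using A by (auto simp: Int_commute)
  next
    case True
    define D where "D = diameter E"
    have D: "0 < D" using assms(3) True by (simp add: D_def)
    have "compact E" using assms(1) True by (rule compact_heis)
    then obtain P where P: "finite P" "P \<subseteq> E" "E \<subseteq> (\<Union>x\<in>P. ball x D)"
      using seq_compact_imp_totally_bounded[of E] D by (auto simp: compact_eq_seq_compact_metric)
    have "hausdorff 3 (UNIV \<inter> E) \<le> hausdorff 3 ((\<Union>x\<in>P. ball x D) \<inter> E)"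
      using P by (intro hausdorff_mono) auto
    also have "\<dots> \<le> (\<Sum>x\<in>P. hausdorff 3 (ball x D \<inter> E))"
      by (rule H.m_finite_UN[OF P(1)])
    also have "\<dots> \<le> (\<Sum>x\<in>P. ennreal (A * D ^ 3))"
      using P D A(2) by (intro sum_mono) (auto simp: Int_commute D_def)
    also have "\<dots> = ennreal (real (card P) * (A * D ^ 3))"
      using A(1) D by (simp add: ennreal_of_nat_eq_real_of_nat ennreal_mult)
    finally have E: "hausdorff 3 E \<le> ennreal (real (card P) * (A * D ^ 3))" by simp
    have "hausdorff 3 (ball p r \<inter> E) \<le> ennreal (A * (1 + real (card P)) * r ^ 3)" if "p \<in> E" "0 < r" for p r
    proof (cases "r \<le> D")
      case True
      then have "hausdorff 3 (ball p r \<inter> E) \<le> ennreal (A * r ^ 3)"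
        using A(2)[OF that] by (simp add: Int_commute D_def)
      also have "\<dots> \<le> ennreal (A * (1 + real (card P)) * r ^ 3)"
        using A(1) that by (intro ennreal_leI mult_right_mono) auto
      finally show ?thesis .
    next
      case False
      have "hausdorff 3 (ball p r \<inter> E) \<le> hausdorff 3 E" by (intro hausdorff_mono) auto
      also note E
      also have "ennreal (real (card P) * (A * D ^ 3)) \<le> ennreal (A * (1 + real (card P)) * r ^ 3)"
      proof (rule ennreal_leI)
        have "real (card P) * (A * D ^ 3) \<le> (1 + real (card P)) * (A * r ^ 3)"
          using A(1) D False by (intro mult_mono power_mono) auto
        then show "real (card P) * (A * D ^ 3) \<le> A * (1 + real (card P)) * r ^ 3"
          by (simp add: mult_ac)
      qed
      finally show ?thesis .
    qed
    moreover have "1 * 1 \<le> A * (1 + real (card P))" using A(1) by (intro mult_mono) auto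
    ultimately show ?thesis by (intro exI[of _ "A * (1 + real (card P))"]) auto
  qed
  then obtain A1 where A1: "A1 \<ge> 1" "\<And>p r. p \<in> E \<Longrightarrow> 0 < r \<Longrightarrow> hausdorff 3 (ball p r \<inter> E) \<le> ennreal (A1 * r ^ 3)"
    by blast
  have "upper_regular (hausdorff_restr 3 E) (8 * A1)"
  proof
    fix r :: real and p assume r: "0 < r"
    show "emeasure (hausdorff_restr 3 E) (ball p r) \<le> ennreal (8 * A1 * r ^ 3)"
    proof (cases "ball p r \<inter> E = {}")
      case True
      then show ?thesis by (simp add: emeasure_hausdorff_restr hausdorff_empty)
    next
      case False
      then obtain p' where p': "p' \<in> E" "p' \<in> ball p r" by blast
      have "ball p r \<subseteq> ball p' (2 * r)"
      proof
        fix x assume "x \<in> ball p r"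
        then show "x \<in> ball p' (2 * r)"
          using p' dist_triangle3[of p' x p] by simp
      qed
      then have "hausdorff 3 (ball p r \<inter> E) \<le> hausdorff 3 (ball p' (2 * r) \<inter> E)"
        by (intro hausdorff_mono) auto
      also have "\<dots> \<le> ennreal (A1 * (2 * r) ^ 3)" using p' r by (intro A1) auto
      finally show ?thesis by (simp add: emeasure_hausdorff_restr power_mult_distrib mult_ac)
    qed
  qed (use A1 in auto)
  then show ?thesis ..
qed

text \<open>The balls of radius \<open>3 * s\<close> around a maximal \<open>6 * s\<close>-separated subset are disjoint,
  while those of radius \<open>6 * s\<close> cover.\<close>
lemma hausdorff_le_of_dense:
  assumes reg: "upper_regular (hausdorff_restr 3 E) A"
    and S: "S \<subseteq> E" "S \<subseteq> ball p0 R" and s: "0 < s" and c: "0 < c" and G: "G \<in> sets borel"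
    and dense: "\<And>p. p \<in> S \<Longrightarrow> c * s ^ 3 \<le> measure (hausdorff_restr 3 E) (G \<inter> ball p (3 * s))"
  shows "hausdorff 3 S \<le> ennreal (216 * A / c * measure (hausdorff_restr 3 E) (G \<inter> ball p0 (R + 3 * s)))"
proof -
  let ?\<mu> = "hausdorff_restr 3 E"
  interpret upper_regular ?\<mu> A by (rule reg)
  interpret H: metric_outer "\<lambda>S. hausdorff 3 (S \<inter> E)" by (rule metric_outer_hausdorff)
  define g where "g = measure ?\<mu> (G \<inter> ball p0 (R + 3 * s))"
  define sep where "sep P \<longleftrightarrow> finite P \<and> P \<subseteq> S \<and> (\<forall>x\<in>P. \<forall>y\<in>P. x \<noteq> y \<longrightarrow> 6 * s \<le> dist x y)" for P
  have card: "real (card P) * (c * s ^ 3) \<le> g" if P: "sep P" for P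
  proof -
    have fin: "emeasure ?\<mu> (G \<inter> ball x r) \<noteq> \<infinity>" for x r
      using emeasure_ball_finite[of x r] emeasure_mono[of "G \<inter> ball x r" "ball x r" ?\<mu>] by (auto simp: less_top top_unique)
    have "disjoint_family_on (\<lambda>x. G \<inter> ball x (3 * s)) P"
    proof (clarsimp simp: disjoint_family_on_def)
      fix x y assume xy: "x \<in> P" "y \<in> P" "x \<noteq> y"
      have "6 * s \<le> dist x y" using P xy by (auto simp: sep_def)
      then have "ball x (3 * s) \<inter> ball y (3 * s) = {}" by (intro disjoint_ballI) simp
      then show "G \<inter> ball x (3 * s) \<inter> (G \<inter> ball y (3 * s)) = {}" by blast
    qed
    then have "measure ?\<mu> (\<Union>x\<in>P. G \<inter> ball x (3 * s)) = (\<Sum>x\<in>P. measure ?\<mu> (G \<inter> ball x (3 * s)))"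
      using P G fin by (intro measure_finite_Union) (auto simp: sep_def)
    moreover have "(\<Sum>x\<in>P. c * s ^ 3) \<le> (\<Sum>x\<in>P. measure ?\<mu> (G \<inter> ball x (3 * s)))"
      using P by (intro sum_mono dense) (auto simp: sep_def)
    moreover have "measure ?\<mu> (\<Union>x\<in>P. G \<inter> ball x (3 * s)) \<le> g"
      unfolding g_def
    proof (rule measure_mono_fmeasurable)
      show "(\<Union>x\<in>P. G \<inter> ball x (3 * s)) \<subseteq> G \<inter> ball p0 (R + 3 * s)"
      proof (intro UN_least Int_mono subsetI order_refl)
        fix x y assume "x \<in> P" "y \<in> ball x (3 * s)"
        moreover have "x \<in> ball p0 R" using P S \<open>x \<in> P\<close> by (auto simp: sep_def)
        ultimately show "y \<in> ball p0 (R + 3 * s)" using dist_triangle[of p0 y x] by simp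
      qed
      show "(\<Union>x\<in>P. G \<inter> ball x (3 * s)) \<in> sets ?\<mu>" using G P by (auto simp: sep_def intro!: sets.finite_UN)
      show "G \<inter> ball p0 (R + 3 * s) \<in> fmeasurable ?\<mu>" using G fin by (auto simp: fmeasurable_def less_top)
    qed
    ultimately show ?thesis by simp
  qed
  have "sep {}" by (simp add: sep_def)
  \<comment> \<open>Each point of a separated set accounts for mass at least
    \<open>c * s ^ 3\<close> out of the finite amount \<open>g\<close>. Cardinalities are thus
    bounded and a separated set of largest size exists.\<close>
  moreover have "\<forall>P. sep P \<longrightarrow> card P < Suc (nat \<lfloor>g / (c * s ^ 3)\<rfloor>)"
  proof (intro allI impI)
    fix P assume "sep P"
    then have "real (card P) \<le> g / (c * s ^ 3)" using card c s by (simp add: pos_le_divide_eq)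
    then show "card P < Suc (nat \<lfloor>g / (c * s ^ 3)\<rfloor>)" by (simp add: le_nat_floor less_Suc_eq_le)
  qed
  ultimately have "\<exists>P. sep P \<and> (\<forall>Q. sep Q \<longrightarrow> card Q \<le> card P)"
    by (rule ex_has_greatest_nat)
  then obtain P where P: "sep P" "\<And>Q. sep Q \<Longrightarrow> card Q \<le> card P" by blast
  have "S \<subseteq> (\<Union>x\<in>P. ball x (6 * s))"
  proof (rule ccontr)
    assume "\<not> ?thesis"
    then obtain y where y: "y \<in> S" "\<And>x. x \<in> P \<Longrightarrow> 6 * s \<le> dist x y"
      by (auto simp: subset_iff not_less Bex_def)
    then have "y \<notin> P" using s by force
    have "sep (insert y P)" using P(1) y by (auto simp: sep_def dist_commute)
    then have "card (insert y P) \<le> card P" by (rule P)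
    then show False using \<open>y \<notin> P\<close> P(1) by (simp add: sep_def)
  qed
  then have "hausdorff 3 S \<le> hausdorff 3 ((\<Union>x\<in>P. ball x (6 * s)) \<inter> E)"
    using S by (intro hausdorff_mono) auto
  also have "\<dots> \<le> (\<Sum>x\<in>P. hausdorff 3 (ball x (6 * s) \<inter> E))"
    using P(1) by (intro H.m_finite_UN) (auto simp: sep_def)
  also have "\<dots> \<le> (\<Sum>x\<in>P. ennreal (A * (6 * s) ^ 3))"
    using ball_le[of "6 * s"] s by (intro sum_mono) (simp add: emeasure_hausdorff_restr)
  also have "\<dots> = ennreal (real (card P) * (A * (6 * s) ^ 3))"
    using A_ge s by (simp add: ennreal_of_nat_eq_real_of_nat ennreal_mult)
  also have "\<dots> \<le> ennreal (216 * A / c * g)"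
  proof (rule ennreal_leI)
    \<comment> \<open>The factor 216 is 6^3, from the radius of the covering balls.\<close>
    have "real (card P) * (A * (6 * s) ^ 3) = 216 * A / c * (real (card P) * (c * s ^ 3))"
      using c by (simp add: power_mult_distrib)
    also have "\<dots> \<le> 216 * A / c * g"
      using card[OF P(1)] A_ge c by (intro mult_left_mono) auto
    finally show "real (card P) * (A * (6 * s) ^ 3) \<le> 216 * A / c * g" .
  qed
  finally show ?thesis by (simp add: g_def)
qed

section \<open>Local symmetry\<close>

lemma annulus_net:
  assumes "0 < e"
  shows "\<exists>N. finite N \<and> N \<subseteq> {u. b \<le> hnorm u \<and> hnorm u \<le> c} \<and>
    (\<forall>u. b \<le> hnorm u \<and> hnorm u \<le> c \<longrightarrow> (\<exists>u0\<in>N. dist u u0 < e))"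
proof -
  let ?K = "{u. b \<le> hnorm u \<and> hnorm u \<le> c}"
  have "closed ?K"
    by (intro closed_Collect_conj closed_Collect_le continuous_hnorm continuous_on_const)
  moreover have "?K \<subseteq> cball hzero c" by (auto simp: dist_commute[of hzero] dist_hzero)
  then have "bounded ?K" by (rule bounded_subset[OF bounded_cball])
  ultimately have "seq_compact ?K" using compact_heis compact_eq_seq_compact_metric by blast
  then obtain N where "finite N" "N \<subseteq> ?K" "?K \<subseteq> (\<Union>x\<in>N. ball x e)"
    using seq_compact_imp_totally_bounded[of ?K] assms by blast
  then show ?thesis by (intro exI[of _ N]) (auto simp: subset_iff dist_commute)
qed

lemma AE_hausdorff_restr: "closed E \<Longrightarrow> AE q in hausdorff_restr s E. q \<in> E"
  by (rule AE_I[of _ _ "- E"]) (auto simp: emeasure_hausdorff_restr hausdorff_empty)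

text \<open>By \<open>neg\<close> the negative half of \<open>psi\<close> vanishes on
  \<open>E\<close>, so almost everywhere the integrand is nonnegative. No cancellation remains, and
  the ball around \<open>q2\<close> alone gives the lower bound.\<close>

lemma cutoff_psi_ge:
  assumes E: "closed E" and reg: "upper_regular (hausdorff_restr 3 E) A"
    and \<rho>: "0 < \<rho>" "6 * \<rho> \<le> hnorm u0" and s: "s = sc j"
    and neg: "\<And>q. q \<in> E \<Longrightarrow> phi u0 \<rho> (hbar (hdil (1 / s) (hinv q \<cdot> p))) = 0"
    and pos: "\<And>q. dist q2 q < \<rho> / 8 * s \<Longrightarrow> c \<le> phi u0 \<rho> (hdil (1 / s) (hinv q \<cdot> p))"
    and sub: "ball q2 (\<rho> / 8 * s) \<subseteq> ball p0 R"
  shows "c / s ^ 3 * measure (hausdorff_restr 3 E) (ball q2 (\<rho> / 8 * s))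
     \<le> upper_regular.cutoff (hausdorff_restr 3 E) (psi u0 \<rho>) p0 R j p"
proof -
  let ?\<mu> = "hausdorff_restr 3 E"
  interpret upper_regular ?\<mu> A by (rule reg)
  let ?b = "ball q2 (\<rho> / 8 * s)"
  have s0: "0 < s" by (simp add: s)
  have "c / s ^ 3 * measure ?\<mu> ?b = (\<integral>q. indicator ?b q *\<^sub>R (c / s ^ 3) \<partial>?\<mu>)"
    using emeasure_ball_finite by simp
  also have "\<dots> \<le> cutoff (psi u0 \<rho>) p0 R j p"
    unfolding cutoff_def
  proof (rule integral_mono_AE)
    show "integrable ?\<mu> (\<lambda>q. indicator ?b q *\<^sub>R (c / s ^ 3))"
      by (rule integrableI_bounded_set_indicator[where B = "\<bar>c / s ^ 3\<bar>"])
        (use emeasure_ball_finite in auto)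
    show "integrable ?\<mu> (\<lambda>q. indicator (ball p0 R) q *\<^sub>R dbump (psi u0 \<rho>) j (hinv q \<cdot> p))"
      by (rule cutoff_integrable[OF antisym_bump_psi[OF \<rho>]])
    show "AE q in ?\<mu>. indicator ?b q *\<^sub>R (c / s ^ 3)
       \<le> indicator (ball p0 R) q *\<^sub>R dbump (psi u0 \<rho>) j (hinv q \<cdot> p)"
      using AE_hausdorff_restr[OF E]
    proof eventually_elim
      case (elim q)
      have eq: "dbump (psi u0 \<rho>) j (hinv q \<cdot> p) = phi u0 \<rho> (hdil (1 / s) (hinv q \<cdot> p)) / s ^ 3"
        using neg[OF elim] by (simp add: dbump_def psi_def s)
      show ?case
      proof (cases "q \<in> ?b")
        case True
        then have "c \<le> phi u0 \<rho> (hdil (1 / s) (hinv q \<cdot> p))" by (intro pos) simp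
        then show ?thesis using True sub s0 by (auto simp: eq divide_right_mono)
      next
        case False
        have "0 \<le> phi u0 \<rho> (hdil (1 / s) (hinv q \<cdot> p))" by (simp add: phi_def)
        then show ?thesis using False s0 by (simp add: eq)
      qed
    qed
  qed
  finally show ?thesis .
qed

lemma measure_hausdorff_restr_ge:
  assumes "B \<in> sets borel" "ennreal x \<le> hausdorff s (E \<inter> B)" "emeasure (hausdorff_restr s E) B < \<infinity>" "0 \<le> x"
  shows "x \<le> measure (hausdorff_restr s E) B"
proof -
  have "ennreal x \<le> emeasure (hausdorff_restr s E) B"
    using assms by (simp add: emeasure_hausdorff_restr Int_commute)
  then show ?thesis
    using assms(3,4) by (simp add: measure_def) (metis enn2real_ennreal enn2real_mono infinity_ennreal_def)
qed

text \<open>The witness \<open>q1\<close> is within 2 s of \<open>p\<close>, and every point of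
  \<open>E\<close> in the \<eta> s-ball around it belongs to \<open>G\<close>; lower regularity
  supplies the mass. The constant \<open>c1\<close> is the guaranteed height of the bump times the
  mass near \<open>q2\<close>, in which the powers of s cancel. The balls of radius
  \<open>4 * R\<close> and \<open>10 * R\<close> are large enough to contain the points near
  \<open>q1\<close> and \<open>q2\<close>.\<close>

lemma nonsymmetric_dense:
  assumes E: "closed E" and reg: "upper_regular (hausdorff_restr 3 E) A"
    and A1: "1 \<le> A1"
    and low: "\<And>p r. p \<in> E \<Longrightarrow> 0 < r \<Longrightarrow> (bounded E \<longrightarrow> r \<le> diameter E) \<Longrightarrow> ennreal (r ^ 3 / A1) \<le> hausdorff 3 (E \<inter> ball p r)"
    and \<tau>: "0 < \<tau>" "\<tau> \<le> 1" and \<rho>: "\<rho> = \<tau> / 6" and \<eta>: "\<eta> = (\<rho> / 48)\<^sup>2"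
    and N: "N \<subseteq> {u. \<tau> \<le> hnorm u \<and> hnorm u \<le> 4}"
      "\<And>u. \<tau> \<le> hnorm u \<Longrightarrow> hnorm u \<le> 4 \<Longrightarrow> \<exists>u0\<in>N. dist u u0 < \<rho> / 8"
    and s: "s = sc j" "s \<le> R" and r: "s \<le> r" "r < 2 * s"
    and p: "p \<in> E" "p \<in> ball p0 R" and nonsym: "\<not> tau_symmetric \<tau> E p r"
    and c1: "c1 = flat 0 (\<rho> ^ 4 - (\<rho> / 2) ^ 4) * (\<rho> / 8) ^ 3 / A1"
    and G: "G = (\<Union>u\<in>N. {q \<in> ball p0 (4 * R). c1 \<le> \<bar>upper_regular.cutoff (hausdorff_restr 3 E) (psi u \<rho>) p0 (10 * R) j q\<bar>})"
    and G_borel: "G \<in> sets borel"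
  shows "\<eta> ^ 3 / A1 * s ^ 3 \<le> measure (hausdorff_restr 3 E) (G \<inter> ball p (3 * s))"
proof -
  let ?\<mu> = "hausdorff_restr 3 E"
  interpret upper_regular ?\<mu> A by (rule reg)
  have s0: "0 < s" by (simp add: s)
  have \<rho>0: "0 < \<rho>" "\<rho> \<le> 1" using \<rho> \<tau> by auto
  have "\<rho> * \<rho> \<le> \<rho> * 1" using \<rho>0 by (intro mult_left_mono) auto
  moreover have "\<eta> = \<rho> * \<rho> / 2304" by (simp add: \<eta> power2_eq_square)
  ultimately have \<eta>0: "0 < \<eta>" "\<eta> \<le> \<tau>" using \<rho>0 \<rho> by (simp add: \<eta>, linarith)
  obtain q1 q2 where q: "q1 \<in> E" "q2 \<in> E" "dist p q1 < r" "dist p q2 < r"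
    and far: "\<And>q1'. q1' \<in> E \<Longrightarrow> dist q1 q1' < r * \<tau> \<Longrightarrow> \<tau> * r < infdist (sym_point q1' q2) E"
    using nonsym unfolding tau_symmetric_def by (auto simp: not_le Bex_def)
  \<comment> \<open>\<open>q1\<close> is itself a candidate for \<open>q1'\<close>. Since its
    distance to the symmetric point equals its distance to \<open>q2\<close>, the failure of
    symmetry keeps \<open>q1\<close> and \<open>q2\<close> apart; this is the inner radius of the
    annulus.\<close>
  have "\<tau> * r < infdist (sym_point q1 q2) E" using q \<tau> r s0 by (intro far) auto
  also have "\<dots> \<le> dist (sym_point q1 q2) q1" by (rule infdist_le[OF q(1)])
  also have "\<dots> = dist q1 q2" by (simp add: dist_commute sym_point_dist)
  finally have d1: "\<tau> * r < dist q1 q2" .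
  have \<tau>s: "\<tau> * s \<le> \<tau> * r" using \<tau> r by simp
  have d2: "dist q1 q2 \<le> 4 * s" using q r dist_triangle3[of q1 q2 p] by linarith
  \<comment> \<open>The two witnesses force \<open>E\<close> to be large at scale s, which makes
    lower regularity available at the radii used below.\<close>
  have diam: "bounded E \<longrightarrow> \<tau> * s \<le> diameter E"
    using d1 \<tau>s diameter_bounded_bound[OF _ q(1,2)] by (auto intro: order_trans less_imp_le)
  define w where "w = hdil (1 / s) (hinv q1 \<cdot> q2)"
  have w: "hnorm w = dist q1 q2 / s"
    using s0 unfolding w_def dist_commute[of q1 q2] by (simp add: hnorm_hdil dist_heis_def)
  have "\<tau> \<le> hnorm w" "hnorm w \<le> 4"
    unfolding w using d1 \<tau>s d2 s0 by (auto simp: field_simps)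
  then obtain u0 where u0: "u0 \<in> N" "dist w u0 < \<rho> / 8" using N(2) by blast
  have u0n: "6 * \<rho> \<le> hnorm u0" using u0(1) N(1) \<rho> by auto
  have mq2: "(\<rho> / 8 * s) ^ 3 / A1 \<le> measure ?\<mu> (ball q2 (\<rho> / 8 * s))"
  proof (rule measure_hausdorff_restr_ge)
    have "\<rho> / 8 * s \<le> \<tau> * s" using s0 \<rho> \<tau> by (intro mult_right_mono) auto
    then show "ennreal ((\<rho> / 8 * s) ^ 3 / A1) \<le> hausdorff 3 (E \<inter> ball q2 (\<rho> / 8 * s))"
      using diam \<rho>0(1) s0 by (intro low q mult_pos_pos) (blast intro: order_trans | simp)+
  qed (use emeasure_ball_finite A1 \<rho>0 s0 in auto)
  have mq1: "(\<eta> * s) ^ 3 / A1 \<le> measure ?\<mu> (ball q1 (\<eta> * s))"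
  proof (rule measure_hausdorff_restr_ge)
    have "\<eta> * s \<le> \<tau> * s" using s0 \<eta>0 by (intro mult_right_mono) auto
    then show "ennreal ((\<eta> * s) ^ 3 / A1) \<le> hausdorff 3 (E \<inter> ball q1 (\<eta> * s))"
      using diam \<eta>0(1) s0 by (intro low q mult_pos_pos) (blast intro: order_trans | simp)+
  qed (use emeasure_ball_finite A1 \<eta>0 s0 in auto)
  have \<eta>s: "\<eta> * s \<le> \<tau> * s" "\<tau> * s \<le> 1 * s" using s0 \<eta>0 \<tau> by (auto intro!: mult_right_mono)
  have in_G: "q1' \<in> G \<inter> ball p (3 * s)" if q1': "q1' \<in> E" "q1' \<in> ball q1 (\<eta> * s)" for q1'
  proof -
    have d: "dist q1 q1' < \<eta> * s" using q1' by simp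
    have "dist p q1' < 3 * s"
      using d dist_triangle[of p q1' q1] q(3) r \<eta>s by linarith
    moreover have "dist p0 q1' < 4 * R"
      using calculation dist_triangle[of p0 q1' p] p s by simp
    moreover have "c1 \<le> \<bar>cutoff (psi u0 \<rho>) p0 (10 * R) j q1'\<bar>"
    proof -
      note P = phi_at_nonsymmetric[OF \<tau>(1) s0 \<rho> \<eta> \<rho>0(2), of q1' q1 q2 u0]
      have near: "dist q1' q1 < \<eta> * s" using d by (simp add: dist_commute)
      have "\<tau> * r < infdist (sym_point q1' q2) E"
        using d \<eta>s \<tau>s by (intro far q1') (simp add: mult.commute)
      then have "\<tau> * s < infdist (sym_point q1' q2) E" using \<tau>s by linarith
      note * = P(1)[OF near d2 u0(2)[unfolded w_def] _ this] P(2)[OF near d2 u0(2)[unfolded w_def]]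
      have sub: "ball q2 (\<rho> / 8 * s) \<subseteq> ball p0 (10 * R)"
      proof
        fix x assume x: "x \<in> ball q2 (\<rho> / 8 * s)"
        have "\<rho> / 8 * s \<le> 1 * s" using \<rho>0 s0 by (intro mult_right_mono) auto
        then have "dist q2 x < s" using x by simp
        then have "dist p0 x < 10 * R"
          using dist_triangle[of p0 x p] dist_triangle[of p x q2] q(4) r p s s0 by simp
        then show "x \<in> ball p0 (10 * R)" by simp
      qed
      let ?f = "flat 0 (\<rho> ^ 4 - (\<rho> / 2) ^ 4)"
      have "c1 = ?f / s ^ 3 * ((\<rho> / 8 * s) ^ 3 / A1)"
        using s0 unfolding c1 power_mult_distrib[of "\<rho> / 8" s] by simp
      also have "\<dots> \<le> ?f / s ^ 3 * measure ?\<mu> (ball q2 (\<rho> / 8 * s))"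
        using mq2 s0 by (intro mult_left_mono) auto
      also have "\<dots> \<le> cutoff (psi u0 \<rho>) p0 (10 * R) j q1'"
        by (rule cutoff_psi_ge[OF E reg \<rho>0(1) u0n s(1) * sub])
      finally show ?thesis by simp
    qed
    ultimately show ?thesis using u0(1) unfolding G by auto
  qed
  have "\<eta> ^ 3 / A1 * s ^ 3 = (\<eta> * s) ^ 3 / A1" by (simp add: power_mult_distrib)
  also have "\<dots> \<le> measure ?\<mu> (ball q1 (\<eta> * s))" by (rule mq1)
  also have "\<dots> \<le> measure ?\<mu> (G \<inter> ball p (3 * s))"
    unfolding measure_def
  proof (rule enn2real_mono)
    have "hausdorff 3 (ball q1 (\<eta> * s) \<inter> E) \<le> hausdorff 3 (G \<inter> ball p (3 * s) \<inter> E)"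
      using in_G by (intro hausdorff_mono) blast
    then show "emeasure ?\<mu> (ball q1 (\<eta> * s)) \<le> emeasure ?\<mu> (G \<inter> ball p (3 * s))"
      using G_borel by (simp add: emeasure_hausdorff_restr)
    have "emeasure ?\<mu> (G \<inter> ball p (3 * s)) \<le> emeasure ?\<mu> (ball p (3 * s))"
      by (intro emeasure_mono) auto
    also have "\<dots> < top" using emeasure_ball_finite by simp
    finally show "emeasure ?\<mu> (G \<inter> ball p (3 * s)) < top" .
  qed
  finally show ?thesis .
qed

section \<open>Chebyshev's inequality, the dyadic splitting of the integral, and the
  conclusion\<close>

lemma (in upper_regular) chebyshev_cutoff:
  assumes \<psi>: "antisym_bump a \<psi>" and c: "0 < c" and R: "R' \<le> R"
  shows "measure \<mu> {q \<in> ball p0 R'. c \<le> \<bar>cutoff \<psi> p0 R j q\<bar>} * c\<^sup>2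
    \<le> (\<integral>q. indicator (ball p0 R) q *\<^sub>R (cutoff \<psi> p0 R j q)\<^sup>2 \<partial>\<mu>)"
    and "{q \<in> ball p0 R'. c \<le> \<bar>cutoff \<psi> p0 R j q\<bar>} \<in> sets borel"
proof -
  let ?S = "{q \<in> ball p0 R'. c \<le> \<bar>cutoff \<psi> p0 R j q\<bar>}"
  have "closed {q. c \<le> \<bar>cutoff \<psi> p0 R j q\<bar>}"
    by (intro closed_Collect_le continuous_on_rabs continuous_on_const continuous_cutoff[OF \<psi>])
  then have "ball p0 R' \<inter> {q. c \<le> \<bar>cutoff \<psi> p0 R j q\<bar>} \<in> sets borel" by simp
  then show S: "?S \<in> sets borel" by (simp add: Int_def)
  have "emeasure \<mu> ?S \<le> emeasure \<mu> (ball p0 R')" by (intro emeasure_mono) auto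
  then have fin: "emeasure \<mu> ?S < \<infinity>" using emeasure_ball_finite by (rule le_less_trans)
  have "measure \<mu> ?S * c\<^sup>2 = (\<integral>q. indicator ?S q *\<^sub>R c\<^sup>2 \<partial>\<mu>)" using fin S by simp
  also have "\<dots> \<le> (\<integral>q. indicator (ball p0 R) q *\<^sub>R (cutoff \<psi> p0 R j q * cutoff \<psi> p0 R j q) \<partial>\<mu>)"
  proof (rule integral_mono[OF _ cutoff_mult_integrable[OF \<psi>]])
    show "integrable \<mu> (\<lambda>q. indicator ?S q *\<^sub>R c\<^sup>2)"
      by (rule integrableI_bounded_set_indicator[where B = "c\<^sup>2"]) (use fin S in auto)
    fix q
    show "indicator ?S q *\<^sub>R c\<^sup>2 \<le> indicator (ball p0 R) q *\<^sub>R (cutoff \<psi> p0 R j q * cutoff \<psi> p0 R j q)"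
    proof (cases "q \<in> ?S")
      case True
      then have "q \<in> ball p0 R" using R by auto
      moreover have "c\<^sup>2 \<le> \<bar>cutoff \<psi> p0 R j q\<bar>\<^sup>2" using True c by (intro power_mono) auto
      ultimately show ?thesis using True by (simp add: power2_eq_square)
    qed simp
  qed
  finally show "measure \<mu> ?S * c\<^sup>2 \<le> (\<integral>q. indicator (ball p0 R) q *\<^sub>R (cutoff \<psi> p0 R j q)\<^sup>2 \<partial>\<mu>)"
    by (simp add: power2_eq_square)
qed

text \<open>On the interval from 2^j to 2^(j+1) the factor 1/r is at most 2^(-j), the reciprocal of
  the length, so each dyadic interval has weight at most 1. \<open>H\<close> is not assumed
  measurable; it is first dominated by a step function.\<close>

lemma nn_integral_dyadic_le:
  fixes H :: "real \<Rightarrow> ennreal" and K :: "int \<Rightarrow> ennreal"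
  assumes R: "0 < R" and H: "\<And>r j. 0 < r \<Longrightarrow> r < R \<Longrightarrow> sc j \<le> r \<Longrightarrow> r < 2 * sc j \<Longrightarrow> H r \<le> K j"
    and K: "\<And>n. (\<Sum>i<n. K (\<lfloor>log 2 R\<rfloor> - int i)) \<le> C"
  shows "(\<integral>\<^sup>+ r\<in>{0<..<R}. H r / ennreal r \<partial>lborel) \<le> C"
proof -
  define J where "J = \<lfloor>log 2 R\<rfloor>"
  define S where "S i = sc (J - int i)" for i :: nat
  have "(\<integral>\<^sup>+ r\<in>{0<..<R}. H r / ennreal r \<partial>lborel)
     \<le> (\<integral>\<^sup>+ r. (\<Sum>i. K (J - int i) / ennreal (S i) * indicator {S i..<2 * S i} r) \<partial>lborel)"
  proof (rule nn_integral_mono)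
    fix r :: real
    show "H r / ennreal r * indicator {0<..<R} r
      \<le> (\<Sum>i. K (J - int i) / ennreal (S i) * indicator {S i..<2 * S i} r)"
    proof (cases "r \<in> {0<..<R}")
      case True
      define j where "j = \<lfloor>log 2 r\<rfloor>"
      have j: "sc j \<le> r" "r < 2 * sc j" using sc_floor[of r] True by (auto simp: j_def)
      have "j \<le> J" unfolding j_def J_def using True by (intro floor_mono) simp
      define i where "i = nat (J - j)"
      have ji: "J - int i = j" using \<open>j \<le> J\<close> by (simp add: i_def)
      have "H r / ennreal r \<le> K j / ennreal (sc j)"
        unfolding divide_ennreal_def
      proof (rule mult_mono)
        show "inverse (ennreal r) \<le> inverse (ennreal (sc j))"
          using j True by (simp add: inverse_ennreal ennreal_leI le_imp_inverse_le)
      qed (use H j True in auto)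
      also have "\<dots> = K (J - int i) / ennreal (S i) * indicator {S i..<2 * S i} r"
        using j by (simp add: S_def ji)
      also have "\<dots> = (\<Sum>i\<in>{i}. K (J - int i) / ennreal (S i) * indicator {S i..<2 * S i} r)"
        by (simp only: sum.insert finite.emptyI empty_iff not_False_eq_True sum.empty add_0_right)
      also have "\<dots> \<le> (\<Sum>i. K (J - int i) / ennreal (S i) * indicator {S i..<2 * S i} r)"
        by (rule sum_le_suminf) auto
      finally show ?thesis using True by simp
    qed simp
  qed
  also have "\<dots> = (\<Sum>i. \<integral>\<^sup>+ r. K (J - int i) / ennreal (S i) * indicator {S i..<2 * S i} r \<partial>lborel)"
    by (rule nn_integral_suminf) simp
  also have "\<dots> = (\<Sum>i. K (J - int i))"
  proof (rule suminf_cong)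
    fix i
    have "0 < S i" by (simp add: S_def)
    have "(\<integral>\<^sup>+ r. K (J - int i) / ennreal (S i) * indicator {S i..<2 * S i} r \<partial>lborel)
      = K (J - int i) / ennreal (S i) * emeasure lborel {S i..<2 * S i}"
      by (rule nn_integral_cmult_indicator) simp
    also have "\<dots> = K (J - int i) / ennreal (S i) * ennreal (S i)"
      using \<open>0 < S i\<close> by simp
    also have "\<dots> = K (J - int i)"
      using \<open>0 < S i\<close> by (simp add: ennreal_divide_times)
    finally show "(\<integral>\<^sup>+ r. K (J - int i) / ennreal (S i) * indicator {S i..<2 * S i} r \<partial>lborel) = K (J - int i)" .
  qed
  also have "\<dots> \<le> C" using K by (intro suminf_le_const) (auto simp: J_def)
  finally show ?thesis .
qed

theorem theorem4p2:
  fixes E :: "heis set"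
  assumes "closed E"
    and "three_regular E"
    and "\<And>K. admissible_kernel K \<Longrightarrow> T_bounded_L2 K (hausdorff_restr 3 E)"
  shows "\<forall>\<tau>>0. \<exists>C>0. \<forall>p0\<in>E. \<forall>R>0.
    (\<integral>\<^sup>+ r\<in>{0<..<R}. hausdorff 3 {p \<in> E \<inter> ball p0 R. \<not> tau_symmetric \<tau> E p r} / ennreal r \<partial>lborel)
      \<le> ennreal (C * R ^ 3)"
proof (cases "bounded E \<and> diameter E \<le> 0")
  case True
  have eq: "x = y" if "x \<in> E" "y \<in> E" for x y
    using order_trans[OF diameter_bounded_bound[of E x y]] True that by fastforce
  have "tau_symmetric \<tau> E p r" if "0 < \<tau>" "0 < r" for \<tau> p r
    unfolding tau_symmetric_def
  proof (intro ballI)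
    fix q1 q2 assume q: "q1 \<in> E \<inter> ball p r" "q2 \<in> E \<inter> ball p r"
    then have "q1 = q2" using eq by blast
    then show "\<exists>q1'\<in>E \<inter> ball q1 (r * \<tau>). infdist (sym_point q1' q2) E \<le> \<tau> * r"
      using q that by (intro bexI[of _ q1]) (auto simp: sym_point_self)
  qed
  then have eq0: "hausdorff 3 {p \<in> E \<inter> ball p0 R. \<not> tau_symmetric \<tau> E p r} / ennreal r * indicator {0<..<R} r = 0"
    if "0 < \<tau>" for \<tau> R r p0
    using that by (cases "0 < r") (auto simp: hausdorff_empty)
  show ?thesis by (intro allI impI exI[of _ 1] conjI ballI) (simp_all only: eq0, simp_all)
next
  case nontriv: False
  let ?\<mu> = "hausdorff_restr 3 E"
  obtain A where reg: "upper_regular ?\<mu> A"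
    using upper_regular_hausdorff[OF assms(1,2)] nontriv by force
  interpret upper_regular ?\<mu> A by (rule reg)
  obtain A1 where A1: "1 \<le> A1"
    "\<And>p r. p \<in> E \<Longrightarrow> 0 < r \<Longrightarrow> (bounded E \<longrightarrow> r \<le> diameter E) \<Longrightarrow> ennreal (r ^ 3 / A1) \<le> hausdorff 3 (E \<inter> ball p r)"
    using assms(2) unfolding three_regular_def by blast
  show ?thesis
  proof (intro allI impI)
    fix \<tau>0 :: real assume "0 < \<tau>0"
    \<comment> \<open>Failure of symmetry for \<open>\<tau>0\<close> implies failure for any smaller
      parameter, so it may be assumed to be at most 1.\<close>
    define \<tau> where "\<tau> = min \<tau>0 1"
    have \<tau>: "0 < \<tau>" "\<tau> \<le> 1" "\<tau> \<le> \<tau>0" using \<open>0 < \<tau>0\<close> by (auto simp: \<tau>_def)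
    \<comment> \<open>The bumps then satisfy \<open>6 * \<rho> \<le> hnorm u\<close> for all
      \<open>u\<close> in the annulus, as \<open>antisym_bump_psi\<close> requires.\<close>
    define \<rho> where "\<rho> = \<tau> / 6"
    define \<eta> where "\<eta> = (\<rho> / 48)\<^sup>2"
    define c1 where "c1 = flat 0 (\<rho> ^ 4 - (\<rho> / 2) ^ 4) * (\<rho> / 8) ^ 3 / A1"
    define c2 where "c2 = \<eta> ^ 3 / A1"
    have \<rho>0: "0 < \<rho>" using \<tau> by (simp add: \<rho>_def)
    have "0 < flat 0 (\<rho> ^ 4 - (\<rho> / 2) ^ 4)"
      using \<rho>0 flat_nonneg[of 0] by (intro le_neq_trans) (auto simp: power_divide dest: sym)
    then have c1: "0 < c1" using \<rho>0 A1 by (simp add: c1_def)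
    have c2: "0 < c2" using \<rho>0 A1 by (simp add: c2_def \<eta>_def)
    \<comment> \<open>The annulus contains all rescaled positions of \<open>q2\<close> seen from
      \<open>q1\<close>: they have norm at least \<tau>, and at most 4 since both points are within
      2 s of \<open>p\<close>.\<close>
    obtain N where N: "finite N" "N \<subseteq> {u. \<tau> \<le> hnorm u \<and> hnorm u \<le> 4}"
      "\<And>u. \<tau> \<le> hnorm u \<Longrightarrow> hnorm u \<le> 4 \<Longrightarrow> \<exists>u0\<in>N. dist u u0 < \<rho> / 8"
      using annulus_net[of "\<rho> / 8" \<tau> 4] \<rho>0 by auto
    have bump: "antisym_bump (2 / 3 * hnorm u) (psi u \<rho>)" if "u \<in> N" for u
      using that N(2) \<rho>0 by (intro antisym_bump_psi) (auto simp: \<rho>_def)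
    define en where "en u p0 R j = (\<integral>q. indicator (ball p0 R) q *\<^sub>R (cutoff (psi u \<rho>) p0 R j q)\<^sup>2 \<partial>?\<mu>)" for u p0 R j
    have "\<exists>C. \<forall>p0 m. \<forall>R>0. (\<Sum>j\<in>scales (2 / 3 * hnorm u) R m. en u p0 R j) \<le> C * R ^ 3" if "u \<in> N" for u
      unfolding en_def by (rule carleson[OF bump[OF that]]) (intro assms(3) admissible_dker[OF bump[OF that]])
    then obtain C where C: "\<And>u p0 m R. u \<in> N \<Longrightarrow> 0 < R \<Longrightarrow>
       (\<Sum>j\<in>scales (2 / 3 * hnorm u) R m. en u p0 R j) \<le> C u * R ^ 3" by metis
    define M where "M = 216 * A / c2 / c1\<^sup>2"
    have M: "0 \<le> M" using A_ge c1 c2 by (simp add: M_def)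
    \<comment> \<open>The factor 1000 comes from applying the Carleson estimate to balls of radius
      \<open>10 * R\<close>; absolute value and 1 make the constant positive.\<close>
    define D where "D = \<bar>M * (\<Sum>u\<in>N. C u) * 1000\<bar> + 1"
    have main: "(\<integral>\<^sup>+ r\<in>{0<..<R}. hausdorff 3 {p \<in> E \<inter> ball p0 R. \<not> tau_symmetric \<tau>0 E p r} / ennreal r \<partial>lborel)
      \<le> ennreal (D * R ^ 3)" if R: "0 < R" for p0 R
    proof -
      \<comment> \<open>All bad radii of one dyadic interval are merged, so that one set of points
        serves the whole interval.\<close>
      define S where "S j = {p \<in> E \<inter> ball p0 R. \<exists>r. sc j \<le> r \<and> r < 2 * sc j \<and> \<not> tau_symmetric \<tau> E p r}" for j
      have S_le: "hausdorff 3 (S j) \<le> ennreal (M * (\<Sum>u\<in>N. en u p0 (10 * R) j))" if j: "sc j \<le> R" for j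
      proof -
        define g where "g u = {q \<in> ball p0 (4 * R). c1 \<le> \<bar>cutoff (psi u \<rho>) p0 (10 * R) j q\<bar>}" for u
        define G where "G = (\<Union>u\<in>N. g u)"
        have g: "g u \<in> sets borel" "measure ?\<mu> (g u) * c1\<^sup>2 \<le> en u p0 (10 * R) j" if "u \<in> N" for u
          using chebyshev_cutoff[OF bump[OF that] c1, of "4 * R" "10 * R" p0 j] R
          by (simp_all add: g_def en_def)
        have gfin: "emeasure ?\<mu> X \<noteq> \<infinity>" if "X \<subseteq> ball p0 (4 * R)" for X
          using emeasure_ball_finite[of p0 "4 * R"] emeasure_mono[OF that, of ?\<mu>] by (auto simp: less_top top_unique)
        have G: "G \<in> sets borel" unfolding G_def using g N(1) by (intro sets.finite_UN) auto
        have "hausdorff 3 (S j) \<le> ennreal (216 * A / c2 * measure ?\<mu> (G \<inter> ball p0 (R + 3 * sc j)))"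
        proof (rule hausdorff_le_of_dense[OF reg _ _ _ c2 G])
          fix p assume "p \<in> S j"
          then obtain r where "p \<in> E" "p \<in> ball p0 R" "sc j \<le> r" "r < 2 * sc j" "\<not> tau_symmetric \<tau> E p r"
            by (auto simp: S_def)
          then show "c2 * sc j ^ 3 \<le> measure ?\<mu> (G \<inter> ball p (3 * sc j))"
            unfolding c2_def
            by (intro nonsymmetric_dense[OF assms(1) reg A1 \<tau>(1,2) \<rho>_def \<eta>_def N(2,3) refl j _ _ _ _ _ c1_def])
              (use G in \<open>auto simp: G_def g_def\<close>)
        qed (auto simp: S_def)
        also have "\<dots> \<le> ennreal (M * (\<Sum>u\<in>N. en u p0 (10 * R) j))"
        proof (rule ennreal_leI)
          have "measure ?\<mu> (G \<inter> ball p0 (R + 3 * sc j)) \<le> measure ?\<mu> G"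
          proof (rule measure_mono_fmeasurable)
            have "G \<subseteq> ball p0 (4 * R)" by (auto simp: G_def g_def)
            then show "G \<in> fmeasurable ?\<mu>" using G gfin by (simp add: fmeasurable_def less_top)
          qed (use G in auto)
          also have "\<dots> \<le> (\<Sum>u\<in>N. measure ?\<mu> (g u))"
            unfolding G_def
          proof (rule measure_subadditive_finite[OF N(1)])
            show "g ` N \<subseteq> sets ?\<mu>" using g by auto
            have "g u \<subseteq> ball p0 (4 * R)" for u by (auto simp: g_def)
            then show "emeasure ?\<mu> (g u) \<noteq> \<infinity>" for u by (rule gfin)
          qed
          also have "\<dots> \<le> (\<Sum>u\<in>N. en u p0 (10 * R) j / c1\<^sup>2)"
            using g(2) c1 by (intro sum_mono) (simp add: pos_le_divide_eq)
          also have "\<dots> = (\<Sum>u\<in>N. en u p0 (10 * R) j) / c1\<^sup>2"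
            by (simp add: sum_divide_distrib)
          finally have "216 * A / c2 * measure ?\<mu> (G \<inter> ball p0 (R + 3 * sc j))
             \<le> 216 * A / c2 * ((\<Sum>u\<in>N. en u p0 (10 * R) j) / c1\<^sup>2)"
            using A_ge c2 by (intro mult_left_mono) auto
          then show "216 * A / c2 * measure ?\<mu> (G \<inter> ball p0 (R + 3 * sc j)) \<le> M * (\<Sum>u\<in>N. en u p0 (10 * R) j)"
            by (simp add: M_def)
        qed
        finally show ?thesis .
      qed
      have en0: "0 \<le> en u p0 (10 * R) j" for u j unfolding en_def by (intro integral_nonneg_AE) auto
      show ?thesis
      proof (rule nn_integral_dyadic_le[OF R])
        fix r j assume "0 < r" "r < R" "sc j \<le> r" "r < 2 * sc j"
        then show "hausdorff 3 {p \<in> E \<inter> ball p0 R. \<not> tau_symmetric \<tau>0 E p r} \<le> hausdorff 3 (S j)"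
          using tau_symmetric_mono[OF _ \<tau>(3)] by (intro hausdorff_mono) (auto simp: S_def)
      next
        fix n
        let ?J = "\<lfloor>log 2 R\<rfloor>"
        have J: "sc (?J - int i) \<le> R" for i using sc_floor(1)[OF R] sc_le[of "?J - int i" ?J] by linarith
        have "(\<Sum>i<n. hausdorff 3 (S (?J - int i))) \<le> (\<Sum>i<n. ennreal (M * (\<Sum>u\<in>N. en u p0 (10 * R) (?J - int i))))"
          by (intro sum_mono S_le J)
        also have "\<dots> = ennreal (\<Sum>i<n. M * (\<Sum>u\<in>N. en u p0 (10 * R) (?J - int i)))"
          using M en0 by (intro sum_ennreal) (auto intro!: mult_nonneg_nonneg sum_nonneg)
        also have "\<dots> \<le> ennreal (D * R ^ 3)"
        proof (rule ennreal_leI)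
          have "(\<Sum>i<n. en u p0 (10 * R) (?J - int i)) \<le> C u * (10 * R) ^ 3" if u: "u \<in> N" for u
          proof -
            have "(\<Sum>i<n. en u p0 (10 * R) (?J - int i)) = (\<Sum>j\<in>(\<lambda>i. ?J - int i) ` {..<n}. en u p0 (10 * R) j)"
              by (subst sum.reindex) (auto simp: inj_on_def)
            \<comment> \<open>Norms in \<open>N\<close> are at most 4, so 2/3 * 4 * R stays below
              the limit 20 R in \<open>scales\<close>. The lower end moves with \<open>n\<close>,
              but the Carleson constant does not depend on it.\<close>
            also have "\<dots> \<le> (\<Sum>j\<in>scales (2 / 3 * hnorm u) (10 * R) (?J - int n). en u p0 (10 * R) j)"
            proof (rule sum_mono2[OF finite_scales[OF bump[OF u]]])
              have "2 / 3 * hnorm u * sc (?J - int i) < 2 * (10 * R)" for i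
              proof -
                have "2 / 3 * hnorm u * sc (?J - int i) \<le> 2 / 3 * 4 * R"
                  using u N(2) J[of i] R by (intro mult_mono) auto
                then show ?thesis using R by simp
              qed
              then show "(\<lambda>i. ?J - int i) ` {..<n} \<subseteq> scales (2 / 3 * hnorm u) (10 * R) (?J - int n)"
                unfolding scales_def[OF bump[OF u]] by (auto simp del: times_divide_eq_left)
            qed (rule en0)
            also have "\<dots> \<le> C u * (10 * R) ^ 3" using u R by (intro C) auto
            finally show ?thesis .
          qed
          then have "(\<Sum>u\<in>N. \<Sum>i<n. en u p0 (10 * R) (?J - int i)) \<le> (\<Sum>u\<in>N. C u * (10 * R) ^ 3)"
            by (rule sum_mono)
          then have "M * (\<Sum>u\<in>N. \<Sum>i<n. en u p0 (10 * R) (?J - int i)) \<le> M * (\<Sum>u\<in>N. C u * (10 * R) ^ 3)"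
            using M by (rule mult_left_mono)
          also have "M * (\<Sum>u\<in>N. \<Sum>i<n. en u p0 (10 * R) (?J - int i)) = (\<Sum>i<n. M * (\<Sum>u\<in>N. en u p0 (10 * R) (?J - int i)))"
            by (subst sum.swap) (simp add: sum_distrib_left)
          also have "M * (\<Sum>u\<in>N. C u * (10 * R) ^ 3) = M * (\<Sum>u\<in>N. C u) * 1000 * R ^ 3"
            by (simp add: power_mult_distrib flip: sum_distrib_right)
          also have "\<dots> \<le> D * R ^ 3"
            using R by (intro mult_right_mono) (auto simp: D_def)
          finally show "(\<Sum>i<n. M * (\<Sum>u\<in>N. en u p0 (10 * R) (?J - int i))) \<le> D * R ^ 3" .
        qed
        finally show "(\<Sum>i<n. hausdorff 3 (S (?J - int i))) \<le> ennreal (D * R ^ 3)" .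
      qed
    qed
    have "0 < D" by (simp add: D_def)
    with main show "\<exists>C>0. \<forall>p0\<in>E. \<forall>R>0.
      (\<integral>\<^sup>+ r\<in>{0<..<R}. hausdorff 3 {p \<in> E \<inter> ball p0 R. \<not> tau_symmetric \<tau>0 E p r} / ennreal r \<partial>lborel)
        \<le> ennreal (C * R ^ 3)" by blast
  qed
qed

end
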